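(* Let $\hat R_{VV}=\tau_{VV}\circ\tilde f^{1/2}\circ\Theta\circ\tilde f^{1/2}\colon V\otimes V\to V\otimes V$ be the $U_q(\mathfrak{sl}(V))$-module isomorphism given by the universal $R$-matrix, for the first fundamental $U_q(\mathfrak{sl}(V))$-module $V$ (all defined in the context). Then $\hat R_{VV}=\tau_{VV}\circ R_0$ and $\hat R_{VV}^{-1}=\tau_{VV}\circ R_\infty$, where $$R_0=\mathrm I+(q^{-1/2}-q^{1/2})\sum_{i=1}^N(-1)^{\bar i}q^{-(\varepsilon_i,\varepsilon_i)/2}E_{ii}\otimes E_{ii}+(q^{-1}-q)\sum_{i<j}(-1)^{\bar j}E_{ij}\otimes E_{ji},$$ $$R_\infty=\mathrm I+(q^{1/2}-q^{-1/2})\sum_{i=1}^N(-1)^{\bar i}q^{(\varepsilon_i,\varepsilon_i)/2}E_{ii}\otimes E_{ii}+(q-q^{-1})\sum_{i>j}(-1)^{\bar j}E_{ij}\otimes E_{ji}.$$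
   Context: **Setup.** Fix integers $m,n\ge0$ with $N=m+n>2$, and $K=\mathbb C(q^{1/2})$. $V$ is a superspace over $K$ with homogeneous basis $v_1,\dots,v_N$, $m$ of them even and $n$ odd, of parities $\bar i\in\{0,1\}$ in any order. $E_{ij}$ are matrix units, of parity $\bar i+\bar j$. Tensor products are graded: $(x\otimes y)(x'\otimes y')=(-1)^{|y||x'|}xx'\otimes yy'$, $(X\otimes Y)(v\otimes w)=(-1)^{|Y||v|}Xv\otimes Yw$; $\tau(x\otimes y)=(-1)^{|x||y|}y\otimes x$, and $\tau_{VV}$ is $\tau$ on $V\otimes V$. $\varepsilon_1,\dots,\varepsilon_N$ are linearly independent with $(\varepsilon_i,\varepsilon_j)=\delta_{ij}(-1)^{\bar i}$; $\alpha_i=\varepsilon_i-\varepsilon_{i+1}$ ($1\le i<N$), of parity $\bar i+\overline{i+1}$; $a_{ij}=(\alpha_i,\alpha_j)$. **Algebra.** $U_q(\mathfrak{sl}(V))$ is the $K$-superalgebra generated by $e_i,f_i,q^{\pm h_i/2}$ ($1\le i<N$), $|e_i|=|f_i|$ the parity of $\alpha_i$, $|q^{\pm h_i/2}|=0$, with relations: the $q^{\pm h_i/2}$ commute, $q^{\pm h_i/2}q^{\mp h_i/2}=1$, $q^{h_i/2}e_jq^{-h_i/2}=q^{a_{ij}/2}e_j$, $q^{h_i/2}f_jq^{-h_i/2}=q^{-a_{ij}/2}f_j$, $e_if_j-(-1)^{|e_i||f_j|}f_je_i=\delta_{ij}\frac{q^{h_i}-q^{-h_i}}{q-q^{-1}}$,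 and, with $[\![a,b]\!]=ab-(-1)^{|a||b|}q^{(\deg a,\deg b)}ba$ ($\deg e_i=\alpha_i$, $\deg f_i=-\alpha_i$): $[\![e_i,e_j]\!]=0$ if $a_{ij}=0$; $[\![e_i,[\![e_i,e_j]\!]]\!]=0$ if $j=i\pm1$ and $\alpha_i$ is even; $[\![[\![[\![e_{i-1},e_i]\!],e_{i+1}]\!],e_i]\!]=0$ if $\alpha_i$ is odd; and the same three relations with all $e$'s replaced by $f$'s. Coproduct: $\Delta(e_i)=q^{h_i/2}\otimes e_i+e_i\otimes q^{-h_i/2}$, $\Delta(f_i)=q^{h_i/2}\otimes f_i+f_i\otimes q^{-h_i/2}$, $\Delta(q^{\pm h_i/2})=q^{\pm h_i/2}\otimes q^{\pm h_i/2}$. **Module $V$.** $\varrho(e_i)=E_{i,i+1}$, $\varrho(f_i)=(-1)^{\bar i}E_{i+1,i}$, $\varrho(q^{\pm h_i/2})=q^{\pm\mathsf h_i/2}$ with $\mathsf h_i=(-1)^{\bar i}E_{ii}-(-1)^{\overline{i+1}}E_{i+1,i+1}$ (for diagonal $D=\mathrm{diag}(d_k)$, $q^D=\mathrm{diag}(q^{d_k})$). $v_j$ has weight $\varepsilon_j$. **Universal intertwiner.** $U^+,U^-$ are the subalgebras generated by the $e_i$, resp. $f_i$; $U^\ge,U^\le$ those generated by these and all $q^{\pm h_i/2}$. $\Delta^J(e_i)=q^{h_i}\otimes e_i+e_i\otimes1$, $\Delta^J(f_i)=1\otimes f_i+f_i\otimes q^{-h_i}$, $\Delta^J(q^{\pm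 h_i/2})=q^{\pm h_i/2}\otimes q^{\pm h_i/2}$, $\Delta^{J,\mathrm{op}}=\tau\circ\Delta^J$. There is a unique bilinear bialgebra pairing $(\cdot,\cdot)_J\colon U^\le\times U^\ge\to\mathbb C(q^{1/4})$ with $(yy',x)_J=(y\otimes y',\Delta^J(x))_J$, $(y,xx')_J=(\Delta^{J,\mathrm{op}}(y),x\otimes x')_J$, where $(y\otimes y',x\otimes x')_J=(-1)^{|y'||x|}(y,x)_J(y',x')_J$, and $(f_i,q^{\pm h_j/2})_J=0=(q^{\pm h_j/2},e_i)_J$, $(f_i,e_j)_J=\frac{\delta_{ij}(-1)^{|f_i||e_j|}}{q^{-1}-q}$, $(q^{h_i/2},q^{h_j/2})_J=q^{-a_{ij}/4}$; it is non-degenerate on $U^-_{-\mu}\times U^+_\mu$. With $\{x_i^\mu\},\{y_i^\mu\}$ dual bases of $U^+_\mu,U^-_{-\mu}$, $\Theta=1+\sum_{\mu>0}\sum_ix_i^\mu\otimes y_i^\mu$. $\tilde f^{1/2}(v_i\otimes v_j)=q^{-(\varepsilon_i,\varepsilon_j)/2}v_i\otimes v_j$. The map $\hat R_{VV}=\tau_{VV}\circ\tilde f^{1/2}\circ\Theta\circ\tilde f^{1/2}$ is a $U_q(\mathfrak{sl}(V))$-module isomorphism. *)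

theory Defs
  imports
    "HOL-Algebra.Embedded_Algebras"
    "HOL-Algebra.QuotRing"
    "HOL-Computational_Algebra.Fraction_Field"
    "HOL-Computational_Algebra.Polynomial"
    "HOL-Library.Poly_Mapping"
    Complex_Main
begin

section \<open>Scalars\<close>

text \<open>The fields $\mathbb{C}(q^{1/2})$ and $\mathbb{C}(q^{1/4})$ are both fields of rational
  functions in one variable, hence the same type; they differ in what the variable stands for.
  The inclusion of the first into the second is the map \<open>emb\<close>, which is not the identity
  but substitutes the square of the variable for the variable.\<close>

type_synonym K = "complex poly fract"   (* variable: q^(1/2) *)
type_synonym L = "complex poly fract"   (* variable: q^(1/4) *)

definition qhalf :: K where "qhalf = Fract [:0, 1:] 1"
definition qquart :: L where "qquart = Fract [:0, 1:] 1"

lift_definition emb :: "K \<Rightarrow> L" is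
  "\<lambda>r. (pcompose (fst r) [:0, 0, 1:], pcompose (snd r) [:0, 0, 1:])"
proof -
  fix r r' :: "complex poly \<times> complex poly"
  assume a: "fractrel r r'"
  have nz: "pcompose s [:0, 0, 1:] \<noteq> 0" if "s \<noteq> 0" for s :: "complex poly"
    using that by (simp add: pcompose_eq_0_iff)
  from a have "fst r * snd r' = fst r' * snd r"
    by (simp add: fractrel_def)
  then have "pcompose (fst r) [:0, 0, 1:] * pcompose (snd r') [:0, 0, 1:]
      = pcompose (fst r') [:0, 0, 1:] * pcompose (snd r) [:0, 0, 1::complex:]"
    by (simp flip: pcompose_mult)
  with a show "fractrel (pcompose (fst r) [:0, 0, 1:], pcompose (snd r) [:0, 0, 1:])
      (pcompose (fst r') [:0, 0, 1:], pcompose (snd r') [:0, 0, 1:])"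
    by (simp add: fractrel_def nz)
qed

lemma emb_Fract:
  assumes "b \<noteq> 0"
  shows "emb (Fract a b) = Fract (pcompose a [:0, 0, 1:]) (pcompose b [:0, 0, 1:])"
proof -
  have "pcompose b [:0, 0, 1:] \<noteq> 0"
    using assms by (simp add: pcompose_eq_0_iff)
  with assms show ?thesis
    by (simp add: Fract.abs_eq emb.abs_eq fractrel_def)
qed

lemma emb_qhalf: "emb qhalf = qquart ^ 2"
proof -
  have "pcompose [:0, 1:] [:0, 0, 1:] = [:0, 1:] * [:0, 1::complex:]"
    by (simp add: pcompose_pCons)
  moreover have "pcompose 1 [:0, 0, 1:] = (1 :: complex poly)"
    by (simp add: one_pCons pcompose_pCons)
  ultimately show ?thesis
    unfolding qhalf_def qquart_def power2_eq_square
    by (simp only: emb_Fract[OF one_neq_zero] mult_fract mult_1)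
qed

text \<open>The power $q^{a/2}$ for an integer \<open>a\<close>.\<close>

abbreviation qh :: "int \<Rightarrow> K" where "qh a \<equiv> qhalf powi a"


section \<open>Vector spaces with a given basis\<close>

text \<open>The space with basis \<open>'a\<close> is \<open>'a \<Rightarrow>\<^sub>0 K\<close>, with basis vectors
  \<open>Poly_Mapping.single a 1\<close>.\<close>

abbreviation bas :: "'a \<Rightarrow> ('a \<Rightarrow>\<^sub>0 K)" where
  "bas a \<equiv> Poly_Mapping.single a 1"

abbreviation coef :: "('a \<Rightarrow>\<^sub>0 'b::zero) \<Rightarrow> 'a \<Rightarrow> 'b" where
  "coef \<equiv> Poly_Mapping.lookup"

abbreviation scal :: "K \<Rightarrow> ('a \<Rightarrow>\<^sub>0 K) \<Rightarrow> ('a \<Rightarrow>\<^sub>0 K)" (infixr \<open>\<cdot>\<close> 75) where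
  "c \<cdot> x \<equiv> Poly_Mapping.map ((*) c) x"

definition linext :: "('a \<Rightarrow> ('b \<Rightarrow>\<^sub>0 K)) \<Rightarrow> ('a \<Rightarrow>\<^sub>0 K) \<Rightarrow> ('b \<Rightarrow>\<^sub>0 K)" where
  "linext h x = (\<Sum>a\<in>Poly_Mapping.keys x. coef x a \<cdot> h a)"

definition ptens :: "('a \<Rightarrow>\<^sub>0 K) \<Rightarrow> ('b \<Rightarrow>\<^sub>0 K) \<Rightarrow> ('a \<times> 'b \<Rightarrow>\<^sub>0 K)" where
  "ptens x y = linext (\<lambda>a. linext (\<lambda>b. bas (a, b)) y) x"

definition flip :: "('a \<Rightarrow> nat) \<Rightarrow> ('a \<times> 'a \<Rightarrow>\<^sub>0 K) \<Rightarrow> ('a \<times> 'a \<Rightarrow>\<^sub>0 K)" where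
  "flip par = linext (\<lambda>(a, b). (-1) ^ (par a * par b) \<cdot> bas (b, a))"


section \<open>Weights\<close>

text \<open>Throughout, the basis of the superspace is indexed by \<open>{1..N}\<close> and \<open>p i\<close>
  is the parity of the \<open>i\<close>-th basis vector. A weight is given by its coordinates with
  respect to the $\varepsilon_i$.\<close>

type_synonym weight = "nat \<Rightarrow> int"

definition eps :: "nat \<Rightarrow> weight" where
  "eps i = (\<lambda>k. if k = i then 1 else 0)"

definition alpha :: "nat \<Rightarrow> weight" where
  "alpha i = (\<lambda>k. eps i k - eps (i + 1) k)"

definition bil :: "nat \<Rightarrow> (nat \<Rightarrow> nat) \<Rightarrow> weight \<Rightarrow> weight \<Rightarrow> int" where
  "bil N p \<mu> \<nu> = (\<Sum>k = 1..N. (-1) ^ p k * \<mu> k * \<nu> k)"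

abbreviation cartan :: "nat \<Rightarrow> (nat \<Rightarrow> nat) \<Rightarrow> nat \<Rightarrow> nat \<Rightarrow> int" where
  "cartan N p i j \<equiv> bil N p (alpha i) (alpha j)"

text \<open>The weights $\mu > 0$: nonzero combinations of simple roots with coefficients in
  $\mathbb{N}$.\<close>

definition Qpos :: "nat \<Rightarrow> weight set" where
  "Qpos N = {\<mu>. \<exists>c :: nat \<Rightarrow> nat. \<mu> = (\<lambda>k. \<Sum>i = 1..<N. int (c i) * alpha i k)} - {\<lambda>_. 0}"


section \<open>The quantum superalgebra\<close>

text \<open>\<open>GK i\<close> and \<open>GKi i\<close> stand for $q^{h_i/2}$ and $q^{-h_i/2}$.\<close>

datatype gen = GE nat | GF nat | GK nat | GKi nat

text \<open>The free algebra on a set of letters is the monoid algebra of the free monoid; the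
  following instance provides its multiplication.\<close>

instantiation list :: (type) monoid_add
begin
definition plus_list :: "'a list \<Rightarrow> 'a list \<Rightarrow> 'a list" where "plus_list u v = u @ v"
definition zero_list :: "'a list" where "zero_list = []"
instance by standard (simp_all add: plus_list_def zero_list_def)
end

type_synonym falg = "gen list \<Rightarrow>\<^sub>0 K"

definition Egens :: "nat \<Rightarrow> gen set" where "Egens N = GE ` {1..<N}"
definition Fgens :: "nat \<Rightarrow> gen set" where "Fgens N = GF ` {1..<N}"
definition Kgens :: "nat \<Rightarrow> gen set" where "Kgens N = GK ` {1..<N} \<union> GKi ` {1..<N}"

definition free_on :: "gen set \<Rightarrow> falg set" where
  "free_on S = {x. Poly_Mapping.keys x \<subseteq> lists S}"

definition free_alg :: "nat \<Rightarrow> falg ring" where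
  "free_alg N = \<lparr>carrier = free_on (Egens N \<union> Fgens N \<union> Kgens N),
     monoid.mult = (*), one = 1, zero = 0, add = (+)\<rparr>"

abbreviation ltr :: "gen \<Rightarrow> falg" where "ltr a \<equiv> bas [a]"

fun gpar :: "(nat \<Rightarrow> nat) \<Rightarrow> gen \<Rightarrow> nat" where
  "gpar p (GE i) = p i + p (i + 1)"
| "gpar p (GF i) = p i + p (i + 1)"
| "gpar p (GK i) = 0"
| "gpar p (GKi i) = 0"

fun gdeg :: "gen \<Rightarrow> weight" where
  "gdeg (GE i) = alpha i"
| "gdeg (GF i) = (\<lambda>k. - alpha i k)"
| "gdeg (GK i) = (\<lambda>k. 0)"
| "gdeg (GKi i) = (\<lambda>k. 0)"

text \<open>Parities are only used as exponents of \<open>-1\<close>, so they need not be reduced modulo 2.\<close>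

definition wpar :: "(nat \<Rightarrow> nat) \<Rightarrow> gen list \<Rightarrow> nat" where
  "wpar p w = (\<Sum>a\<leftarrow>w. gpar p a)"

definition wdeg :: "gen list \<Rightarrow> weight" where
  "wdeg w = (\<lambda>k. \<Sum>a\<leftarrow>w. gdeg a k)"

text \<open>The bracket $ab - (-1)^{|a||b|} q^{(\deg a, \deg b)} ba$ of homogeneous elements, extended
  bilinearly from words.\<close>

definition qbr :: "nat \<Rightarrow> (nat \<Rightarrow> nat) \<Rightarrow> falg \<Rightarrow> falg \<Rightarrow> falg" where
  "qbr N p a b = a * b - linext (\<lambda>u. linext (\<lambda>v.
     ((-1) ^ (wpar p u * wpar p v) * qh (2 * bil N p (wdeg u) (wdeg v))) \<cdot> bas (v @ u)) b) a"

text \<open>An element \<open>r\<close> stands for the relation \<open>r = 0\<close>.\<close>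

inductive_set relators :: "nat \<Rightarrow> (nat \<Rightarrow> nat) \<Rightarrow> falg set" for N :: nat and p :: "nat \<Rightarrow> nat" where
  K_comm: "a \<in> Kgens N \<Longrightarrow> b \<in> Kgens N \<Longrightarrow> ltr a * ltr b - ltr b * ltr a \<in> relators N p"
| K_inv1: "i \<in> {1..<N} \<Longrightarrow> ltr (GK i) * ltr (GKi i) - 1 \<in> relators N p"
| K_inv2: "i \<in> {1..<N} \<Longrightarrow> ltr (GKi i) * ltr (GK i) - 1 \<in> relators N p"
| K_E: "i \<in> {1..<N} \<Longrightarrow> j \<in> {1..<N} \<Longrightarrow>
    ltr (GK i) * ltr (GE j) * ltr (GKi i) - qh (cartan N p i j) \<cdot> ltr (GE j) \<in> relators N p"
| K_F: "i \<in> {1..<N} \<Longrightarrow> j \<in> {1..<N} \<Longrightarrow>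
    ltr (GK i) * ltr (GF j) * ltr (GKi i) - qh (- cartan N p i j) \<cdot> ltr (GF j) \<in> relators N p"
| E_F: "i \<in> {1..<N} \<Longrightarrow> j \<in> {1..<N} \<Longrightarrow>
    ltr (GE i) * ltr (GF j) - (-1) ^ (gpar p (GE i) * gpar p (GF j)) \<cdot> (ltr (GF j) * ltr (GE i))
      - (if i = j then inverse (qh 2 - qh (-2)) \<cdot> (ltr (GK i) ^ 2 - ltr (GKi i) ^ 2) else 0)
    \<in> relators N p"
| Serre2: "X \<in> {GE, GF} \<Longrightarrow> i \<in> {1..<N} \<Longrightarrow> j \<in> {1..<N} \<Longrightarrow> cartan N p i j = 0 \<Longrightarrow>
    qbr N p (ltr (X i)) (ltr (X j)) \<in> relators N p"
| Serre3: "X \<in> {GE, GF} \<Longrightarrow> i \<in> {1..<N} \<Longrightarrow> j \<in> {1..<N} \<Longrightarrow> j = i + 1 \<or> i = j + 1 \<Longrightarrow>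
    even (gpar p (X i)) \<Longrightarrow>
    qbr N p (ltr (X i)) (qbr N p (ltr (X i)) (ltr (X j))) \<in> relators N p"
| Serre4: "X \<in> {GE, GF} \<Longrightarrow> i - 1 \<in> {1..<N} \<Longrightarrow> i + 1 \<in> {1..<N} \<Longrightarrow> odd (gpar p (X i)) \<Longrightarrow>
    qbr N p (qbr N p (qbr N p (ltr (X (i - 1))) (ltr (X i))) (ltr (X (i + 1)))) (ltr (X i))
    \<in> relators N p"

definition rel_ideal :: "nat \<Rightarrow> (nat \<Rightarrow> nat) \<Rightarrow> falg set" where
  "rel_ideal N p = Idl\<^bsub>free_alg N\<^esub> (relators N p)"

definition Uq :: "nat \<Rightarrow> (nat \<Rightarrow> nat) \<Rightarrow> falg set ring" where
  "Uq N p = free_alg N Quot rel_ideal N p"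

definition quo :: "nat \<Rightarrow> (nat \<Rightarrow> nat) \<Rightarrow> falg \<Rightarrow> falg set" where
  "quo N p x = rel_ideal N p +>\<^bsub>free_alg N\<^esub> x"

text \<open>The copy of the base field inside \<open>Uq N p\<close>, which makes the latter an algebra.\<close>

definition Kscalars :: "nat \<Rightarrow> (nat \<Rightarrow> nat) \<Rightarrow> falg set set" where
  "Kscalars N p = range (\<lambda>c. quo N p (c \<cdot> 1))"

text \<open>The homogeneous components of degree \<open>\<mu>\<close> of the subalgebras generated by the $e_i$ and
  by the $f_i$.\<close>

definition Uplus :: "nat \<Rightarrow> (nat \<Rightarrow> nat) \<Rightarrow> weight \<Rightarrow> falg set set" where
  "Uplus N p \<mu> = quo N p ` {x \<in> free_on (Egens N). \<forall>w \<in> Poly_Mapping.keys x. wdeg w = \<mu>}"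

definition Uminus :: "nat \<Rightarrow> (nat \<Rightarrow> nat) \<Rightarrow> weight \<Rightarrow> falg set set" where
  "Uminus N p \<mu> = quo N p ` {x \<in> free_on (Fgens N). \<forall>w \<in> Poly_Mapping.keys x. wdeg w = \<mu>}"


section \<open>Coproduct and pairing\<close>

text \<open>Elements of the tensor square of \<open>Uq N p\<close> are represented in the tensor square of
  the free algebra, which has the pairs of words as a basis. The coproduct $\Delta^J$ is the
  superalgebra homomorphism on the free algebra that lifts the one on \<open>Uq N p\<close>.\<close>

definition tmult :: "(nat \<Rightarrow> nat) \<Rightarrow> (gen list \<times> gen list \<Rightarrow>\<^sub>0 K) \<Rightarrow>
    (gen list \<times> gen list \<Rightarrow>\<^sub>0 K) \<Rightarrow> (gen list \<times> gen list \<Rightarrow>\<^sub>0 K)" where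
  "tmult p A B = linext (\<lambda>(x, y). linext (\<lambda>(x', y').
     (-1) ^ (wpar p y * wpar p x') \<cdot> bas (x @ x', y @ y')) B) A"

fun DeltaJ_gen :: "gen \<Rightarrow> (gen list \<times> gen list \<Rightarrow>\<^sub>0 K)" where
  "DeltaJ_gen (GE i) = bas ([GK i, GK i], [GE i]) + bas ([GE i], [])"
| "DeltaJ_gen (GF i) = bas ([], [GF i]) + bas ([GF i], [GKi i, GKi i])"
| "DeltaJ_gen (GK i) = bas ([GK i], [GK i])"
| "DeltaJ_gen (GKi i) = bas ([GKi i], [GKi i])"

fun DeltaJ_word :: "(nat \<Rightarrow> nat) \<Rightarrow> gen list \<Rightarrow> (gen list \<times> gen list \<Rightarrow>\<^sub>0 K)" where
  "DeltaJ_word p [] = bas ([], [])"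
| "DeltaJ_word p (a # w) = tmult p (DeltaJ_gen a) (DeltaJ_word p w)"

definition DeltaJ :: "(nat \<Rightarrow> nat) \<Rightarrow> falg \<Rightarrow> (gen list \<times> gen list \<Rightarrow>\<^sub>0 K)" where
  "DeltaJ p = linext (DeltaJ_word p)"

definition DeltaJop :: "(nat \<Rightarrow> nat) \<Rightarrow> falg \<Rightarrow> (gen list \<times> gen list \<Rightarrow>\<^sub>0 K)" where
  "DeltaJop p = flip (wpar p) \<circ> DeltaJ p"

text \<open>The bilinear extension of
  $(y \otimes y', x \otimes x')_J = (-1)^{|y'||x|} (y, x)_J (y', x')_J$.\<close>

definition pair2 :: "nat \<Rightarrow> (nat \<Rightarrow> nat) \<Rightarrow> (falg set \<Rightarrow> falg set \<Rightarrow> L) \<Rightarrow>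
    (gen list \<times> gen list \<Rightarrow>\<^sub>0 K) \<Rightarrow> (gen list \<times> gen list \<Rightarrow>\<^sub>0 K) \<Rightarrow> L" where
  "pair2 N p J Y X = (\<Sum>(y, y') \<in> Poly_Mapping.keys Y. \<Sum>(x, x') \<in> Poly_Mapping.keys X.
     emb (coef Y (y, y')) * emb (coef X (x, x')) * (-1) ^ (wpar p y' * wpar p x) *
     J (quo N p (bas y)) (quo N p (bas x)) * J (quo N p (bas y')) (quo N p (bas x')))"

text \<open>The bialgebra pairing of $U^{\le}$ (generated by the $f_i$ and $q^{\pm h_i/2}$) with
  $U^{\ge}$ (generated by the $e_i$ and $q^{\pm h_i/2}$). The function \<open>J\<close> is applied to
  elements of \<open>Uq N p\<close>; its values outside $U^{\le} \times U^{\ge}$ are irrelevant. That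
  \<open>J\<close> is compatible with units and counits follows from the clauses below.\<close>

definition bialgebra_pairing ::
    "nat \<Rightarrow> (nat \<Rightarrow> nat) \<Rightarrow> (falg set \<Rightarrow> falg set \<Rightarrow> L) \<Rightarrow> bool" where
  "bialgebra_pairing N p J \<longleftrightarrow>
    (let Fle = free_on (Fgens N \<union> Kgens N); Fge = free_on (Egens N \<union> Kgens N);
         B = (\<lambda>y x. J (quo N p y) (quo N p x)) in
      (\<forall>y\<in>Fle. \<forall>y'\<in>Fle. \<forall>x\<in>Fge. B (y + y') x = B y x + B y' x) \<and>
      (\<forall>y\<in>Fle. \<forall>x\<in>Fge. \<forall>x'\<in>Fge. B y (x + x') = B y x + B y x') \<and>
      (\<forall>c. \<forall>y\<in>Fle. \<forall>x\<in>Fge. B (c \<cdot> y) x = emb c * B y x \<and> B y (c \<cdot> x) = emb c * B y x) \<and>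
      (\<forall>y\<in>Fle. \<forall>y'\<in>Fle. \<forall>x\<in>Fge. B (y * y') x = pair2 N p J (ptens y y') (DeltaJ p x)) \<and>
      (\<forall>y\<in>Fle. \<forall>x\<in>Fge. \<forall>x'\<in>Fge. B y (x * x') = pair2 N p J (DeltaJop p y) (ptens x x')) \<and>
      (\<forall>i\<in>{1..<N}. \<forall>j\<in>{1..<N}.
         B (ltr (GF i)) (ltr (GK j)) = 0 \<and> B (ltr (GF i)) (ltr (GKi j)) = 0 \<and>
         B (ltr (GK j)) (ltr (GE i)) = 0 \<and> B (ltr (GKi j)) (ltr (GE i)) = 0 \<and>
         B (ltr (GF i)) (ltr (GE j)) =
           (if i = j then (-1) ^ (gpar p (GF i) * gpar p (GE j)) / emb (qh (-2) - qh 2) else 0) \<and>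
         B (ltr (GK i)) (ltr (GK j)) = qquart powi (- cartan N p i j)))"

text \<open>For every \<open>\<mu> \<in> Qpos N\<close>, \<open>x \<mu>\<close> and \<open>y \<mu>\<close> are (finite, ordered) bases
  of $U^+_{\mu}$ and $U^-_{-\mu}$, dual to each other with respect to \<open>J\<close>.\<close>

definition dual_bases :: "nat \<Rightarrow> (nat \<Rightarrow> nat) \<Rightarrow> (falg set \<Rightarrow> falg set \<Rightarrow> L) \<Rightarrow>
    (weight \<Rightarrow> falg set list) \<Rightarrow> (weight \<Rightarrow> falg set list) \<Rightarrow> bool" where
  "dual_bases N p J x y \<longleftrightarrow> (\<forall>\<mu>\<in>Qpos N.
     ring.independent (Uq N p) (Kscalars N p) (x \<mu>) \<and>
     ring.Span (Uq N p) (Kscalars N p) (x \<mu>) = Uplus N p \<mu> \<and>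
     ring.independent (Uq N p) (Kscalars N p) (y \<mu>) \<and>
     ring.Span (Uq N p) (Kscalars N p) (y \<mu>) = Uminus N p (\<lambda>k. - \<mu> k) \<and>
     length (x \<mu>) = length (y \<mu>) \<and>
     (\<forall>i<length (y \<mu>). \<forall>j<length (x \<mu>). J (y \<mu> ! i) (x \<mu> ! j) = (if i = j then 1 else 0)))"


section \<open>The module and operators on its tensor square\<close>

type_synonym vec = "nat \<Rightarrow>\<^sub>0 K"
type_synonym vec2 = "nat \<times> nat \<Rightarrow>\<^sub>0 K"

definition VV :: "nat \<Rightarrow> vec2 set" where
  "VV N = {w. Poly_Mapping.keys w \<subseteq> {1..N} \<times> {1..N}}"

definition munit :: "nat \<Rightarrow> nat \<Rightarrow> vec \<Rightarrow> vec" where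
  "munit i j = linext (\<lambda>k. if k = j then bas i else 0)"

text \<open>The diagonal matrix $\mathsf h_i$, with \<open>k\<close>-th diagonal entry \<open>hdiag p i k\<close>.\<close>

definition hdiag :: "(nat \<Rightarrow> nat) \<Rightarrow> nat \<Rightarrow> nat \<Rightarrow> int" where
  "hdiag p i k = (if k = i then (-1) ^ p i else 0) - (if k = i + 1 then (-1) ^ p (i + 1) else 0)"

fun rho_gen :: "(nat \<Rightarrow> nat) \<Rightarrow> gen \<Rightarrow> vec \<Rightarrow> vec" where
  "rho_gen p (GE i) = munit i (i + 1)"
| "rho_gen p (GF i) = (\<lambda>v. (-1) ^ p i \<cdot> munit (i + 1) i v)"
| "rho_gen p (GK i) = linext (\<lambda>k. qh (hdiag p i k) \<cdot> bas k)"
| "rho_gen p (GKi i) = linext (\<lambda>k. qh (- hdiag p i k) \<cdot> bas k)"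

definition rho_free :: "(nat \<Rightarrow> nat) \<Rightarrow> falg \<Rightarrow> vec \<Rightarrow> vec" where
  "rho_free p x v = linext (\<lambda>w. foldr (rho_gen p) w v) x"

text \<open>An element of \<open>Uq N p\<close> is a coset, and acts through any of its representatives in the
  free algebra.\<close>

definition rho :: "(nat \<Rightarrow> nat) \<Rightarrow> falg set \<Rightarrow> vec \<Rightarrow> vec" where
  "rho p u = rho_free p (SOME x. x \<in> u)"

text \<open>The graded tensor product of operators. For homogeneous \<open>Y\<close> the sign is
  $(-1)^{|Y||v_k|}$: the component of \<open>Y\<close> that maps $v_l$ to a multiple of $v_j$ has parity
  $\bar\jmath + \bar l$.\<close>

definition otens :: "(nat \<Rightarrow> nat) \<Rightarrow> (vec \<Rightarrow> vec) \<Rightarrow> (vec \<Rightarrow> vec) \<Rightarrow> vec2 \<Rightarrow> vec2" where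
  "otens p X Y = linext (\<lambda>(k, l).
     ptens (X (bas k)) (linext (\<lambda>j. (-1) ^ ((p j + p l) * p k) \<cdot> bas j) (Y (bas l))))"

definition fhalf :: "nat \<Rightarrow> (nat \<Rightarrow> nat) \<Rightarrow> vec2 \<Rightarrow> vec2" where
  "fhalf N p = linext (\<lambda>(i, j). qh (- bil N p (eps i) (eps j)) \<cdot> bas (i, j))"

text \<open>The action of $\Theta$. Only finitely many \<open>\<mu>\<close> contribute a nonzero vector, so the sum
  over all $\mu > 0$ is a finite one.\<close>

definition Theta :: "nat \<Rightarrow> (nat \<Rightarrow> nat) \<Rightarrow> (weight \<Rightarrow> falg set list) \<Rightarrow>
    (weight \<Rightarrow> falg set list) \<Rightarrow> vec2 \<Rightarrow> vec2" where
  "Theta N p x y w = w + (\<Sum>\<mu>. if \<mu> \<in> Qpos N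
     then (\<Sum>i<length (x \<mu>). otens p (rho p (x \<mu> ! i)) (rho p (y \<mu> ! i)) w) else 0)"

definition Rhat :: "nat \<Rightarrow> (nat \<Rightarrow> nat) \<Rightarrow> (weight \<Rightarrow> falg set list) \<Rightarrow>
    (weight \<Rightarrow> falg set list) \<Rightarrow> vec2 \<Rightarrow> vec2" where
  "Rhat N p x y = flip p \<circ> fhalf N p \<circ> Theta N p x y \<circ> fhalf N p"

definition R0 :: "nat \<Rightarrow> (nat \<Rightarrow> nat) \<Rightarrow> vec2 \<Rightarrow> vec2" where
  "R0 N p w = w
     + (qh (-1) - qh 1) \<cdot> (\<Sum>i = 1..N. ((-1) ^ p i * qh (- bil N p (eps i) (eps i)))
         \<cdot> otens p (munit i i) (munit i i) w)
     + (qh (-2) - qh 2) \<cdot> (\<Sum>(i, j) \<in> {(i, j). i \<in> {1..N} \<and> j \<in> {1..N} \<and> i < j}.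
         (-1) ^ p j \<cdot> otens p (munit i j) (munit j i) w)"

definition Rinf :: "nat \<Rightarrow> (nat \<Rightarrow> nat) \<Rightarrow> vec2 \<Rightarrow> vec2" where
  "Rinf N p w = w
     + (qh 1 - qh (-1)) \<cdot> (\<Sum>i = 1..N. ((-1) ^ p i * qh (bil N p (eps i) (eps i)))
         \<cdot> otens p (munit i i) (munit i i) w)
     + (qh 2 - qh (-2)) \<cdot> (\<Sum>(i, j) \<in> {(i, j). i \<in> {1..N} \<and> j \<in> {1..N} \<and> i > j}.
         (-1) ^ p j \<cdot> otens p (munit i j) (munit j i) w)"

end

theory Submission
  imports Defs
begin

text \<open>
The summand of $\Theta$ of weight $\mu$ acts on $V \otimes V$ as zero unless
$\mu = \varepsilon_i - \varepsilon_j$ with $i < j$, because these are the only positive differences of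
weights of $V$. For such $\mu$ an element $x$ of $U^+_\mu$ acts as $a(x) E_{ij}$, where $a(x)$ is the
coefficient of the word $e_i e_{i+1} \cdots e_{j-1}$ in any representative of $x$: it is the only word
of this weight that moves $v_j$ to $v_i$. Suppose that $y \in U^-_{-\mu}$ represents the functional
$a$, that is $(y, x)_J = a(x)$ for all $x$. Expanding $y$ in the basis $y_r$ and pairing with the dual
basis $x_r$ gives $y = \sum_r a(x_r) y_r$. Hence the summand acts as
$\sum_r a(x_r) E_{ij} \otimes \varrho(y_r) = E_{ij} \otimes \varrho(y)$
(\<open>Theta_root_term\<close>).

Such a $y$ is an iterated $q$-commutator \<open>rootF\<close> of $f_i, \dots, f_{j-1}$. To pair it with a
word in the $e_a$, note that $\Delta^J(e_a)$ has only two terms. Therefore pairing $y' f_k$ or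
$f_k y'$ with a word amounts to deleting one letter $e_k$ and pairing the rest with $y'$, with a sign and
a power of $q$ that depend on the letters on one side of the deleted one (\<open>Jword_F_right\<close>,
\<open>Jword_F_left\<close>). In the $q$-commutator the deletions from all positions but the last cancel
(\<open>skew_diff_delta\<close>), and induction shows that $y$ represents $a$ (\<open>Jfree_rootF\<close>). The operator
of $y$ on $V$ is $(q^{-1} - q)(-1)^{\bar\jmath} E_{ji}$ (\<open>rho_rootF\<close>), so
\[ \Theta = 1 + (q^{-1} - q) \sum_{i<j} (-1)^{\bar\jmath} E_{ij} \otimes E_{ji} \]
on $V \otimes V$.

The argument moves freely between cosets and representatives in the free algebra. For the operators
this is justified by verifying the defining relations on $V$ (\<open>rho_relator\<close>, \<open>rho_quo\<close>). In the
pairing it supplies the commutation of $q^{h_k/2}$ with $e_b$ (\<open>K_past_E\<close>).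

What remains is a calculation on basis vectors. The maps $\tilde f^{1/2}$ change only the coefficients of
$v_k \otimes v_k$, and the two maps $\tau \circ R_0$ and $\tau \circ R_\infty$ are inverse to each
other already on the span of $v_k \otimes v_l$ and $v_l \otimes v_k$ (\<open>flip_R_inverse\<close>).
\<close>

section \<open>Linear maps between spaces with a basis\<close>

lemma coef_scal [simp]: "coef (c \<cdot> x) a = c * coef x a"
  by (simp add: Poly_Mapping.map.rep_eq when_def)

lemma scal_simps [simp]:
  "c \<cdot> (0 :: 'a \<Rightarrow>\<^sub>0 K) = 0" "0 \<cdot> (x :: 'a \<Rightarrow>\<^sub>0 K) = 0" "1 \<cdot> (x :: 'a \<Rightarrow>\<^sub>0 K) = x"
  "c \<cdot> d \<cdot> (x :: 'a \<Rightarrow>\<^sub>0 K) = (c * d) \<cdot> x"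
  "(- 1) \<cdot> (x :: 'a \<Rightarrow>\<^sub>0 K) = - x"
  "c \<cdot> (- x) = (- c) \<cdot> (x :: 'a \<Rightarrow>\<^sub>0 K)"
  by (auto intro!: poly_mapping_eqI simp: mult.assoc)

lemma scal_add: "c \<cdot> (x + y) = c \<cdot> x + c \<cdot> (y :: 'a \<Rightarrow>\<^sub>0 K)"
  and add_scal: "(c + d) \<cdot> x = c \<cdot> x + d \<cdot> (x :: 'a \<Rightarrow>\<^sub>0 K)"
  by (auto intro!: poly_mapping_eqI simp: lookup_add lookup_minus algebra_simps)

lemma scal_sum: "c \<cdot> sum f A = (\<Sum>a\<in>A. c \<cdot> (f a :: 'a \<Rightarrow>\<^sub>0 K))"
  by (induction A rule: infinite_finite_induct) (auto simp: scal_add)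

lemma single_eq_scal_bas: "Poly_Mapping.single a c = c \<cdot> bas a"
  by simp

lemma scal_eq_single_mult: "c \<cdot> (x :: falg) = Poly_Mapping.single [] c * x"
  using mult_map_scale_conv_mult[of c x] by (simp add: zero_list_def)

lemma scal_mult_left: "(c \<cdot> x) * y = c \<cdot> (x * (y :: falg))"
  by (simp add: scal_eq_single_mult mult.assoc)

lemma bas_mult: "bas u * bas v = (bas (u @ v) :: falg)"
  by (simp add: mult_single plus_list_def)

lemma one_eq_bas: "(1 :: falg) = bas []"
  by (metis single_one zero_list_def)

definition lin :: "(('a \<Rightarrow>\<^sub>0 K) \<Rightarrow> ('b \<Rightarrow>\<^sub>0 K)) \<Rightarrow> bool" where
  "lin f \<longleftrightarrow> (\<forall>x y. f (x + y) = f x + f y) \<and> (\<forall>c x. f (c \<cdot> x) = c \<cdot> f x)"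

lemma
  fixes f :: "('a \<Rightarrow>\<^sub>0 K) \<Rightarrow> ('b \<Rightarrow>\<^sub>0 K)"
  assumes "lin f"
  shows lin_add: "f (x + y) = f x + f y" and lin_scal: "f (c \<cdot> x) = c \<cdot> f x"
    and lin_zero: "f 0 = 0" and lin_diff: "f (x - y) = f x - f y"
    and lin_uminus: "f (- x) = - f x" and lin_sum: "f (sum g A) = (\<Sum>a\<in>A. f (g a))"
proof -
  show add: "f (x + y) = f x + f y" and sc: "f (c \<cdot> x) = c \<cdot> f x" for x y :: "'a \<Rightarrow>\<^sub>0 K" and c
    using assms by (auto simp: lin_def)
  show z: "f 0 = 0" using sc[of 0 0] by simp
  show um: "f (- x) = - f x" for x using sc[of "- 1" x] by simp
  show "f (x - y) = f x - f y" using add[of x "- y"] um[of y] by simp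
  show "f (sum g A) = (\<Sum>a\<in>A. f (g a))"
    by (induction A rule: infinite_finite_induct) (auto simp: add z)
qed

lemma linext_superset:
  assumes "finite S" "Poly_Mapping.keys x \<subseteq> S"
  shows "linext h x = (\<Sum>a\<in>S. coef x a \<cdot> h a)"
  unfolding linext_def using assms
  by (intro sum.mono_neutral_left) (auto simp: in_keys_iff)

lemma lin_linext: "lin (linext (h :: 'a \<Rightarrow> ('b \<Rightarrow>\<^sub>0 K)))"
  unfolding lin_def
proof (intro conjI allI)
  fix x y :: "'a \<Rightarrow>\<^sub>0 K"
  let ?S = "Poly_Mapping.keys x \<union> Poly_Mapping.keys y"
  show "linext h (x + y) = linext h x + linext h y"
    using linext_superset[of ?S x h] linext_superset[of ?S y h] linext_superset[of ?S "x + y" h]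
      keys_add[of x y]
    by (simp add: lookup_add add_scal sum.distrib)
next
  fix c and x :: "'a \<Rightarrow>\<^sub>0 K"
  have "Poly_Mapping.keys (c \<cdot> x) \<subseteq> Poly_Mapping.keys x"
    by (auto simp: in_keys_iff)
  then show "linext h (c \<cdot> x) = c \<cdot> linext h x"
    using linext_superset[of "Poly_Mapping.keys x" "c \<cdot> x" h]
    by (simp add: linext_def scal_sum)
qed

lemmas linext_simps = lin_add[OF lin_linext] lin_scal[OF lin_linext] lin_zero[OF lin_linext]
  lin_diff[OF lin_linext] lin_uminus[OF lin_linext] lin_sum[OF lin_linext]

lemma linext_bas [simp]: "linext h (bas a) = h a"
  by (simp add: linext_def)

lemma linext_single [simp]: "linext h (Poly_Mapping.single a c) = c \<cdot> h a"
  by (subst single_eq_scal_bas) (simp add: lin_scal[OF lin_linext] del: map_single)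

lemma linext_expand: "linext bas x = x"
proof (rule poly_mapping_eqI)
  fix k
  show "coef (linext bas x) k = coef x k"
    by (cases "k \<in> Poly_Mapping.keys x")
      (auto simp: linext_def lookup_sum lookup_single when_def in_keys_iff)
qed

lemma lin_eqI:
  assumes "lin f" "lin g" "\<And>a. a \<in> Poly_Mapping.keys x \<Longrightarrow> f (bas a) = g (bas a)"
  shows "f x = g x"
proof -
  have "f (linext bas x) = g (linext bas x)"
    unfolding linext_def by (simp add: lin_sum[OF assms(1)] lin_sum[OF assms(2)]
        lin_scal[OF assms(1)] lin_scal[OF assms(2)] assms(3) del: map_single)
  then show ?thesis by (simp add: linext_expand)
qed

lemma lin_id: "lin (\<lambda>x. x)" by (simp add: lin_def)
lemma lin_0: "lin (\<lambda>x. 0)" by (simp add: lin_def)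
lemma lin_comp: "lin f \<Longrightarrow> lin g \<Longrightarrow> lin (\<lambda>x. f (g x))" by (simp add: lin_def)
lemma lin_plus: "lin f \<Longrightarrow> lin g \<Longrightarrow> lin (\<lambda>x. f x + g x)" by (simp add: lin_def scal_add algebra_simps)
lemma lin_scalar: "lin f \<Longrightarrow> lin (\<lambda>x. c \<cdot> f x)"
  by (simp add: lin_def scal_add mult.commute)
lemma lin_Sum: "(\<And>a. a \<in> A \<Longrightarrow> lin (f a)) \<Longrightarrow> lin (\<lambda>x. \<Sum>a\<in>A. f a x)"
  by (induction A rule: infinite_finite_induct) (auto simp: lin_0 lin_plus)
lemma lin_mult_right: "lin (\<lambda>x :: falg. x * y)"
  by (simp add: lin_def distrib_right scal_mult_left)
lemma lin_mult_left: "lin (\<lambda>x :: falg. y * x)"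
proof -
  have *: "Poly_Mapping.single [] c * y = y * Poly_Mapping.single [] c" for c :: K and y :: falg
  proof -
    have "y * Poly_Mapping.single [] c = linext (\<lambda>w. bas w * Poly_Mapping.single [] c) y"
      by (rule lin_eqI[OF lin_mult_right lin_linext]) simp
    also have "\<dots> = linext (\<lambda>w. c \<cdot> bas w) y"
      by (simp add: mult_single plus_list_def)
    also have "\<dots> = c \<cdot> linext bas y"
      by (rule lin_eqI[OF lin_linext lin_scalar[OF lin_linext]]) (simp only: linext_bas)
    finally show ?thesis by (simp add: linext_expand scal_eq_single_mult)
  qed
  have "y * (c \<cdot> x) = c \<cdot> (y * x)" for c :: K and x :: falg
    by (metis * mult.assoc scal_eq_single_mult)
  then show ?thesis by (simp add: lin_def distrib_left)
qed

lemma scal_mult_right: "x * (c \<cdot> y) = c \<cdot> (x * (y :: falg))"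
  by (rule lin_scal[OF lin_mult_left])

lemma lin_linext_param:
  assumes "\<And>a. lin (h a)"
  shows "lin (\<lambda>v. linext (\<lambda>a. h a v) x)"
  unfolding linext_def by (intro lin_Sum lin_scalar assms)

lemma free_on_closed [simp]:
  "0 \<in> free_on S" "1 \<in> free_on S"
  "bas w \<in> free_on S \<longleftrightarrow> w \<in> lists S"
  by (simp_all add: free_on_def one_eq_bas)

lemma free_on_closed_ops [simp]:
  assumes "x \<in> free_on S"
  shows "- x \<in> free_on S" "c \<cdot> x \<in> free_on S"
    and "y \<in> free_on S \<Longrightarrow> x + y \<in> free_on S" "y \<in> free_on S \<Longrightarrow> x - y \<in> free_on S"
    and "y \<in> free_on S \<Longrightarrow> x * y \<in> free_on S"
proof -
  have "Poly_Mapping.keys (c \<cdot> x) \<subseteq> Poly_Mapping.keys x" "Poly_Mapping.keys (- x) = Poly_Mapping.keys x"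
    by (auto simp: in_keys_iff)
  then show "- x \<in> free_on S" "c \<cdot> x \<in> free_on S"
    using assms unfolding free_on_def by auto
  then show "y \<in> free_on S \<Longrightarrow> x + y \<in> free_on S"
    using assms keys_add[of x y] unfolding free_on_def by blast
  have "Poly_Mapping.keys (x - y) \<subseteq> Poly_Mapping.keys x \<union> Poly_Mapping.keys y"
    by (auto simp: in_keys_iff lookup_minus)
  then show "y \<in> free_on S \<Longrightarrow> x - y \<in> free_on S"
    using assms unfolding free_on_def by blast
  show "y \<in> free_on S \<Longrightarrow> x * y \<in> free_on S"
    using assms keys_mult[of x y] unfolding free_on_def by (fastforce simp: plus_list_def)
qed

lemma free_on_mono: "S \<subseteq> T \<Longrightarrow> free_on S \<subseteq> free_on T"
  unfolding free_on_def using lists_mono by blast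

lemma free_on_sum: "(\<And>a. a \<in> A \<Longrightarrow> f a \<in> free_on S) \<Longrightarrow> sum f A \<in> free_on S"
  by (induction A rule: infinite_finite_induct) auto

section \<open>Scalars\<close>

lemma emb_ring_hom [simp]:
  "emb 0 = 0" "emb 1 = 1" "emb (a + b) = emb a + emb b" "emb (a * b) = emb a * emb b"
  "emb (- a) = - emb a"
proof -
  have nz: "b \<noteq> 0 \<Longrightarrow> pcompose b [:0,0,1:] \<noteq> 0" for b :: "complex poly"
    by (simp add: pcompose_eq_0_iff)
  show "emb 0 = 0"
    using nz[of 1] by (simp add: Zero_fract_def emb_Fract eq_fract)
  show "emb 1 = 1" by (simp add: One_fract_def emb_Fract) (simp add: one_pCons pcompose_pCons)
  show "emb (a + b) = emb a + emb b"
    by (cases a; cases b) (simp add: emb_Fract nz pcompose_add pcompose_mult)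
  show "emb (a * b) = emb a * emb b"
    by (cases a; cases b) (simp add: emb_Fract nz pcompose_mult)
  show "emb (- a) = - emb a"
    by (cases a) (simp add: emb_Fract nz pcompose_uminus)
qed

lemma emb_eq_0 [simp]: "emb a = 0 \<longleftrightarrow> a = 0"
  by (metis emb_ring_hom(1,2,4) mult_zero_left right_inverse zero_neq_one)

lemma emb_diff [simp]: "emb (a - b) = emb a - emb b"
  using emb_ring_hom(3)[of a "- b"] by simp

lemma emb_inject [simp]: "emb a = emb b \<longleftrightarrow> a = b"
  by (metis emb_diff emb_eq_0 eq_iff_diff_eq_0)

lemma emb_inverse [simp]: "emb (inverse a) = inverse (emb a)"
  by (metis emb_eq_0 emb_ring_hom(2,4) field_class.field_inverse inverse_unique inverse_zero mult.commute)

lemma emb_power [simp]: "emb (a ^ k) = emb a ^ k"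
  by (induction k) auto

lemma emb_powi [simp]: "emb (a powi k) = emb a powi k"
  by (simp add: power_int_def)

text \<open>The pairing takes values in the larger field, so a functional on words extends to the free
algebra semilinearly along \<open>emb\<close>.\<close>

definition Lext :: "('a \<Rightarrow> L) \<Rightarrow> ('a \<Rightarrow>\<^sub>0 K) \<Rightarrow> L" where
  "Lext h x = (\<Sum>a\<in>Poly_Mapping.keys x. emb (coef x a) * h a)"

lemma Lext_superset:
  assumes "finite S" "Poly_Mapping.keys x \<subseteq> S"
  shows "Lext h x = (\<Sum>a\<in>S. emb (coef x a) * h a)"
  unfolding Lext_def using assms
  by (intro sum.mono_neutral_left) (auto simp: in_keys_iff)

lemma Lext_add: "Lext h (x + y) = Lext h x + Lext h y"
proof -
  let ?S = "Poly_Mapping.keys x \<union> Poly_Mapping.keys y"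
  show ?thesis
    using Lext_superset[of ?S x h] Lext_superset[of ?S y h] Lext_superset[of ?S "x + y" h]
      keys_add[of x y]
    by (simp add: lookup_add distrib_right sum.distrib)
qed

lemma Lext_scal: "Lext h (c \<cdot> x) = emb c * Lext h x"
proof -
  have "Poly_Mapping.keys (c \<cdot> x) \<subseteq> Poly_Mapping.keys x"
    by (auto simp: in_keys_iff)
  then show ?thesis
    using Lext_superset[of "Poly_Mapping.keys x" "c \<cdot> x" h]
    by (simp add: Lext_def sum_distrib_left mult.assoc)
qed

lemma Lext_zero [simp]: "Lext h 0 = 0" by (simp add: Lext_def)

lemma Lext_bas [simp]: "Lext h (bas a) = h a"
  by (simp add: Lext_def)

lemma Lext_sum: "Lext h (sum f A) = (\<Sum>a\<in>A. Lext h (f a))"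
  by (induction A rule: infinite_finite_induct) (auto simp: Lext_add)

lemma Lext_linext: "Lext g (linext h x) = Lext (\<lambda>a. Lext g (h a)) x"
  by (simp add: linext_def Lext_sum Lext_scal) (simp add: Lext_def)

lemma Lext_cong: "(\<And>a. a \<in> Poly_Mapping.keys x \<Longrightarrow> g a = h a) \<Longrightarrow> Lext g x = Lext h x"
  by (simp add: Lext_def)

lemma Lext_cmult: "Lext (\<lambda>a. c * h a) x = c * Lext h x"
  by (simp add: Lext_def sum_distrib_left mult.left_commute)

lemma Lext_plus: "Lext (\<lambda>a. g a + h a) x = Lext g x + Lext h x"
  by (simp add: Lext_def sum.distrib distrib_left)

text \<open>The generator of the field is transcendental: evaluating at \<open>0\<close> separates its powers from
\<open>1\<close>. Hence $q - q^{-1}$ can be inverted.\<close>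

lemma qhalf_power_neq_1:
  assumes "k > 0" shows "qhalf ^ k \<noteq> 1"
proof
  assume "qhalf ^ k = 1"
  moreover have "qhalf ^ k = Fract ([:0, 1:] ^ k) 1" for k
    by (induction k) (auto simp: qhalf_def One_fract_def)
  ultimately have "[:0, 1:] ^ k = (1 :: complex poly)"
    by (simp add: One_fract_def eq_fract)
  then have "poly ([:0, 1:] ^ k) 0 = (1 :: complex)" by simp
  with assms show False by (simp add: zero_power)
qed

lemma qhalf_nz [simp]: "qhalf \<noteq> 0"
  using qhalf_power_neq_1[of 1] by (auto simp: qhalf_def Zero_fract_def eq_fract)

lemma qh_simps:
  "qh (a + b) = qh a * qh b" "qh 0 = 1" "qh a \<noteq> 0"
  by (auto simp: power_int_add)

lemma q_minus_qinv_nz: "qh 2 - qh (- 2) \<noteq> 0" "qh (- 2) - qh 2 \<noteq> 0"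
proof -
  have "qh 2 \<noteq> qh (- 2)"
  proof
    assume "qh 2 = qh (- 2)"
    then have "qh 2 * qh 2 = 1" by (metis qh_simps(1,2) add.right_inverse)
    moreover have "qh 2 * qh 2 = qhalf ^ 4" by (simp add: power_int_def flip: power_add)
    ultimately show False using qhalf_power_neq_1[of 4] by simp
  qed
  then show "qh 2 - qh (- 2) \<noteq> 0" "qh (- 2) - qh 2 \<noteq> 0" by auto
qed

section \<open>The Cartan matrix\<close>

lemma bil_alpha:
  assumes "i \<in> {1..<N}"
  shows "bil N p (alpha i) \<nu> = (- 1) ^ p i * \<nu> i - (- 1) ^ p (i + 1) * \<nu> (i + 1)"
proof -
  have "bil N p (alpha i) \<nu> = (\<Sum>k = 1..N. (if k = i then (- 1) ^ p k * \<nu> k else 0)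
      - (if k = i + 1 then (- 1) ^ p k * \<nu> k else 0))"
    unfolding bil_def alpha_def eps_def by (intro sum.cong) auto
  with assms show ?thesis by (simp add: sum_subtractf)
qed

lemma cartan_eq:
  assumes "i \<in> {1..<N}" "j \<in> {1..<N}"
  shows "cartan N p i j = (if i = j then (- 1) ^ p i + (- 1) ^ p (i + 1)
    else if j = i + 1 then - ((- 1) ^ p j) else if i = j + 1 then - ((- 1) ^ p i) else 0)"
  unfolding bil_alpha[OF assms(1)] by (auto simp: alpha_def eps_def)

lemma cartan_hdiag:
  assumes "i \<in> {1..<N}"
  shows "cartan N p i j = hdiag p i j - hdiag p i (j + 1)"
  unfolding bil_alpha[OF assms(1)] by (auto simp: alpha_def eps_def hdiag_def)

section \<open>The action of words on V\<close>

lemma lin_rho_gen: "lin (rho_gen p a)"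
  by (cases a) (auto simp: munit_def intro: lin_linext lin_scalar)

lemma lin_single: "lin f \<Longrightarrow> f (Poly_Mapping.single a c) = c \<cdot> f (bas a)"
  by (subst single_eq_scal_bas) (simp add: lin_scal del: map_single)

lemma rho_gen_single [simp]:
  "rho_gen p (GE i) (Poly_Mapping.single k c) = (if k = i + 1 then Poly_Mapping.single i c else 0)"
  "rho_gen p (GF i) (Poly_Mapping.single k c) =
    (if k = i then Poly_Mapping.single (i + 1) ((- 1) ^ p i * c) else 0)"
  "rho_gen p (GK i) (Poly_Mapping.single k c) = Poly_Mapping.single k (qh (hdiag p i k) * c)"
  "rho_gen p (GKi i) (Poly_Mapping.single k c) = Poly_Mapping.single k (qh (- hdiag p i k) * c)"
  by (simp_all add: munit_def mult.commute)

declare rho_gen.simps [simp del]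

lemmas rho_gen_simps [simp] = lin_zero[OF lin_rho_gen] lin_scal[OF lin_rho_gen]

definition act :: "(nat \<Rightarrow> nat) \<Rightarrow> gen list \<Rightarrow> vec \<Rightarrow> vec" where
  "act p w = foldr (rho_gen p) w"

lemma act_simps [simp]: "act p [] v = v" "act p (a # w) v = rho_gen p a (act p w v)"
  "act p (u @ w) v = act p u (act p w v)"
  by (simp_all add: act_def)

lemma lin_act: "lin (act p w)"
  by (induction w) (auto simp: lin_def act_def lin_add[OF lin_rho_gen] lin_scal[OF lin_rho_gen])

lemma rho_free_act: "rho_free p x v = linext (\<lambda>w. act p w v) x"
  by (simp add: rho_free_def act_def)

lemma lin_rho_free_alg: "lin (\<lambda>x. rho_free p x v)"
  unfolding rho_free_act by (rule lin_linext)

lemma lin_rho_free: "lin (rho_free p x)"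
  unfolding rho_free_act using lin_linext_param[of "act p" x, OF lin_act] by simp

lemmas rho_free_simps [simp] = lin_add[OF lin_rho_free_alg] lin_diff[OF lin_rho_free_alg]
  lin_scal[OF lin_rho_free_alg] lin_zero[OF lin_rho_free_alg] lin_uminus[OF lin_rho_free_alg]
  lin_zero[OF lin_rho_free]

lemma rho_free_bas [simp]: "rho_free p (bas w) v = act p w v"
  by (simp add: rho_free_act)

lemma rho_free_one [simp]: "rho_free p 1 v = v"
  by (simp add: one_eq_bas)

lemma rho_free_mult [simp]: "rho_free p (x * y) v = rho_free p x (rho_free p y v)"
proof -
  have *: "rho_free p (bas w * y) v = rho_free p (bas w) (rho_free p y v)" for w
    by (rule lin_eqI[of "\<lambda>y. rho_free p (bas w * y) v" "\<lambda>y. rho_free p (bas w) (rho_free p y v)" y,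
          OF lin_comp[OF lin_rho_free_alg lin_mult_left] lin_comp[OF lin_rho_free lin_rho_free_alg]])
      (simp add: bas_mult)
  show ?thesis
    by (rule lin_eqI[of "\<lambda>x. rho_free p (x * y) v" "\<lambda>x. rho_free p x (rho_free p y v)" x,
          OF lin_comp[OF lin_rho_free_alg lin_mult_right] lin_rho_free_alg]) (rule *)
qed

definition Eword :: "nat list \<Rightarrow> gen list" where "Eword l = map GE l"
definition Fword :: "nat list \<Rightarrow> gen list" where "Fword l = map GF l"

text \<open>The operator of $e_i$ moves $v_{i+1}$ to $v_i$. A word therefore moves $v_k$ only if, read from
the right, it walks down one index at a time starting at $k - 1$.\<close>

lemma act_Eword:
  "act p (Eword l) (bas k) = (if \<exists>i\<le>k. l = [i..<k] then bas (k - length l) else 0)"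
proof (induction l)
  case Nil
  then show ?case by (auto simp: Eword_def)
next
  case (Cons a l)
  have step: "act p (Eword (a # l)) (bas k) = rho_gen p (GE a) (act p (Eword l) (bas k))"
    by (simp add: Eword_def)
  show ?case
  proof (cases "\<exists>i\<le>k. l = [i..<k]")
    case True
    then obtain i where i: "i \<le> k" "l = [i..<k]" by auto
    have act_l: "act p (Eword l) (bas k) = bas i" using Cons.IH True i by simp
    show ?thesis
    proof (cases "i = a + 1")
      case True
      with i have "a # l = [a..<k]" by (simp add: upt_conv_Cons)
      moreover have "a \<le> k" "k - length (a # l) = a" using True i by auto
      ultimately show ?thesis unfolding step act_l using True by (metis rho_gen_single(1))
    next
      case False
      have "\<not> (\<exists>i'\<le>k. a # l = [i'..<k])"
      proof
        assume "\<exists>i'\<le>k. a # l = [i'..<k]"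
        then obtain i' where i': "a # l = [i'..<k]" by auto
        then have "i' < k" by (cases "i' < k") auto
        with i' have "a = i'" "l = [Suc a..<k]" by (simp_all add: upt_conv_Cons)
        moreover from this i \<open>i' < k\<close> have "i = Suc a"
          using length_upt[of i k] length_upt[of "Suc a" k] by simp
        ultimately show False using False by simp
      qed
      then show ?thesis unfolding step act_l using False by (simp only: rho_gen_single if_False)
    qed
  next
    case False
    have "\<not> (\<exists>i\<le>k. a # l = [i..<k])"
    proof
      assume "\<exists>i\<le>k. a # l = [i..<k]"
      then obtain i where i: "i \<le> k" "a # l = [i..<k]" by auto
      then have "i < k" by (cases "i < k") auto
      with i have "l = [i+1..<k]" by (simp add: upt_conv_Cons)
      with False \<open>i < k\<close> show False by (metis Suc_eq_plus1 Suc_leI)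
    qed
    moreover have "act p (Eword l) (bas k) = 0" using Cons.IH False by (simp only: if_False)
    ultimately show ?thesis unfolding step by (simp only: if_False rho_gen_simps)
  qed
qed

lemma act_Fword:
  "\<exists>c. act p (Fword l) (bas k) =
     (if rev l = [k..<k + length l] then Poly_Mapping.single (k + length l) c else 0)"
proof (induction l)
  case Nil
  then show ?case by (auto simp: Fword_def intro!: exI[of _ 1])
next
  case (Cons a l)
  have step: "act p (Fword (a # l)) (bas k) = rho_gen p (GF a) (act p (Fword l) (bas k))"
    by (simp add: Fword_def)
  have eq: "rev (a # l) = [k..<k + length (a # l)] \<longleftrightarrow> rev l = [k..<k + length l] \<and> a = k + length l"
    by auto
  obtain c where c: "act p (Fword l) (bas k) =
      (if rev l = [k..<k + length l] then Poly_Mapping.single (k + length l) c else 0)"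
    using Cons.IH by blast
  have "act p (Fword (a # l)) (bas k) = (if rev l = [k..<k + length l] \<and> a = k + length l
      then Poly_Mapping.single (k + length (a # l)) ((- 1) ^ p a * c) else 0)"
  proof (cases "rev l = [k..<k + length l]")
    case True
    then show ?thesis unfolding step c by simp
  next
    case False
    then show ?thesis unfolding step c by (simp only: if_False rho_gen_simps simp_thms)
  qed
  then show ?case unfolding eq by blast
qed

text \<open>This settles the Serre relations of degree three and four:
every word in them contains some letter twice, and a walk never uses the same step twice.\<close>

lemma act_repeated:
  assumes "X \<in> {GE, GF}" "\<not> distinct l"
  shows "act p (map X l) v = 0"
proof (rule lin_eqI[of "act p (map X l)" "\<lambda>_. 0" v, OF lin_act lin_0])
  fix k
  have "distinct l = distinct (rev l)" by simp
  then have "l \<noteq> [i..<k]" "rev l \<noteq> [i..<k]" for i k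
    using assms(2) distinct_upt[of i k] by metis+
  then have "act p (Eword l) (bas k) = 0" "act p (Fword l) (bas k) = 0"
    using act_Eword[of p l k] act_Fword[of p l k] by auto
  then show "act p (map X l) (bas k) = 0"
    using assms(1) by (auto simp: Eword_def Fword_def)
qed

lemma free_on_single [simp]: "w \<in> lists S \<Longrightarrow> Poly_Mapping.single w c \<in> free_on S"
  by (simp add: free_on_def)

lemma rho_free_single [simp]: "rho_free p (Poly_Mapping.single w c) v = c \<cdot> act p w v"
  by (simp add: rho_free_act)

section \<open>The relations hold on V\<close>

lemma keys_linext: "Poly_Mapping.keys (linext h x) \<subseteq> (\<Union>a\<in>Poly_Mapping.keys x. Poly_Mapping.keys (h a))"
proof -
  have "Poly_Mapping.keys (c \<cdot> z) \<subseteq> Poly_Mapping.keys z" for c and z :: "'a \<Rightarrow>\<^sub>0 K"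
    by (auto simp: in_keys_iff)
  then show ?thesis unfolding linext_def
    by (intro order.trans[OF keys_sum] UN_mono) auto
qed

text \<open>Homogeneity with respect to the multiset of letters refines homogeneity with respect to weights
and parities, and it is preserved by the operations that build the Serre relators and the root vectors.\<close>

definition homog :: "gen multiset \<Rightarrow> falg set" where
  "homog M = {x. \<forall>w\<in>Poly_Mapping.keys x. mset w = M}"

lemma homog_ltr: "ltr a \<in> homog {#a#}"
  by (simp add: homog_def)

lemma homog_qbr:
  assumes "a \<in> homog M" "b \<in> homog M'"
  shows "qbr N p a b \<in> homog (M + M')"
proof -
  let ?L = "linext (\<lambda>u. linext (\<lambda>v.
     ((-1) ^ (wpar p u * wpar p v) * qh (2 * bil N p (wdeg u) (wdeg v))) \<cdot> bas (v @ u)) b) a"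
  have "Poly_Mapping.keys (a * b) \<subseteq> {u @ v |u v. u \<in> Poly_Mapping.keys a \<and> v \<in> Poly_Mapping.keys b}"
    using keys_mult[of a b] by (auto simp: plus_list_def)
  moreover have "Poly_Mapping.keys ?L
      \<subseteq> {v @ u |u v. u \<in> Poly_Mapping.keys a \<and> v \<in> Poly_Mapping.keys b}"
    by (rule order.trans[OF keys_linext], rule UN_least, rule order.trans[OF keys_linext])
      (auto split: if_splits)
  moreover have "Poly_Mapping.keys (a * b - ?L) \<subseteq> Poly_Mapping.keys (a * b) \<union> Poly_Mapping.keys ?L"
    by (auto simp: in_keys_iff lookup_minus)
  ultimately have "Poly_Mapping.keys (qbr N p a b) \<subseteq>
      {u @ v |u v. u \<in> Poly_Mapping.keys a \<and> v \<in> Poly_Mapping.keys b} \<union>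
      {v @ u |u v. u \<in> Poly_Mapping.keys a \<and> v \<in> Poly_Mapping.keys b}"
    unfolding qbr_def by blast
  with assms show ?thesis by (fastforce simp: homog_def)
qed

lemma homog_free_on:
  assumes "x \<in> homog M" "set_mset M \<subseteq> S"
  shows "x \<in> free_on S"
proof -
  have "set w \<subseteq> S" if "mset w = M" for w
    using that assms(2) by (metis set_mset_mset)
  then show ?thesis using assms(1) unfolding homog_def free_on_def by blast
qed

lemma homog_act_zero:
  assumes "x \<in> homog M" "\<And>w. mset w = M \<Longrightarrow> act p w v = 0"
  shows "rho_free p x v = 0"
  using assms unfolding homog_def rho_free_act linext_def by (auto intro!: sum.neutral)

lemma homog_repeated_act_zero:
  assumes "x \<in> homog M" "X \<in> {GE, GF}" "set_mset M \<subseteq> range X" "count M a \<ge> 2"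
  shows "rho_free p x v = 0"
proof (rule homog_act_zero[OF assms(1)])
  fix w assume w: "mset w = M"
  then have "set w \<subseteq> range X" using assms(3) by (metis set_mset_mset)
  then obtain l where l: "w = map X l" by (metis ex_map_conv rangeE subset_iff)
  have "\<not> distinct w"
  proof
    assume "distinct w"
    then have "count (mset w) a \<le> 1" by (auto simp: distinct_count_atmost_1)
    with assms(4) w show False by simp
  qed
  moreover have "inj X" using assms(2) by (auto simp: inj_def)
  ultimately have "\<not> distinct l" unfolding l by (metis distinct_map inj_on_subset subset_UNIV)
  with assms(2) l show "act p w v = 0" using act_repeated by auto
qed

lemma homog_Serre:
  "qbr N p (ltr a) (ltr b) \<in> homog {#a, b#}"
  "qbr N p (ltr a) (qbr N p (ltr a) (ltr b)) \<in> homog {#a, a, b#}"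
  "qbr N p (qbr N p (qbr N p (ltr a) (ltr b)) (ltr c)) (ltr b) \<in> homog {#a, b, c, b#}"
proof -
  have "qbr N p (ltr a) (ltr b) \<in> homog ({#a#} + {#b#})"
    "qbr N p (ltr a) (qbr N p (ltr a) (ltr b)) \<in> homog ({#a#} + ({#a#} + {#b#}))"
    "qbr N p (qbr N p (qbr N p (ltr a) (ltr b)) (ltr c)) (ltr b)
       \<in> homog ({#a#} + {#b#} + {#c#} + {#b#})"
    by (intro homog_qbr homog_ltr)+
  then show "qbr N p (ltr a) (ltr b) \<in> homog {#a, b#}"
    "qbr N p (ltr a) (qbr N p (ltr a) (ltr b)) \<in> homog {#a, a, b#}"
    "qbr N p (qbr N p (qbr N p (ltr a) (ltr b)) (ltr c)) (ltr b) \<in> homog {#a, b, c, b#}"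
    by (simp_all only: union_mset_add_mset_left add_0 empty_neutral)
qed

lemma relators_in_carrier:
  assumes "r \<in> relators N p"
  shows "r \<in> free_on (Egens N \<union> Fgens N \<union> Kgens N)"
proof -
  let ?S = "Egens N \<union> Fgens N \<union> Kgens N"
  have gens: "GE i \<in> ?S" "GF i \<in> ?S" "GK i \<in> ?S" "GKi i \<in> ?S" if "i \<in> {1..<N}" for i
    using that by (auto simp: Egens_def Fgens_def Kgens_def)
  have ltr: "ltr a \<in> free_on ?S" if "a \<in> ?S" for a using that by simp
  note ops = ltr free_on_closed_ops free_on_closed(1,2)
  from assms show ?thesis
  proof cases
    case (K_comm a b)
    then have "a \<in> ?S" "b \<in> ?S" by auto
    then show ?thesis unfolding K_comm(1) by (simp only: ops)
  next
    case (K_inv1 i)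
    then show ?thesis by (simp only: gens ops)
  next
    case (K_inv2 i)
    then show ?thesis by (simp only: gens ops)
  next
    case (K_E i j)
    then show ?thesis by (simp only: gens ops)
  next
    case (K_F i j)
    then show ?thesis by (simp only: gens ops)
  next
    case (E_F i j)
    then show ?thesis by (simp only: gens ops power2_eq_square split: if_split) simp
  next
    case (Serre2 X i j)
    with gens have "set_mset {#X i, X j#} \<subseteq> ?S" by auto
    then show ?thesis unfolding Serre2(1) by (rule homog_free_on[OF homog_Serre(1)])
  next
    case (Serre3 X i j)
    with gens have "set_mset {#X i, X i, X j#} \<subseteq> ?S" by auto
    then show ?thesis unfolding Serre3(1) by (rule homog_free_on[OF homog_Serre(2)])
  next
    case (Serre4 X i)
    then have "i \<in> {1..<N}" by auto
    then have "X (i - 1) \<in> ?S" "X i \<in> ?S" "X (i + 1) \<in> ?S"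
      using Serre4(2-4) gens(1,2)[of i] gens(1,2)[of "i - 1"] gens(1,2)[of "i + 1"] by blast+
    then have "set_mset {#X (i - 1), X i, X (i + 1), X i#} \<subseteq> ?S" by simp
    then show ?thesis unfolding Serre4(1) by (rule homog_free_on[OF homog_Serre(3)])
  qed
qed

lemma minus_one_power_cases: "(- 1 :: int) ^ k = 1 \<or> (- 1 :: int) ^ k = - 1"
  by (cases "even k") auto

lemma qh_sign_diff:
  "qh (2 * (- 1) ^ k) - qh (- 2 * (- 1) ^ k) = (- 1) ^ k * (qh 2 - qh (- 2))"
  by (cases "even k") auto

text \<open>The Cartan-type relations compare eigenvalues; in the relation between $e_i$ and $f_i$ only
$v_i$ and $v_{i+1}$ contribute, where $q^{h_i} - q^{-h_i}$ has the eigenvalues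
$\pm (q - q^{-1})$. In the Serre relations every single word acts as zero.\<close>

lemma rho_relator_bas:
  assumes "r \<in> relators N p"
  shows "rho_free p r (bas k) = 0"
  using assms
proof cases
  case (K_comm a b)
  then show ?thesis by (auto simp: Kgens_def mult.commute)
next
  case (K_inv1 i)
  then show ?thesis by (simp flip: qh_simps(1))
next
  case (K_inv2 i)
  then show ?thesis by (simp flip: qh_simps(1))
next
  case (K_E i j)
  have "qh (hdiag p i j) * qh (- hdiag p i (j + 1)) = qh (cartan N p i j)"
    unfolding cartan_hdiag[OF K_E(2)] by (simp flip: qh_simps(1))
  then show ?thesis using K_E(1) by (simp add: mult.commute)
next
  case (K_F i j)
  have "qh (hdiag p i (j + 1)) * qh (- hdiag p i j) = qh (- cartan N p i j)"
    unfolding cartan_hdiag[OF K_F(2)] by (simp flip: qh_simps(1))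
  then have eq: "qh (hdiag p i (Suc j)) * ((- 1) ^ p j * qh (- hdiag p i j))
      = (- 1) ^ p j * qh (- cartan N p i j)"
    by (metis mult.left_commute Suc_eq_plus1)
  show ?thesis unfolding K_F(1) by (simp add: eq mult.commute[of _ "(- 1) ^ p j"])
next
  case (E_F i j)
  have K2: "qh (hdiag p i k) * qh (hdiag p i k) - qh (- hdiag p i k) * qh (- hdiag p i k)
      = (if k = i then (- 1) ^ p i * (qh 2 - qh (- 2))
         else if k = i + 1 then - ((- 1) ^ p (i + 1)) * (qh 2 - qh (- 2)) else 0)"
  proof -
    have sq: "qh a * qh a = qh (2 * a)" for a
      using qh_simps(1)[of a a] by (simp only: mult_2)
    have "qh (2 * h) - qh (2 * - h) = (- 1) ^ a * (qh 2 - qh (- 2))" if "h = (- 1) ^ a" for h a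
      using qh_sign_diff[of a] that by simp
    from this[of "(- 1) ^ p i" "p i"] this[of "(- 1) ^ (p (i + 1) + 1)" "p (i + 1) + 1"]
    show ?thesis unfolding sq hdiag_def by simp
  qed
  have par: "(- 1 :: K) ^ ((p i + p (i + 1)) * (p i + p (i + 1))) * (- 1) ^ p i = (- 1) ^ p (i + 1)"
    by (cases "even (p i)"; cases "even (p (i + 1))") auto
  show ?thesis
  proof (cases "i = j")
    case True
    have EF: "rho_free p (ltr (GE i) * ltr (GF i)) (bas k)
        = (if k = i then Poly_Mapping.single i ((- 1) ^ p i) else 0)"
      and FE: "rho_free p (ltr (GF i) * ltr (GE i)) (bas k)
        = (if k = i + 1 then Poly_Mapping.single (i + 1) ((- 1) ^ p i) else 0)"
      by simp_all
    have KK: "rho_free p (ltr (GK i) ^ 2 - ltr (GKi i) ^ 2) (bas k) = Poly_Mapping.single k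
          (qh (hdiag p i k) * qh (hdiag p i k) - qh (- hdiag p i k) * qh (- hdiag p i k))"
      by (simp add: power2_eq_square single_diff)
    have r: "r = ltr (GE i) * ltr (GF i)
        - (- 1) ^ ((p i + p (i + 1)) * (p i + p (i + 1))) \<cdot> (ltr (GF i) * ltr (GE i))
        - inverse (qh 2 - qh (- 2)) \<cdot> (ltr (GK i) ^ 2 - ltr (GKi i) ^ 2)"
      unfolding E_F(1) using True by simp
    have "rho_free p r (bas k) = (if k = i then Poly_Mapping.single i ((- 1) ^ p i) else 0)
       - (- 1) ^ ((p i + p (i + 1)) * (p i + p (i + 1))) \<cdot>
           (if k = i + 1 then Poly_Mapping.single (i + 1) ((- 1) ^ p i) else 0)
       - inverse (qh 2 - qh (- 2)) \<cdot> Poly_Mapping.single k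
          (qh (hdiag p i k) * qh (hdiag p i k) - qh (- hdiag p i k) * qh (- hdiag p i k))"
      unfolding r EF[symmetric] FE[symmetric] KK[symmetric] lin_diff[OF lin_rho_free_alg]
        lin_scal[OF lin_rho_free_alg] ..
    also have "\<dots> = (if k = i then Poly_Mapping.single i ((- 1) ^ p i) else 0)
       - (if k = i + 1 then Poly_Mapping.single (i + 1) ((- 1) ^ p (i + 1)) else 0)
       - (if k = i then Poly_Mapping.single i ((- 1) ^ p i) else 0)
       + (if k = i + 1 then Poly_Mapping.single (i + 1) ((- 1) ^ p (i + 1)) else 0)"
    proof -
      obtain D where D: "D = qh 2 - qh (- 2)" "D \<noteq> 0" using q_minus_qinv_nz(1) by blast
      have inv: "inverse D * (s * D) = s" "inverse D * (s * - D) = - s" for s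
        using D(2) by (simp_all add: field_simps)
      show ?thesis unfolding K2 D(1)[symmetric] using par
        by (auto simp: single_uminus inv)
    qed
    also have "\<dots> = 0" by simp
    finally show ?thesis .
  next
    case False
    then show ?thesis unfolding E_F(1) by auto
  qed
next
  case (Serre2 X i j)
  show ?thesis unfolding Serre2(1)
  proof (rule homog_act_zero[OF homog_Serre(1)])
    fix w assume w: "mset w = {#X i, X j#}"
    then have "length w = 2" by (metis size_mset size_add_mset size_empty numeral_2_eq_2)
    then obtain a b where "w = [a, b]" by (auto simp: numeral_2_eq_2 length_Suc_conv)
    with w consider "w = [X i, X j]" | "w = [X j, X i]" by (auto simp: add_eq_conv_ex)
    moreover have "\<not> (j = i + 1 \<or> i = j + 1)"
      using Serre2(5) minus_one_power_cases unfolding cartan_eq[OF Serre2(3,4)] by (auto split: if_splits)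
    ultimately show "act p w (bas k) = 0"
      using Serre2(2) by cases auto
  qed
next
  case (Serre3 X i j)
  show ?thesis unfolding Serre3(1)
    by (rule homog_repeated_act_zero[OF homog_Serre(2) Serre3(2), of _ _ "X i"]) auto
next
  case (Serre4 X i)
  show ?thesis unfolding Serre4(1)
    by (rule homog_repeated_act_zero[OF homog_Serre(3) Serre4(2), of _ _ _ "X i"]) auto
qed

lemma rho_relator:
  assumes "r \<in> relators N p"
  shows "rho_free p r v = 0"
  by (rule lin_eqI[of "rho_free p r" "\<lambda>_. 0" v, OF lin_rho_free lin_0]) (rule rho_relator_bas[OF assms])

section \<open>The quotient algebra\<close>

lemma free_alg_sel [simp]:
  "carrier (free_alg N) = free_on (Egens N \<union> Fgens N \<union> Kgens N)"
  "monoid.mult (free_alg N) = (*)" "one (free_alg N) = 1"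
  "ring.zero (free_alg N) = 0" "add (free_alg N) = (+)"
  by (simp_all add: free_alg_def)

lemma ring_free_alg: "ring (free_alg N)"
proof (rule ringI)
  show "abelian_group (free_alg N)"
  proof (rule abelian_groupI; unfold free_alg_sel)
    fix x assume "x \<in> free_on (Egens N \<union> Fgens N \<union> Kgens N)"
    then show "\<exists>y\<in>free_on (Egens N \<union> Fgens N \<union> Kgens N). y + x = 0"
      using free_on_closed_ops(1) add.left_inverse by blast
  next
    fix x y :: falg show "x + y = y + x" by (rule add.commute)
  next
    fix x y z :: falg show "x + y + z = x + (y + z)" by (rule add.assoc)
  qed (simp_all only: free_on_closed free_on_closed_ops add_0)
  show "monoid (free_alg N)"
  proof (rule monoidI; unfold free_alg_sel)
    fix x y z :: falg show "x * y * z = x * (y * z)" by (rule mult.assoc)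
  qed (simp_all only: free_on_closed free_on_closed_ops mult_1 mult_1_right)
next
  fix x y z show "(x \<oplus>\<^bsub>free_alg N\<^esub> y) \<otimes>\<^bsub>free_alg N\<^esub> z
      = x \<otimes>\<^bsub>free_alg N\<^esub> z \<oplus>\<^bsub>free_alg N\<^esub> y \<otimes>\<^bsub>free_alg N\<^esub> z"
    by (simp only: free_alg_sel distrib_right)
next
  fix x y z show "z \<otimes>\<^bsub>free_alg N\<^esub> (x \<oplus>\<^bsub>free_alg N\<^esub> y)
      = z \<otimes>\<^bsub>free_alg N\<^esub> x \<oplus>\<^bsub>free_alg N\<^esub> z \<otimes>\<^bsub>free_alg N\<^esub> y"
    by (simp only: free_alg_sel distrib_left)
qed

lemma free_alg_a_inv:
  assumes "x \<in> free_on (Egens N \<union> Fgens N \<union> Kgens N)"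
  shows "\<ominus>\<^bsub>free_alg N\<^esub> x = - x"
proof -
  interpret ring "free_alg N" by (rule ring_free_alg)
  show ?thesis using assms by (intro minus_equality) auto
qed

lemma ideal_rel_ideal: "ideal (rel_ideal N p) (free_alg N)"
  unfolding rel_ideal_def
  by (rule ring.genideal_ideal[OF ring_free_alg]) (auto simp: relators_in_carrier)

lemma relators_rel_ideal: "relators N p \<subseteq> rel_ideal N p"
  unfolding rel_ideal_def
  by (rule ring.genideal_self[OF ring_free_alg]) (auto simp: relators_in_carrier)

lemma rho_rel_ideal:
  assumes "x \<in> rel_ideal N p" shows "rho_free p x v = 0"
proof -
  interpret ring "free_alg N" by (rule ring_free_alg)
  let ?I = "{x \<in> carrier (free_alg N). \<forall>v. rho_free p x v = 0}"
  have "ideal ?I (free_alg N)"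
  proof (rule idealI)
    show "subgroup ?I (add_monoid (free_alg N))"
    proof (rule add.subgroupI)
      have "0 \<in> ?I" by simp
      then show "?I \<noteq> {}" by blast
      fix a b assume "a \<in> ?I" "b \<in> ?I"
      then show "\<ominus>\<^bsub>free_alg N\<^esub> a \<in> ?I" "a \<oplus>\<^bsub>free_alg N\<^esub> b \<in> ?I"
        by (simp_all add: free_alg_a_inv)
    qed simp
    show "ring (free_alg N)" by (rule ring_free_alg)
  qed simp_all
  moreover have "relators N p \<subseteq> ?I" using relators_in_carrier rho_relator by auto
  ultimately have "rel_ideal N p \<subseteq> ?I"
    unfolding rel_ideal_def by (rule genideal_minimal)
  with assms show ?thesis by auto
qed

lemma quo_hom: "quo N p \<in> ring_hom (free_alg N) (Uq N p)"
  unfolding quo_def Uq_def using ideal.rcos_ring_hom[OF ideal_rel_ideal] by simp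

lemma quo_eqI:
  assumes "x \<in> carrier (free_alg N)" "y \<in> carrier (free_alg N)" "x - y \<in> rel_ideal N p"
  shows "quo N p x = quo N p y"
proof -
  have "x \<ominus>\<^bsub>free_alg N\<^esub> y = x - y"
    using assms free_alg_a_inv[of y N] by (simp add: a_minus_def)
  then show ?thesis unfolding quo_def
    using ring.quotient_eq_iff_same_a_r_cos[OF ring_free_alg ideal_rel_ideal assms(1,2)] assms(3)
    by simp
qed

text \<open>The relators act as zero and the elements that act as zero form an ideal, so the operator of a
coset does not depend on the representative that the definition of \<open>rho\<close> picks.\<close>

lemma rho_quo:
  assumes "x \<in> carrier (free_alg N)"
  shows "rho p (quo N p x) v = rho_free p x v"
proof -
  have *: "rho_free p y v = rho_free p x v" if "y \<in> quo N p x" for y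
  proof -
    from that obtain h where "h \<in> rel_ideal N p" "y = h + x"
      unfolding quo_def a_r_coset_def r_coset_def by auto
    then show ?thesis using rho_rel_ideal by simp
  qed
  have "0 \<in> rel_ideal N p"
    using additive_subgroup.zero_closed[OF ideal.axioms(1)[OF ideal_rel_ideal]] by simp
  then have "x \<in> quo N p x" unfolding quo_def a_r_coset_def r_coset_def
    by (auto intro!: bexI[of _ 0])
  then have "(SOME y. y \<in> quo N p x) \<in> quo N p x" by (rule someI)
  with * show ?thesis unfolding rho_def by blast
qed

section \<open>The coproduct of words\<close>

lemma wpar_simps [simp]: "wpar p [] = 0" "wpar p (a # w) = gpar p a + wpar p w"
  "wpar p (u @ w) = wpar p u + wpar p w"
  by (simp_all add: wpar_def)

lemma Lext_tmult:
  "Lext g (tmult p A Z) = Lext (\<lambda>(x, y). Lext (\<lambda>(x', y').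
     (- 1) ^ (wpar p y * wpar p x') * g (x @ x', y @ y')) Z) A"
  unfolding tmult_def Lext_linext split_def Lext_scal Lext_bas emb_power emb_ring_hom(2,5) ..

lemma keys_tmult:
  assumes "(x, y) \<in> Poly_Mapping.keys (tmult p A Z)"
  obtains x1 y1 x2 y2 where "(x1, y1) \<in> Poly_Mapping.keys A" "(x2, y2) \<in> Poly_Mapping.keys Z"
    "x = x1 @ x2" "y = y1 @ y2"
proof -
  obtain x1 y1 where A: "(x1, y1) \<in> Poly_Mapping.keys A" and
    "(x, y) \<in> Poly_Mapping.keys (linext (\<lambda>(x', y').
     (-1) ^ (wpar p y1 * wpar p x') \<cdot> bas (x1 @ x', y1 @ y')) Z :: (gen list \<times> gen list) \<Rightarrow>\<^sub>0 K)"
    using assms keys_linext unfolding tmult_def by fast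
  then obtain x2 y2 where Z: "(x2, y2) \<in> Poly_Mapping.keys Z" and
    "(x, y) \<in> Poly_Mapping.keys ((-1) ^ (wpar p y1 * wpar p x2) \<cdot> bas (x1 @ x2, y1 @ y2)
       :: (gen list \<times> gen list) \<Rightarrow>\<^sub>0 K)"
    using keys_linext by fast
  then have "x = x1 @ x2" "y = y1 @ y2" by (auto split: if_splits)
  with A Z show ?thesis by (rule that)
qed

lemma Lext_Delta_E:
  "Lext g (DeltaJ_word p (GE a # w)) =
    Lext (\<lambda>(x1, x2). (- 1) ^ (gpar p (GE a) * wpar p x1) * g (GK a # GK a # x1, GE a # x2))
      (DeltaJ_word p w) + Lext (\<lambda>(x1, x2). g (GE a # x1, x2)) (DeltaJ_word p w)"
  by (simp add: Lext_tmult Lext_add del: gpar.simps)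

lemma Lext_Delta_F:
  "Lext g (DeltaJ_word p (GF a # w)) =
    Lext (\<lambda>(x1, x2). (- 1) ^ (gpar p (GF a) * wpar p x1) * g (x1, GF a # x2)) (DeltaJ_word p w) +
    Lext (\<lambda>(x1, x2). g (GF a # x1, GKi a # GKi a # x2)) (DeltaJ_word p w)"
  by (simp add: Lext_tmult Lext_add del: gpar.simps)

lemma Lext_Delta_K:
  "Lext g (DeltaJ_word p (GK a # w)) = Lext (\<lambda>(x1, x2). g (GK a # x1, GK a # x2)) (DeltaJ_word p w)"
  "Lext g (DeltaJ_word p (GKi a # w)) = Lext (\<lambda>(x1, x2). g (GKi a # x1, GKi a # x2)) (DeltaJ_word p w)"
  by (simp_all add: Lext_tmult)

lemmas Lext_Delta = Lext_Delta_E Lext_Delta_F Lext_Delta_K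

declare DeltaJ_word.simps(2) [simp del]

lemma keys_Delta_E:
  assumes "(x, y) \<in> Poly_Mapping.keys (DeltaJ_word p (Eword l))" "set l \<subseteq> {1..<N}"
  shows "x \<in> lists (Egens N \<union> Kgens N) \<and> y \<in> lists (Egens N)"
  using assms
proof (induction l arbitrary: x y)
  case Nil
  then show ?case by (simp add: Eword_def)
next
  case (Cons a l)
  then have D: "(x, y) \<in> Poly_Mapping.keys (tmult p (DeltaJ_gen (GE a)) (DeltaJ_word p (Eword l)))"
    by (simp add: Eword_def DeltaJ_word.simps(2))
  then obtain x1 y1 x2 y2 where 1: "(x1, y1) \<in> Poly_Mapping.keys (DeltaJ_gen (GE a))"
    and 2: "(x2, y2) \<in> Poly_Mapping.keys (DeltaJ_word p (Eword l))" "x = x1 @ x2" "y = y1 @ y2"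
    by (rule keys_tmult)
  from 1 have "(x1, y1) = ([GK a, GK a], [GE a]) \<or> (x1, y1) = ([GE a], [])"
    using keys_add[of "bas ([GK a, GK a], [GE a]) :: _ \<Rightarrow>\<^sub>0 K" "bas ([GE a], [])"] by auto
  moreover have "GE a \<in> Egens N" "GK a \<in> Kgens N"
    using Cons.prems(2) by (auto simp: Egens_def Kgens_def)
  ultimately show ?case using Cons.IH[OF 2(1)] Cons.prems(2) 2(2,3) by auto
qed

lemma keys_Delta_F:
  assumes "(x, y) \<in> Poly_Mapping.keys (DeltaJ_word p w)" "w \<in> lists (Fgens N)"
  shows "x \<in> lists (Fgens N) \<and> y \<in> lists (Fgens N \<union> Kgens N)"
  using assms
proof (induction w arbitrary: x y)
  case Nil
  then show ?case by simp
next
  case (Cons f w)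
  from Cons.prems(2) obtain a where a: "f = GF a" "a \<in> {1..<N}" by (auto simp: Fgens_def)
  have D: "(x, y) \<in> Poly_Mapping.keys (tmult p (DeltaJ_gen (GF a)) (DeltaJ_word p w))"
    using Cons.prems(1) a by (simp add: DeltaJ_word.simps(2))
  then obtain x1 y1 x2 y2 where 1: "(x1, y1) \<in> Poly_Mapping.keys (DeltaJ_gen (GF a))"
    and 2: "(x2, y2) \<in> Poly_Mapping.keys (DeltaJ_word p w)" "x = x1 @ x2" "y = y1 @ y2"
    by (rule keys_tmult)
  from 1 have "(x1, y1) = ([], [GF a]) \<or> (x1, y1) = ([GF a], [GKi a, GKi a])"
    using keys_add[of "bas ([], [GF a]) :: _ \<Rightarrow>\<^sub>0 K" "bas ([GF a], [GKi a, GKi a])"] by auto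
  moreover have "GF a \<in> Fgens N" "GKi a \<in> Kgens N"
    using a(2) by (auto simp: Fgens_def Kgens_def)
  ultimately show ?case using Cons.IH[OF 2(1)] Cons.prems(2) 2(2,3) by auto
qed

lemma EFK_disjoint:
  "GE a \<notin> Kgens N" "GF a \<notin> Kgens N" "GF a \<notin> Egens N" "GE a \<notin> Fgens N"
  by (auto simp: Egens_def Fgens_def Kgens_def)

lemma Lext_0 [simp]: "Lext (\<lambda>_. 0) z = 0" by (simp add: Lext_def)

text \<open>The next three lemmas are counit axioms for the coproduct: a functional that vanishes as soon as
one tensor factor contains a letter other than $q^{\pm h_i/2}$ sees exactly one term, the one in which
all letters went to the other side.\<close>

lemma Delta_E_counit_right:
  assumes "\<And>x y. y \<notin> lists (Kgens N) \<Longrightarrow> h (x, y) = 0"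
  shows "Lext h (DeltaJ_word p (Eword l)) = h (Eword l, [])"
  using assms
proof (induction l arbitrary: h)
  case Nil
  then show ?case by (simp add: Eword_def)
next
  case (Cons a l)
  have "h (x, GE a # y) = 0" for x y by (rule Cons.prems) (simp add: EFK_disjoint)
  then have "Lext h (DeltaJ_word p (Eword (a # l)))
      = Lext (\<lambda>(x, y). h (GE a # x, y)) (DeltaJ_word p (Eword l))"
    unfolding Eword_def list.map Lext_Delta_E by (simp add: split_def)
  also have "\<dots> = h (GE a # Eword l, [])"
    using Cons.IH[of "\<lambda>(x, y). h (GE a # x, y)"] Cons.prems by simp
  finally show ?case by (simp add: Eword_def)
qed

lemma Delta_E_counit_left:
  assumes "\<And>x y. x \<notin> lists (Kgens N) \<Longrightarrow> h (x, y) = 0"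
  shows "Lext h (DeltaJ_word p (Eword l)) = h (concat (map (\<lambda>a. [GK a, GK a]) l), Eword l)"
  using assms
proof (induction l arbitrary: h)
  case Nil
  then show ?case by (simp add: Eword_def)
next
  case (Cons a l)
  let ?h = "\<lambda>(x, y). (- 1) ^ (gpar p (GE a) * wpar p x) * h (GK a # GK a # x, GE a # y)"
  have par: "wpar p (concat (map (\<lambda>a. [GK a, GK a]) l)) = 0" for l by (induction l) auto
  have "h (GE a # x, y) = 0" for x y by (rule Cons.prems) (simp add: EFK_disjoint)
  then have "Lext h (DeltaJ_word p (Eword (a # l))) = Lext ?h (DeltaJ_word p (Eword l))"
    unfolding Eword_def list.map Lext_Delta_E by (simp add: split_def)
  also have "\<dots> = ?h (concat (map (\<lambda>a. [GK a, GK a]) l), Eword l)"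
    by (rule Cons.IH) (auto intro: Cons.prems)
  finally show ?case by (simp add: Eword_def par)
qed

lemma Delta_F_counit_left:
  assumes "w \<in> lists (Fgens N)" "\<And>x y. x \<noteq> [] \<Longrightarrow> x \<in> lists (Fgens N) \<Longrightarrow> h (x, y) = 0"
  shows "Lext h (DeltaJ_word p w) = h ([], w)"
  using assms
proof (induction w arbitrary: h)
  case Nil
  then show ?case by simp
next
  case (Cons f w)
  from Cons.hyps have fw: "f \<in> Fgens N" "w \<in> lists (Fgens N)" by auto
  then obtain a where "f = GF a" by (auto simp: Fgens_def)
  with fw have a: "f = GF a" "GF a \<in> Fgens N" "w \<in> lists (Fgens N)" by auto
  let ?h = "\<lambda>(x, y). (- 1) ^ (gpar p (GF a) * wpar p x) * h (x, GF a # y)"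
  have "Lext (\<lambda>(x, y). h (GF a # x, GKi a # GKi a # y)) (DeltaJ_word p w) = Lext (\<lambda>_. 0) (DeltaJ_word p w)"
    by (rule Lext_cong) (use keys_Delta_F[of _ _ p w N] a Cons.prems in auto)
  then have "Lext h (DeltaJ_word p (f # w)) = Lext ?h (DeltaJ_word p w)"
    unfolding a(1) Lext_Delta_F by simp
  also have "\<dots> = ?h ([], w)"
    by (rule Cons.IH) (use a Cons.prems in auto)
  finally show ?case by (simp add: a)
qed

section \<open>Deleting a letter\<close>

text \<open>Skew derivations on functionals of words in the $e_i$. They sum over all ways to delete one
letter \<open>k\<close>. In \<open>skewR\<close> the power of $q$ records the letters to the right of the deleted one
and the sign those to its left; in \<open>skewL\<close> the power of $q$ records the letters to its left,
and the sign comes from the parity \<open>s\<close> of the other tensor factor plus that of the letters passed.\<close>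

fun skewR :: "nat \<Rightarrow> (nat \<Rightarrow> nat) \<Rightarrow> nat \<Rightarrow> (nat list \<Rightarrow> L) \<Rightarrow> nat list \<Rightarrow> L" where
  "skewR N p k \<phi> [] = 0"
| "skewR N p k \<phi> (a # l) = (if a = k then emb (qh (2 * (\<Sum>b\<leftarrow>l. cartan N p k b))) * \<phi> l else 0)
     + (- 1) ^ (gpar p (GF k) * gpar p (GE a)) * skewR N p k (\<lambda>l. \<phi> (a # l)) l"

fun skewL :: "nat \<Rightarrow> (nat \<Rightarrow> nat) \<Rightarrow> nat \<Rightarrow> nat \<Rightarrow> (nat list \<Rightarrow> L) \<Rightarrow> nat list \<Rightarrow> L" where
  "skewL N p k s \<phi> [] = 0"
| "skewL N p k s \<phi> (a # l) = (if a = k then (- 1) ^ (s * gpar p (GF k)) * \<phi> l else 0)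
     + emb (qh (2 * cartan N p k a)) * skewL N p k (s + gpar p (GE a)) (\<lambda>l. \<phi> (a # l)) l"

lemma Lext_skewR: "Lext (\<lambda>u. skewR N p k (\<phi> u) l) z = skewR N p k (\<lambda>l. Lext (\<lambda>u. \<phi> u l) z) l"
proof (induction l arbitrary: \<phi>)
  case (Cons a l)
  show ?case
    by (simp add: Lext_plus Lext_cmult Cons.IH[of "\<lambda>u l. \<phi> u (a # l)"] del: gpar.simps)
qed simp

lemma Lext_skewL: "Lext (\<lambda>u. skewL N p k s (\<phi> u) l) z = skewL N p k s (\<lambda>l. Lext (\<lambda>u. \<phi> u l) z) l"
proof (induction l arbitrary: \<phi> s)
  case (Cons a l)
  show ?case
    by (simp add: Lext_plus Lext_cmult Cons.IH[of _ "\<lambda>u l. \<phi> u (a # l)"] del: gpar.simps)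
qed simp

section \<open>The pairing on words\<close>

lemma pair2_Lext: "pair2 N p J Y X = Lext (\<lambda>(y, y'). Lext (\<lambda>(x, x'). (- 1) ^ (wpar p y' * wpar p x) *
     J (quo N p (bas y)) (quo N p (bas x)) * J (quo N p (bas y')) (quo N p (bas x'))) X) Y"
  unfolding pair2_def Lext_def split_def sum_distrib_left
  by (intro sum.cong refl) (simp add: mult.assoc)

lemma qquart_nz [simp]: "qquart \<noteq> 0"
  by (auto simp: qquart_def Zero_fract_def eq_fract)

locale pairing =
  fixes N :: nat and p :: "nat \<Rightarrow> nat" and J :: "falg set \<Rightarrow> falg set \<Rightarrow> L"
  assumes bp: "bialgebra_pairing N p J"
begin

abbreviation "FK \<equiv> Fgens N \<union> Kgens N"
abbreviation "EK \<equiv> Egens N \<union> Kgens N"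

definition Jfree :: "falg \<Rightarrow> falg \<Rightarrow> L" where "Jfree y x = J (quo N p y) (quo N p x)"
definition Jword :: "gen list \<Rightarrow> gen list \<Rightarrow> L" where "Jword u w = Jfree (bas u) (bas w)"

lemma Jfree_add_left: "y \<in> free_on FK \<Longrightarrow> y' \<in> free_on FK \<Longrightarrow> x \<in> free_on EK \<Longrightarrow> Jfree (y + y') x = Jfree y x + Jfree y' x"
  and Jfree_add_right: "y \<in> free_on FK \<Longrightarrow> x \<in> free_on EK \<Longrightarrow> x' \<in> free_on EK \<Longrightarrow> Jfree y (x + x') = Jfree y x + Jfree y x'"
  and Jfree_scal_left: "y \<in> free_on FK \<Longrightarrow> x \<in> free_on EK \<Longrightarrow> Jfree (c \<cdot> y) x = emb c * Jfree y x"
  and Jfree_scal_right: "y \<in> free_on FK \<Longrightarrow> x \<in> free_on EK \<Longrightarrow> Jfree y (c \<cdot> x) = emb c * Jfree y x"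
  and Jfree_mult_left: "y \<in> free_on FK \<Longrightarrow> y' \<in> free_on FK \<Longrightarrow> x \<in> free_on EK \<Longrightarrow>
     Jfree (y * y') x = pair2 N p J (ptens y y') (DeltaJ p x)"
  and Jfree_mult_right: "y \<in> free_on FK \<Longrightarrow> x \<in> free_on EK \<Longrightarrow> x' \<in> free_on EK \<Longrightarrow>
     Jfree y (x * x') = pair2 N p J (DeltaJop p y) (ptens x x')"
  using bp unfolding bialgebra_pairing_def Let_def Jfree_def by blast+

lemma Jfree_gens:
  assumes "i \<in> {1..<N}" "j \<in> {1..<N}"
  shows "Jword [GF i] [GK j] = 0" "Jword [GF i] [GKi j] = 0" "Jword [GK j] [GE i] = 0" "Jword [GKi j] [GE i] = 0"
    "Jword [GF i] [GE j] = (if i = j then (- 1) ^ gpar p (GF i) / emb (qh (- 2) - qh 2) else 0)"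
    "Jword [GK i] [GK j] = qquart powi (- cartan N p i j)"
proof -
  have "(- 1 :: L) ^ (gpar p (GF i) * gpar p (GE i)) = (- 1) ^ gpar p (GF i)"
    by (cases "even (gpar p (GF i))") auto
  moreover have "\<forall>i\<in>{1..<N}. \<forall>j\<in>{1..<N}.
      Jword [GF i] [GK j] = 0 \<and> Jword [GF i] [GKi j] = 0 \<and> Jword [GK j] [GE i] = 0 \<and> Jword [GKi j] [GE i] = 0 \<and>
      Jword [GF i] [GE j] =
        (if i = j then (- 1) ^ (gpar p (GF i) * gpar p (GE j)) / emb (qh (- 2) - qh 2) else 0) \<and>
      Jword [GK i] [GK j] = qquart powi (- cartan N p i j)"
    using bp unfolding bialgebra_pairing_def Let_def Jword_def Jfree_def by blast
  ultimately show "Jword [GF i] [GK j] = 0" "Jword [GF i] [GKi j] = 0" "Jword [GK j] [GE i] = 0" "Jword [GKi j] [GE i] = 0"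
    "Jword [GF i] [GE j] = (if i = j then (- 1) ^ gpar p (GF i) / emb (qh (- 2) - qh 2) else 0)"
    "Jword [GK i] [GK j] = qquart powi (- cartan N p i j)"
    using assms by (metis (no_types, lifting))+
qed

lemma ptens_bas: "ptens (bas u) (bas v) = bas (u, v)"
  by (simp add: ptens_def)

lemma Jword_mult_left:
  assumes "u \<in> lists FK" "u' \<in> lists FK" "x \<in> lists EK"
  shows "Jword (u @ u') x = Lext (\<lambda>(x1, x2). (- 1) ^ (wpar p u' * wpar p x1) * Jword u x1 * Jword u' x2)
    (DeltaJ_word p x)"
proof -
  have "Jword (u @ u') x = Jfree (bas u * bas u') (bas x)" by (simp add: Jword_def bas_mult)
  also have "\<dots> = pair2 N p J (ptens (bas u) (bas u')) (DeltaJ p (bas x))"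
    using assms by (intro Jfree_mult_left) auto
  finally show ?thesis by (simp add: ptens_bas pair2_Lext DeltaJ_def Jword_def Jfree_def)
qed

lemma Jword_mult_right:
  assumes "u \<in> lists FK" "x \<in> lists EK" "x' \<in> lists EK"
  shows "Jword u (x @ x') = Lext (\<lambda>(y, y'). (- 1) ^ (wpar p y * wpar p y') *
    ((- 1) ^ (wpar p y * wpar p x) * Jword y' x * Jword y x')) (DeltaJ_word p u)"
proof -
  have "Jword u (x @ x') = Jfree (bas u) (bas x * bas x')" by (simp add: Jword_def bas_mult)
  also have "\<dots> = pair2 N p J (DeltaJop p (bas u)) (ptens (bas x) (bas x'))"
    using assms by (intro Jfree_mult_right) auto
  also have "DeltaJop p (bas u) = flip (wpar p) (DeltaJ_word p u)"
    by (simp add: DeltaJop_def DeltaJ_def)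
  finally show ?thesis unfolding ptens_bas pair2_Lext flip_def Lext_linext
    by (simp add: split_def Lext_scal Jword_def Jfree_def del: map_single)
qed

lemma K_words [simp]: "i \<in> {1..<N} \<Longrightarrow> GK i \<in> Kgens N" "i \<in> {1..<N} \<Longrightarrow> GKi i \<in> Kgens N"
  "i \<in> {1..<N} \<Longrightarrow> GE i \<in> Egens N" "i \<in> {1..<N} \<Longrightarrow> GF i \<in> Fgens N"
  by (auto simp: Kgens_def Egens_def Fgens_def)

lemma Jword_nil_mult: "x \<in> lists EK \<Longrightarrow> x' \<in> lists EK \<Longrightarrow> Jword [] (x @ x') = Jword [] x * Jword [] x'"
  using Jword_mult_right[of "[]" x x'] by simp

lemma Jword_cong_quo:
  "quo N p (bas u) = quo N p (bas u') \<Longrightarrow> Jword u w = Jword u' w"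
  "quo N p (bas u) = quo N p (bas u') \<Longrightarrow> Jword w u = Jword w u'"
  by (simp_all add: Jword_def Jfree_def)

lemma quo_K_Ki:
  assumes "i \<in> {1..<N}" shows "quo N p (bas [GK i, GKi i]) = quo N p (bas [])"
proof (rule quo_eqI)
  show "bas [GK i, GKi i] - bas [] \<in> rel_ideal N p"
    using relators.K_inv1[OF assms, of p] relators_rel_ideal[of N p]
    by (auto simp: bas_mult one_eq_bas)
qed (use assms in auto)

text \<open>The values at the unit are forced because
$(q^{h_i/2}, q^{h_i/2})_J$ is invertible and the pairing is multiplicative in each argument; for
$e_i$ the coproduct yields $t = t + t$.\<close>

lemma Jword_nil:
  shows "i \<in> {1..<N} \<Longrightarrow> Jword [] [GK i] = 1" "i \<in> {1..<N} \<Longrightarrow> Jword [] [GKi i] = 1"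
    "i \<in> {1..<N} \<Longrightarrow> Jword [] [GE i] = 0" "i \<in> {1..<N} \<Longrightarrow> Jword [] [] = 1"
proof -
  assume i: "i \<in> {1..<N}"
  have "Jword ([] @ [GK i]) [GK i] = Jword [] [GK i] * Jword [GK i] [GK i]"
    using i by (subst Jword_mult_left) (auto simp: Lext_Delta)
  moreover have "Jword [GK i] [GK i] \<noteq> 0"
    unfolding Jfree_gens(6)[OF i i] by simp
  ultimately show K: "Jword [] [GK i] = 1" by simp
  have "Jword [] ([GK i] @ []) = Jword [] [GK i] * Jword [] []"
    using i by (intro Jword_nil_mult) auto
  with K show n: "Jword [] [] = 1" by simp
  have "Jword [] ([GK i] @ [GKi i]) = Jword [] [GK i] * Jword [] [GKi i]"
    using i by (intro Jword_nil_mult) auto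
  then show Ki: "Jword [] [GKi i] = 1"
    using K n Jword_cong_quo(2)[OF quo_K_Ki[OF i], of "[]"] by simp
  have "Jword [] ([GK i] @ [GK i]) = Jword [] [GK i] * Jword [] [GK i]"
    using i by (intro Jword_nil_mult) auto
  then have "Jword ([] @ []) [GE i] = Jword [] [GE i] + Jword [] [GE i]"
    using i n K by (subst Jword_mult_left) (auto simp: Lext_Delta)
  then have "Jword [] [GE i] = Jword [] [GE i] + Jword [] [GE i]" by (simp only: append.left_neutral)
  then show "Jword [] [GE i] = 0" by (simp only: add_cancel_right_right)
qed

lemma Jword_nil_word:
  assumes "x \<in> lists EK" "N > 1"
  shows "Jword [] x = of_bool (x \<in> lists (Kgens N))"
  using assms(1)
proof (induction x)
  case Nil
  then show ?case using Jword_nil(4)[of 1] assms(2) by simp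
next
  case (Cons a x)
  have "Jword [] ([a] @ x) = Jword [] [a] * Jword [] x" using Cons.hyps by (intro Jword_nil_mult) auto
  moreover have "Jword [] [a] = of_bool (a \<in> Kgens N)"
    using Cons.hyps(1) Jword_nil(1-3) by (auto simp: Egens_def Kgens_def)
  ultimately show ?case using Cons.IH by simp
qed

text \<open>Only the value on $(q^{h_i/2}, q^{h_j/2})$ is prescribed. That on the inverse follows since
$q^{h_i/2} q^{-h_i/2} = 1$, and squaring both arguments gives the fourth power, which turns
$q^{a_{ij}/4}$ into $q^{a_{ij}}$.\<close>

lemma Jword_Ki_K:
  assumes "i \<in> {1..<N}" "j \<in> {1..<N}"
  shows "Jword [GKi i, GKi i] [GK j, GK j] = emb (qh (2 * cartan N p i j))"
proof -
  have m: "Jword (u @ u') [GK j] = Jword u [GK j] * Jword u' [GK j]" if "u \<in> lists FK" "u' \<in> lists FK" for u u'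
    using that assms by (subst Jword_mult_left) (auto simp: Lext_Delta)
  have "Jword [GK i] [GK j] * Jword [GKi i] [GK j] = Jword [GK i, GKi i] [GK j]"
    using m[of "[GK i]" "[GKi i]"] assms by simp
  also have "\<dots> = 1" using Jword_cong_quo(1)[OF quo_K_Ki] Jword_nil assms by simp
  finally have "Jword [GKi i] [GK j] = qquart powi (cartan N p i j)"
    unfolding Jfree_gens(6)[OF assms] by (simp add: power_int_minus field_simps)
  moreover have "Jword [GKi i, GKi i] [GK j, GK j] = Jword [GKi i] [GK j] ^ 4"
  proof -
    have "Jword [GKi i] ([GK j] @ [GK j]) = Jword [GKi i] [GK j] * Jword [GKi i] [GK j]"
      using assms by (subst Jword_mult_right) (auto simp: Lext_Delta)
    moreover have "Jword ([GKi i] @ [GKi i]) [GK j, GK j] = Jword [GKi i] [GK j, GK j] * Jword [GKi i] [GK j, GK j]"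
      using assms by (subst Jword_mult_left) (auto simp: Lext_Delta)
    ultimately show ?thesis by (simp add: power4_eq_xxxx mult.assoc)
  qed
  moreover have "emb (qh (2 * c)) = (qquart powi c) ^ 4" for c
  proof -
    have "emb (qh (2 * c)) = (qquart ^ 2) powi (2 * c)" by (simp add: emb_qhalf)
    also have "\<dots> = qquart powi (4 * c)"
      using power_int_mult[of qquart 2 "2 * c"] by simp
    also have "\<dots> = (qquart powi c) ^ 4"
      using power_int_mult[of qquart c 4] by (simp add: mult.commute)
    finally show ?thesis .
  qed
  ultimately show ?thesis by simp
qed

lemma Jword_Ki_E:
  assumes "i \<in> {1..<N}" "j \<in> {1..<N}"
  shows "Jword [GKi i, GKi i] [GE j] = 0"
proof -
  have "Jword ([GKi i] @ [GKi i]) [GE j] = 0"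
    using assms by (subst Jword_mult_left) (auto simp: Lext_Delta Jfree_gens simp del: append.simps)
  then show ?thesis by simp
qed

lemma Jword_F_mult:
  assumes "k \<in> {1..<N}" "x \<in> lists EK" "x' \<in> lists EK"
  shows "Jword [GF k] (x @ x') = Jword [GF k] x * Jword [] x'
    + (- 1) ^ (gpar p (GF k) * wpar p x) * Jword [GKi k, GKi k] x * Jword [GF k] x'"
  using assms by (subst Jword_mult_right) (auto simp: Lext_Delta simp del: gpar.simps)

lemma Jword_F_KK:
  assumes "k \<in> {1..<N}" "a \<in> {1..<N}"
  shows "Jword [GF k] [GK a, GK a] = 0"
  using Jword_F_mult[of k "[GK a]" "[GK a]"] assms by (simp add: Jfree_gens del: gpar.simps)

lemma Jword_F_KK_Cons:
  assumes "k \<in> {1..<N}" "a \<in> {1..<N}" "x \<in> lists EK"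
  shows "Jword [GF k] (GK a # GK a # x) = emb (qh (2 * cartan N p k a)) * Jword [GF k] x"
  using Jword_F_mult[of k "[GK a, GK a]" x] assms by (simp add: Jword_F_KK Jword_Ki_K del: gpar.simps emb_powi)

lemma Jword_F_E_Cons:
  assumes "k \<in> {1..<N}" "a \<in> {1..<N}" "x \<in> lists EK"
  shows "Jword [GF k] (GE a # x) = Jword [GF k] [GE a] * Jword [] x"
  using Jword_F_mult[of k "[GE a]" x] assms by (simp add: Jword_Ki_E del: gpar.simps)

lemma Jword_KK_F_zero:
  assumes "u \<in> lists FK" "u \<notin> lists (Kgens N)" "k \<in> {1..<N}"
  shows "Jword u [GK k, GK k] = 0"
  using assms(1,2)
proof (induction u)
  case (Cons a u)
  have "Jword ([a] @ u) [GK k, GK k] = Jword [a] [GK k, GK k] * Jword u [GK k, GK k]"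
    using assms(3) Cons.hyps by (subst Jword_mult_left) (auto simp: Lext_Delta)
  moreover have "Jword [a] [GK k, GK k] = 0" if "a \<notin> Kgens N"
    using that Cons.hyps(1) Jword_F_KK assms(3) by (auto simp: Fgens_def)
  ultimately show ?case using Cons by auto
qed simp

text \<open>A trailing $q^{h_k}$ is group-like and pairs to zero with every $f_i$, so only the term of the
coproduct survives in which it meets the empty word.\<close>

lemma Jword_append_KK:
  assumes "u \<in> lists (Fgens N)" "x \<in> lists EK" "k \<in> {1..<N}"
  shows "Jword u (x @ [GK k, GK k]) = Jword u x"
proof -
  have FK: "u \<in> lists FK" using assms(1) by auto
  have "Jword u (x @ [GK k, GK k]) = Lext (\<lambda>(y, y'). (- 1) ^ (wpar p y * wpar p y') *
    ((- 1) ^ (wpar p y * wpar p x) * Jword y' x * Jword y [GK k, GK k])) (DeltaJ_word p u)"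
    using assms FK by (intro Jword_mult_right) auto
  also have "\<dots> = Jword u x * Jword [] [GK k, GK k]"
  proof (subst Delta_F_counit_left[OF assms(1)], goal_cases)
    case (1 y y')
    then have "y \<in> lists FK" "y \<notin> lists (Kgens N)"
      by (auto simp: Fgens_def Kgens_def neq_Nil_conv)
    then show ?case using Jword_KK_F_zero assms(3) by simp
  qed simp
  also have "Jword [] [GK k, GK k] = 1"
    using Jword_nil_word[of "[GK k, GK k]"] assms(3) by simp
  finally show ?thesis by simp
qed

end

lemma scal_minus: "(- c) \<cdot> x = - (c \<cdot> (x :: 'a \<Rightarrow>\<^sub>0 K))"
  by (rule poly_mapping_eqI) simp

lemma linext_mult_ltr: "y * ltr a = linext (\<lambda>u. bas (u @ [a])) y"
  by (rule lin_eqI[of "\<lambda>y. y * ltr a" "linext (\<lambda>u. bas (u @ [a]))" y, OF lin_mult_right lin_linext])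
    (simp add: bas_mult)

lemma linext_ltr_mult: "ltr a * y = linext (\<lambda>u. bas (a # u)) y"
  by (rule lin_eqI[of "\<lambda>y. ltr a * y" "linext (\<lambda>u. bas (a # u))" y, OF lin_mult_left lin_linext])
    (simp add: bas_mult)

context pairing begin

lemma Eword_lists: "set l \<subseteq> {1..<N} \<Longrightarrow> Eword l \<in> lists (Egens N)"
  "set l \<subseteq> {1..<N} \<Longrightarrow> Eword l \<in> lists EK"
proof -
  assume l: "set l \<subseteq> {1..<N}"
  show E: "Eword l \<in> lists (Egens N)"
    using l unfolding Eword_def Egens_def lists_eq_set by (simp add: image_mono)
  show "Eword l \<in> lists EK" using E lists_mono[of "Egens N" EK] by blast
qed

lemma rel_ideal_mult:
  assumes "r \<in> rel_ideal N p" "a \<in> free_on (Egens N \<union> Fgens N \<union> Kgens N)"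
  shows "a * r \<in> rel_ideal N p" "r * a \<in> rel_ideal N p"
  using ideal.I_l_closed[OF ideal_rel_ideal assms(1), of a]
    ideal.I_r_closed[OF ideal_rel_ideal assms(1), of a] assms(2) by simp_all

lemma rel_ideal_add:
  assumes "r \<in> rel_ideal N p" "s \<in> rel_ideal N p"
  shows "r + s \<in> rel_ideal N p"
  using additive_subgroup.a_closed[OF ideal.axioms(1)[OF ideal_rel_ideal] assms] by simp

text \<open>The relation $q^{h_k/2} e_b q^{-h_k/2} = q^{a_{kb}/2} e_b$ holds in the quotient, on which the
pairing lives.\<close>

lemma K_past_E:
  assumes "k \<in> {1..<N}" "b \<in> {1..<N}" "u \<in> lists FK" "v \<in> lists EK" "w \<in> lists EK"
  shows "Jword u (v @ GK k # GE b # w) = emb (qh (cartan N p k b)) * Jword u (v @ GE b # GK k # w)"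
proof -
  let ?q = "qh (cartan N p k b)" and ?C = "free_on (Egens N \<union> Fgens N \<union> Kgens N)"
  have C: "bas z \<in> ?C" if "z \<in> lists EK" for z using that by auto
  \<comment> \<open>$K e - q^{a/2} e K = (K e K^{-1} - q^{a/2} e) K - K e (K^{-1} K - 1)$\<close>
  have "(ltr (GK k) * ltr (GE b) * ltr (GKi k) - ?q \<cdot> ltr (GE b)) * bas (GK k # w) \<in> rel_ideal N p"
    using relators.K_E[OF assms(1,2), of p] relators_rel_ideal assms C[of "GK k # w"]
    by (intro rel_ideal_mult) auto
  moreover have "bas [GK k, GE b] * ((ltr (GKi k) * ltr (GK k) - 1) * bas w) \<in> rel_ideal N p"
    using relators.K_inv2[OF assms(1), of p] relators_rel_ideal assms C[of w] C[of "[GK k, GE b]"]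
    by (intro rel_ideal_mult) auto
  then have "- 1 * (bas [GK k, GE b] * ((ltr (GKi k) * ltr (GK k) - 1) * bas w)) \<in> rel_ideal N p"
    by (rule rel_ideal_mult(1)) simp
  ultimately have "bas v * ((ltr (GK k) * ltr (GE b) * ltr (GKi k) - ?q \<cdot> ltr (GE b)) * bas (GK k # w)
     + - 1 * (bas [GK k, GE b] * ((ltr (GKi k) * ltr (GK k) - 1) * bas w))) \<in> rel_ideal N p"
    by (rule rel_ideal_mult(1)[OF rel_ideal_add C[OF assms(4)]])
  also have "bas v * ((ltr (GK k) * ltr (GE b) * ltr (GKi k) - ?q \<cdot> ltr (GE b)) * bas (GK k # w)
     + - 1 * (bas [GK k, GE b] * ((ltr (GKi k) * ltr (GK k) - 1) * bas w)))
    = bas (v @ GK k # GE b # w) - ?q \<cdot> bas (v @ GE b # GK k # w)"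
    by (simp add: left_diff_distrib right_diff_distrib distrib_left bas_mult scal_mult_left
        scal_mult_right one_eq_bas del: map_single)
  finally have "quo N p (bas (v @ GK k # GE b # w)) = quo N p (?q \<cdot> bas (v @ GE b # GK k # w))"
    using C[of "v @ GK k # GE b # w"] C[of "v @ GE b # GK k # w"] assms
    by (intro quo_eqI) (simp_all del: map_single free_on_closed(3))
  then have "Jword u (v @ GK k # GE b # w) = Jfree (bas u) (?q \<cdot> bas (v @ GE b # GK k # w))"
    by (simp add: Jword_def Jfree_def)
  also have "\<dots> = emb ?q * Jword u (v @ GE b # GK k # w)"
    unfolding Jword_def using assms by (intro Jfree_scal_right) auto
  finally show ?thesis .
qed

lemma KK_past_Eword:
  assumes "k \<in> {1..<N}" "set l \<subseteq> {1..<N}" "u \<in> lists FK" "v \<in> lists EK"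
  shows "Jword u (v @ GK k # GK k # Eword l)
    = emb (qh (2 * (\<Sum>b\<leftarrow>l. cartan N p k b))) * Jword u (v @ Eword l @ [GK k, GK k])"
  using assms(2,4)
proof (induction l arbitrary: v)
  case Nil
  then show ?case by (simp add: Eword_def)
next
  case (Cons b l)
  then have b: "b \<in> {1..<N}" "set l \<subseteq> {1..<N}" by auto
  let ?c = "cartan N p k b"
  have "Jword u (v @ GK k # GK k # GE b # Eword l)
      = emb (qh ?c) * Jword u ((v @ [GK k]) @ GE b # GK k # Eword l)"
    using K_past_E[of k b u "v @ [GK k]" "Eword l"] assms b Cons.prems Eword_lists(2)[OF b(2)] by simp
  also have "\<dots> = emb (qh ?c) * (emb (qh ?c) * Jword u ((v @ [GE b]) @ GK k # GK k # Eword l))"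
    using K_past_E[of k b u v "GK k # Eword l"] assms b Cons.prems Eword_lists(2)[OF b(2)] by simp
  also have "Jword u ((v @ [GE b]) @ GK k # GK k # Eword l)
      = emb (qh (2 * (\<Sum>b\<leftarrow>l. cartan N p k b))) * Jword u ((v @ [GE b]) @ Eword l @ [GK k, GK k])"
    using b Cons.prems by (intro Cons.IH) auto
  also have "emb (qh ?c) * (emb (qh ?c) * (emb (qh (2 * (\<Sum>b\<leftarrow>l. cartan N p k b))) * t))
      = emb (qh (2 * (?c + (\<Sum>b\<leftarrow>l. cartan N p k b)))) * t" for t
    unfolding distrib_left mult_2[of ?c] qh_simps(1) emb_ring_hom(4) by (simp only: mult.assoc)
  finally show ?case by (simp add: Eword_def)
qed

lemma Jword_F_nil: "k \<in> {1..<N} \<Longrightarrow> Jword [GF k] [] = 0"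
  using Jword_append_KK[of "[GF k]" "[]" k] Jword_F_KK[of k k] by simp

text \<open>Expanding the word by its coproduct, the factor $f_k$ pairs only with a right tensor component that
is the single letter $e_k$. The coproduct puts $q^{h_k}$ in the place of that letter in the left component;
moving it to the right end, where it disappears, produces the power of $q$.\<close>

lemma Jword_F_right:
  assumes "u \<in> lists (Fgens N)" "k \<in> {1..<N}" "set l \<subseteq> {1..<N}"
  shows "Jword (u @ [GF k]) (Eword l) = Jword [GF k] [GE k] * skewR N p k (\<lambda>l. Jword u (Eword l)) l"
proof -
  let ?g = "gpar p (GF k)" and ?c = "Jword [GF k] [GE k]"
  have u: "u \<in> lists FK" using assms(1) by auto
  \<comment> \<open>the prefix \<open>x0\<close> collects the letters that have already gone to the left tensor factor\<close>
  define G where "G x0 l = Lext (\<lambda>(x1, x2). (- 1) ^ (?g * wpar p x1) * Jword u (x0 @ x1) * Jword [GF k] x2)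
    (DeltaJ_word p (Eword l))" for x0 l
  have "G x0 l = ?c * skewR N p k (\<lambda>l. Jword u (x0 @ Eword l)) l"
    if "x0 \<in> lists EK" "set l \<subseteq> {1..<N}" for x0 l
    using that
  proof (induction l arbitrary: x0)
    case Nil
    then show ?case by (simp add: G_def Eword_def Jword_F_nil[OF assms(2)])
  next
    case (Cons a l)
    then have a: "a \<in> {1..<N}" and l: "set l \<subseteq> {1..<N}" by auto
    let ?D = "DeltaJ_word p (Eword l)"
    have first: "Lext (\<lambda>(x1, x2). (- 1) ^ (gpar p (GE a) * wpar p x1) * ((- 1) ^ (?g * wpar p x1) *
          Jword u (x0 @ GK a # GK a # x1) * Jword [GF k] (GE a # x2))) ?D
        = (if a = k then ?c * (emb (qh (2 * (\<Sum>b\<leftarrow>l. cartan N p k b))) * Jword u (x0 @ Eword l)) else 0)"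
    proof -
      have "Lext (\<lambda>(x1, x2). (- 1) ^ (gpar p (GE a) * wpar p x1) * ((- 1) ^ (?g * wpar p x1) *
          Jword u (x0 @ GK a # GK a # x1) * Jword [GF k] (GE a # x2))) ?D
        = Lext (\<lambda>(x1, x2). (if a = k then ?c else 0) * Jword u (x0 @ GK a # GK a # x1)
            * of_bool (x2 \<in> lists (Kgens N))) ?D"
      proof (rule Lext_cong, clarify)
        fix x1 x2 assume "(x1, x2) \<in> Poly_Mapping.keys ?D"
        then have x2: "x2 \<in> lists EK" using keys_Delta_E[OF _ l] by auto
        have "Jword [GF k] (GE a # x2) = (if a = k then ?c else 0) * of_bool (x2 \<in> lists (Kgens N))"
          using Jword_F_E_Cons[OF assms(2) a x2] Jword_nil_word[OF x2] a Jfree_gens(5)[OF assms(2) a] by auto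
        moreover have "(- 1 :: L) ^ (gpar p (GE k) * wpar p x1) * (- 1) ^ (gpar p (GF k) * wpar p x1) = 1"
          by (simp flip: power_add)
        ultimately show "(- 1) ^ (gpar p (GE a) * wpar p x1) * ((- 1) ^ (?g * wpar p x1) *
            Jword u (x0 @ GK a # GK a # x1) * Jword [GF k] (GE a # x2))
          = (if a = k then ?c else 0) * Jword u (x0 @ GK a # GK a # x1) * of_bool (x2 \<in> lists (Kgens N))"
          by (auto simp: mult.assoc[symmetric] simp del: gpar.simps)
      qed
      also have "\<dots> = (if a = k then ?c else 0) * Jword u (x0 @ GK a # GK a # Eword l)"
        by (subst Delta_E_counit_right[where N = N]) auto
      also have "Jword u (x0 @ GK a # GK a # Eword l)
          = emb (qh (2 * (\<Sum>b\<leftarrow>l. cartan N p a b))) * Jword u (x0 @ Eword l)"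
        using KK_past_Eword[OF a l u Cons.prems(1)] Jword_append_KK[OF assms(1), of "x0 @ Eword l" a]
          Cons.prems(1) Eword_lists(2)[OF l] a by simp
      finally show ?thesis by simp
    qed
    have second: "Lext (\<lambda>(x1, x2). (- 1) ^ (?g * wpar p (GE a # x1)) * Jword u (x0 @ GE a # x1) * Jword [GF k] x2) ?D
        = (- 1) ^ (?g * gpar p (GE a)) * G (x0 @ [GE a]) l"
      unfolding G_def Lext_cmult[symmetric]
      by (rule Lext_cong) (auto simp: distrib_left power_add mult.assoc simp del: gpar.simps)
    have "G x0 (a # l) = Lext (\<lambda>(x1, x2). (- 1) ^ (gpar p (GE a) * wpar p x1) * ((- 1) ^ (?g * wpar p x1) *
          Jword u (x0 @ GK a # GK a # x1) * Jword [GF k] (GE a # x2))) ?D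
        + Lext (\<lambda>(x1, x2). (- 1) ^ (?g * wpar p (GE a # x1)) * Jword u (x0 @ GE a # x1) * Jword [GF k] x2) ?D"
      unfolding G_def by (simp add: Eword_def Lext_Delta_E del: gpar.simps) (simp only: gpar.simps add_0)
    also have "\<dots> = ?c * skewR N p k (\<lambda>l. Jword u (x0 @ Eword l)) (a # l)"
      unfolding first second using Cons.IH[of "x0 @ [GE a]"] Cons.prems a
      by (simp add: Eword_def distrib_left mult.assoc mult.left_commute del: gpar.simps)
    finally show ?case .
  qed
  from this[of "[]" l] have "G [] l = ?c * skewR N p k (\<lambda>l. Jword u (Eword l)) l" using assms(3) by simp
  moreover have "Jword (u @ [GF k]) (Eword l) = G [] l"
    using u assms(2) Eword_lists(2)[OF assms(3)]
    by (subst Jword_mult_left) (auto simp: G_def simp del: gpar.simps)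
  ultimately show ?thesis by simp
qed

text \<open>Here $f_k$ meets the left tensor component, which must be $e_k$ together with factors $q^{h_a}$
for all other letters. Those to the right of $e_k$ contribute nothing, those to its left
contribute the power of $q$.\<close>

lemma Jword_F_left:
  assumes "u \<in> lists (Fgens N)" "k \<in> {1..<N}" "set l \<subseteq> {1..<N}"
  shows "Jword (GF k # u) (Eword l) = Jword [GF k] [GE k] * skewL N p k (wpar p u) (\<lambda>l. Jword u (Eword l)) l"
proof -
  let ?g = "gpar p (GF k)" and ?c = "Jword [GF k] [GE k]"
  have u: "u \<in> lists FK" using assms(1) by auto
  \<comment> \<open>\<open>s\<close> accumulates the parity of \<open>u\<close> and of the letters that have gone to the right factor\<close>
  define G where "G x0 s l = Lext (\<lambda>(x1, x2). (- 1) ^ (s * wpar p x1) * Jword [GF k] x1 * Jword u (x0 @ x2))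
    (DeltaJ_word p (Eword l))" for x0 s l
  have "G x0 s l = ?c * skewL N p k s (\<lambda>l. Jword u (x0 @ Eword l)) l"
    if "x0 \<in> lists EK" "set l \<subseteq> {1..<N}" for x0 s l
    using that
  proof (induction l arbitrary: x0 s)
    case Nil
    then show ?case by (simp add: G_def Eword_def Jword_F_nil[OF assms(2)])
  next
    case (Cons a l)
    then have a: "a \<in> {1..<N}" and l: "set l \<subseteq> {1..<N}" by auto
    let ?D = "DeltaJ_word p (Eword l)"
    have first: "Lext (\<lambda>(x1, x2). (- 1) ^ (gpar p (GE a) * wpar p x1) * ((- 1) ^ (s * wpar p x1) *
          Jword [GF k] (GK a # GK a # x1) * Jword u (x0 @ GE a # x2))) ?D
        = emb (qh (2 * cartan N p k a)) * G (x0 @ [GE a]) (s + gpar p (GE a)) l"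
      unfolding G_def Lext_cmult[symmetric]
    proof (rule Lext_cong, clarify)
      fix x1 x2 assume "(x1, x2) \<in> Poly_Mapping.keys ?D"
      then have "x1 \<in> lists EK" using keys_Delta_E[OF _ l] by auto
      note eq = Jword_F_KK_Cons[OF assms(2) a this]
      have sgn: "(- 1 :: L) ^ ((s + gpar p (GE a)) * wpar p x1)
          = (- 1) ^ (gpar p (GE a) * wpar p x1) * (- 1) ^ (s * wpar p x1)"
        by (simp add: distrib_right power_add del: gpar.simps)
      show "(- 1) ^ (gpar p (GE a) * wpar p x1) * ((- 1) ^ (s * wpar p x1) *
          Jword [GF k] (GK a # GK a # x1) * Jword u (x0 @ GE a # x2))
        = emb (qh (2 * cartan N p k a)) * ((- 1) ^ ((s + gpar p (GE a)) * wpar p x1) *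
          Jword [GF k] x1 * Jword u ((x0 @ [GE a]) @ x2))"
        unfolding eq sgn by (simp add: mult_ac del: gpar.simps emb_powi)
    qed
    have second: "Lext (\<lambda>(x1, x2). (- 1) ^ (s * wpar p (GE a # x1)) * Jword [GF k] (GE a # x1) * Jword u (x0 @ x2)) ?D
        = (if a = k then ?c * ((- 1) ^ (s * ?g) * Jword u (x0 @ Eword l)) else 0)"
    proof -
      have "Lext (\<lambda>(x1, x2). (- 1) ^ (s * wpar p (GE a # x1)) * Jword [GF k] (GE a # x1) * Jword u (x0 @ x2)) ?D
        = Lext (\<lambda>(x1, x2). (if a = k then ?c * (- 1) ^ (s * ?g) else 0) * (- 1) ^ (s * wpar p x1) * Jword u (x0 @ x2)
            * of_bool (x1 \<in> lists (Kgens N))) ?D"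
      proof (rule Lext_cong, clarify)
        fix x1 x2 assume "(x1, x2) \<in> Poly_Mapping.keys ?D"
        then have x1: "x1 \<in> lists EK" using keys_Delta_E[OF _ l] by auto
        have "Jword [GF k] (GE a # x1) = (if a = k then ?c else 0) * of_bool (x1 \<in> lists (Kgens N))"
          using Jword_F_E_Cons[OF assms(2) a x1] Jword_nil_word[OF x1] a Jfree_gens(5)[OF assms(2) a] by auto
        moreover have "gpar p (GE k) = ?g" by simp
        ultimately show "(- 1) ^ (s * wpar p (GE a # x1)) * Jword [GF k] (GE a # x1) * Jword u (x0 @ x2)
          = (if a = k then ?c * (- 1) ^ (s * ?g) else 0) * (- 1) ^ (s * wpar p x1) * Jword u (x0 @ x2)
            * of_bool (x1 \<in> lists (Kgens N))"
          by (auto simp: distrib_left power_add simp del: gpar.simps)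
      qed
      also have "\<dots> = (if a = k then ?c * (- 1) ^ (s * ?g) else 0) * Jword u (x0 @ Eword l)"
      proof -
        have par: "wpar p (concat (map (\<lambda>a. [GK a, GK a]) l)) = 0" for l by (induction l) auto
        have K: "concat (map (\<lambda>a. [GK a, GK a]) l) \<in> lists (Kgens N)"
          using l by (induction l) auto
        show ?thesis by (subst Delta_E_counit_left[where N = N]) (use K in \<open>auto simp: par simp del: gpar.simps\<close>)
      qed
      finally show ?thesis by simp
    qed
    have "G x0 s (a # l) = Lext (\<lambda>(x1, x2). (- 1) ^ (gpar p (GE a) * wpar p x1) * ((- 1) ^ (s * wpar p x1) *
          Jword [GF k] (GK a # GK a # x1) * Jword u (x0 @ GE a # x2))) ?D
        + Lext (\<lambda>(x1, x2). (- 1) ^ (s * wpar p (GE a # x1)) * Jword [GF k] (GE a # x1) * Jword u (x0 @ x2)) ?D"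
      unfolding G_def by (simp add: Eword_def Lext_Delta_E del: gpar.simps) (simp only: gpar.simps add_0)
    also have "\<dots> = ?c * skewL N p k s (\<lambda>l. Jword u (x0 @ Eword l)) (a # l)"
      unfolding first second using Cons.IH[of "x0 @ [GE a]"] Cons.prems a
      by (simp add: Eword_def distrib_left mult.assoc mult.left_commute del: gpar.simps emb_powi)
    finally show ?case .
  qed
  from this[of "[]" l "wpar p u"] have "G [] (wpar p u) l = ?c * skewL N p k (wpar p u) (\<lambda>l. Jword u (Eword l)) l"
    using assms(3) by simp
  moreover have "Jword ([GF k] @ u) (Eword l) = G [] (wpar p u) l"
    using u assms(2) Eword_lists(2)[OF assms(3)]
    by (subst Jword_mult_left) (auto simp: G_def simp del: gpar.simps)
  ultimately show ?thesis by simp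
qed

lemma Jfree_zero: "y \<in> free_on FK \<Longrightarrow> Jfree y 0 = 0" "x \<in> free_on EK \<Longrightarrow> Jfree 0 x = 0"
  using Jfree_scal_right[of y 0 0] Jfree_scal_left[of 0 x 0] by simp_all

lemma Jfree_sum_left: "(\<And>a. a \<in> A \<Longrightarrow> f a \<in> free_on FK) \<Longrightarrow> x \<in> free_on EK \<Longrightarrow> Jfree (sum f A) x = (\<Sum>a\<in>A. Jfree (f a) x)"
  by (induction A rule: infinite_finite_induct) (auto simp: Jfree_zero Jfree_add_left free_on_sum)

lemma Jfree_sum_right: "(\<And>a. a \<in> A \<Longrightarrow> f a \<in> free_on EK) \<Longrightarrow> y \<in> free_on FK \<Longrightarrow> Jfree y (sum f A) = (\<Sum>a\<in>A. Jfree y (f a))"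
  by (induction A rule: infinite_finite_induct) (auto simp: Jfree_zero Jfree_add_right free_on_sum)

lemma Jfree_Lext_left:
  assumes "y \<in> free_on FK" "x \<in> free_on EK"
  shows "Jfree y x = Lext (\<lambda>u. Jfree (bas u) x) y"
proof -
  have k: "bas u \<in> free_on FK" if "u \<in> Poly_Mapping.keys y" for u
    using that assms(1) by (auto simp: free_on_def)
  have "Jfree (y) x = Jfree (\<Sum>u\<in>Poly_Mapping.keys y. coef y u \<cdot> bas u) x"
    using linext_expand[of y] by (simp add: linext_def)
  also have "\<dots> = (\<Sum>u\<in>Poly_Mapping.keys y. Jfree (coef y u \<cdot> bas u) x)"
    by (rule Jfree_sum_left) (use k assms in \<open>simp_all del: map_single free_on_closed(3)\<close>)
  also have "\<dots> = Lext (\<lambda>u. Jfree (bas u) x) y"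
    unfolding Lext_def
    by (rule sum.cong) (use k assms in \<open>simp_all add: Jfree_scal_left del: map_single free_on_closed(3)\<close>)
  finally show ?thesis .
qed

lemma Jfree_Lext_right:
  assumes "y \<in> free_on FK" "x \<in> free_on EK"
  shows "Jfree y x = Lext (\<lambda>w. Jfree y (bas w)) x"
proof -
  have k: "bas u \<in> free_on EK" if "u \<in> Poly_Mapping.keys x" for u
    using that assms(2) by (auto simp: free_on_def)
  have "Jfree y (x) = Jfree y (\<Sum>u\<in>Poly_Mapping.keys x. coef x u \<cdot> bas u)"
    using linext_expand[of x] by (simp add: linext_def)
  also have "\<dots> = (\<Sum>u\<in>Poly_Mapping.keys x. Jfree y (coef x u \<cdot> bas u))"
    by (rule Jfree_sum_right) (use k assms in \<open>simp_all del: map_single free_on_closed(3)\<close>)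
  also have "\<dots> = Lext (\<lambda>u. Jfree y (bas u)) x"
    unfolding Lext_def
    by (rule sum.cong) (use k assms in \<open>simp_all add: Jfree_scal_right del: map_single free_on_closed(3)\<close>)
  finally show ?thesis .
qed

lemma free_on_FK: "y \<in> free_on (Fgens N) \<Longrightarrow> y \<in> free_on FK"
  and free_on_EK: "x \<in> free_on (Egens N) \<Longrightarrow> x \<in> free_on EK"
  using free_on_mono by blast+

lemma skewR_cong:
  assumes "\<And>l. set l \<subseteq> S \<Longrightarrow> \<phi> l = \<psi> l" "set l \<subseteq> S"
  shows "skewR N p k \<phi> l = skewR N p k \<psi> l"
  using assms
proof (induction l arbitrary: \<phi> \<psi>)
  case (Cons a l)
  have "skewR N p k (\<lambda>l. \<phi> (a # l)) l = skewR N p k (\<lambda>l. \<psi> (a # l)) l"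
    using Cons.prems by (intro Cons.IH) auto
  with Cons.prems show ?case by simp
qed simp

lemma skewL_cong:
  assumes "\<And>l. set l \<subseteq> S \<Longrightarrow> \<phi> l = \<psi> l" "set l \<subseteq> S"
  shows "skewL N p k s \<phi> l = skewL N p k s \<psi> l"
  using assms
proof (induction l arbitrary: \<phi> \<psi> s)
  case (Cons a l)
  have "skewL N p k (s + gpar p (GE a)) (\<lambda>l. \<phi> (a # l)) l = skewL N p k (s + gpar p (GE a)) (\<lambda>l. \<psi> (a # l)) l"
    using Cons.prems by (intro Cons.IH) auto
  with Cons.prems show ?case by simp
qed simp

lemma Jfree_Eword:
  assumes "y \<in> free_on (Fgens N)" "set l \<subseteq> {1..<N}"
  shows "Jfree y (bas (Eword l)) = Lext (\<lambda>u. Jword u (Eword l)) y"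
  unfolding Jword_def using assms free_on_FK Eword_lists by (intro Jfree_Lext_left) auto

lemma Jfree_F_right:
  assumes "y \<in> free_on (Fgens N)" "k \<in> {1..<N}" "set l \<subseteq> {1..<N}"
  shows "Jfree (y * ltr (GF k)) (bas (Eword l)) = Jword [GF k] [GE k] * skewR N p k (\<lambda>l. Jfree y (bas (Eword l))) l"
proof -
  have "y * ltr (GF k) \<in> free_on (Fgens N)" using assms by simp
  then have "Jfree (y * ltr (GF k)) (bas (Eword l)) = Lext (\<lambda>u. Jword u (Eword l)) (y * ltr (GF k))"
    using assms(3) by (rule Jfree_Eword)
  also have "\<dots> = Lext (\<lambda>u. Jword u (Eword l)) (linext (\<lambda>u. bas (u @ [GF k])) y)"
    unfolding linext_mult_ltr ..
  also have "\<dots> = Lext (\<lambda>u. Jword (u @ [GF k]) (Eword l)) y"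
    by (simp add: Lext_linext)
  also have "\<dots> = Lext (\<lambda>u. Jword [GF k] [GE k] * skewR N p k (\<lambda>l. Jword u (Eword l)) l) y"
    using assms by (intro Lext_cong Jword_F_right) (auto simp: free_on_def)
  also have "\<dots> = Jword [GF k] [GE k] * skewR N p k (\<lambda>l. Lext (\<lambda>u. Jword u (Eword l)) y) l"
    by (simp add: Lext_cmult Lext_skewR)
  also have "skewR N p k (\<lambda>l. Lext (\<lambda>u. Jword u (Eword l)) y) l = skewR N p k (\<lambda>l. Jfree y (bas (Eword l))) l"
    by (rule skewR_cong[OF _ assms(3)]) (simp add: Jfree_Eword assms(1))
  finally show ?thesis .
qed

lemma Jfree_F_left:
  assumes "y \<in> free_on (Fgens N)" "k \<in> {1..<N}" "set l \<subseteq> {1..<N}"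
    "\<And>u. u \<in> Poly_Mapping.keys y \<Longrightarrow> wpar p u = s"
  shows "Jfree (ltr (GF k) * y) (bas (Eword l)) = Jword [GF k] [GE k] * skewL N p k s (\<lambda>l. Jfree y (bas (Eword l))) l"
proof -
  have "ltr (GF k) * y \<in> free_on (Fgens N)" using assms by simp
  then have "Jfree (ltr (GF k) * y) (bas (Eword l)) = Lext (\<lambda>u. Jword u (Eword l)) (ltr (GF k) * y)"
    using assms(3) by (rule Jfree_Eword)
  also have "\<dots> = Lext (\<lambda>u. Jword u (Eword l)) (linext (\<lambda>u. bas (GF k # u)) y)"
    unfolding linext_ltr_mult ..
  also have "\<dots> = Lext (\<lambda>u. Jword (GF k # u) (Eword l)) y"
    by (simp add: Lext_linext)
  also have "\<dots> = Lext (\<lambda>u. Jword [GF k] [GE k] * skewL N p k s (\<lambda>l. Jword u (Eword l)) l) y"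
  proof (rule Lext_cong)
    fix u assume u: "u \<in> Poly_Mapping.keys y"
    then have "u \<in> lists (Fgens N)" using assms(1) by (auto simp: free_on_def)
    from Jword_F_left[OF this assms(2,3)] assms(4)[OF u]
    show "Jword (GF k # u) (Eword l) = Jword [GF k] [GE k] * skewL N p k s (\<lambda>l. Jword u (Eword l)) l" by simp
  qed
  also have "\<dots> = Jword [GF k] [GE k] * skewL N p k s (\<lambda>l. Lext (\<lambda>u. Jword u (Eword l)) y) l"
    by (simp add: Lext_cmult Lext_skewL)
  also have "skewL N p k s (\<lambda>l. Lext (\<lambda>u. Jword u (Eword l)) y) l = skewL N p k s (\<lambda>l. Jfree y (bas (Eword l))) l"
    by (rule skewL_cong[OF _ assms(3)]) (simp add: Jfree_Eword assms(1))
  finally show ?thesis .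
qed

end

section \<open>Root vectors\<close>

lemma skew_zero [simp]: "skewR N p k (\<lambda>_. 0) l = 0" "skewL N p k s (\<lambda>_. 0) l = 0"
  by (induction l arbitrary: s) (auto simp del: gpar.simps)

lemma skew_delta_Nil:
  "skewR N p k (\<lambda>l. of_bool (l = [])) l = of_bool (l = [k])"
  "skewL N p k s (\<lambda>l. of_bool (l = [])) l = (- 1) ^ (s * gpar p (GF k)) * of_bool (l = [k])"
  by (cases l; auto simp del: gpar.simps)+

lemma sum_cartan_upt:
  assumes "1 \<le> i" "i < j" "j < N"
  shows "(\<Sum>b\<leftarrow>[i..<j]. cartan N p j b) = - ((- 1) ^ p j)"
proof -
  obtain j' where j: "j = Suc j'" using assms(2) by (cases j) auto
  have "(\<Sum>b\<leftarrow>[i..<j']. cartan N p j b) = 0"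
  proof -
    have "map (cartan N p j) [i..<j'] = map (\<lambda>_. 0) [i..<j']"
      using assms j by (intro map_cong) (auto simp: cartan_eq)
    then show ?thesis by (simp only: sum_list_0)
  qed
  moreover have "cartan N p j j' = - ((- 1) ^ p j)"
    using assms j by (subst cartan_eq) auto
  ultimately show ?thesis using assms j by simp
qed

text \<open>The cancellation behind the $q$-commutator. Deleting \<open>j\<close> from \<open>l\<close> can give
\<open>[i..<j]\<close> only if \<open>l\<close> arises by inserting \<open>j\<close>. If it is inserted before the letter
$j - 1$, only \<open>skewR\<close> acquires a power of $q$, namely $q^{a_{j,j-1}}$, and the coefficient is chosen so that
the two deletions cancel. If it is inserted after $j - 1$, the power of $q$ arises in
\<open>skewL\<close> instead, and the difference does not vanish.\<close>

lemma skew_diff_delta: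
  assumes "1 \<le> i" "i < j" "j < N"
  shows "skewL N p j s (\<lambda>l. of_bool (l = [i..<j])) l
    - (- 1) ^ (s * gpar p (GF j)) * emb (qh (2 * (- 1) ^ p j)) * skewR N p j (\<lambda>l. of_bool (l = [i..<j])) l
    = of_bool (l = [i..<j] @ [j]) * (- 1) ^ ((s + wpar p (Eword [i..<j])) * gpar p (GF j))
       * emb (qh (- 2 * (- 1) ^ p j) - qh (2 * (- 1) ^ p j))"
  using assms
proof (induction l arbitrary: i s)
  case Nil
  then show ?case by simp
next
  case (Cons b l)
  let ?g = "gpar p (GF j)" and ?Q = "emb (qh (2 * (- 1) ^ p j))" and ?Qi = "emb (qh (- 2 * (- 1) ^ p j))"
  have upt: "[i..<j] = i # [Suc i..<j]" using Cons.prems by (simp add: upt_conv_Cons)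
  have QQ: "?Q * ?Qi = 1"
    unfolding emb_ring_hom(4)[symmetric] by (simp flip: qh_simps(1))
  consider "b = j" | "b = i" "b \<noteq> j" | "b \<noteq> i" "b \<noteq> j" by blast
  then show ?case
  proof cases
    case 1
    then have "(\<lambda>l. of_bool (b # l = [i..<j]) :: L) = (\<lambda>_. 0)" "b # l \<noteq> [i..<j] @ [j]"
      using Cons.prems by (auto simp: upt)
    moreover have "?Q * emb (qh (2 * (\<Sum>b\<leftarrow>[i..<j]. cartan N p j b))) = 1"
      using sum_cartan_upt[OF Cons.prems, of p] QQ by simp
    ultimately show ?thesis using 1
      by (auto simp: mult.assoc simp del: gpar.simps emb_powi)
  next
    case 2
    have d: "(\<lambda>l. of_bool (b # l = [i..<j]) :: L) = (\<lambda>l. of_bool (l = [Suc i..<j]))"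
      using 2 by (auto simp: upt)
    have w: "wpar p (Eword [i..<j]) = gpar p (GE i) + wpar p (Eword [Suc i..<j])"
      by (simp add: upt Eword_def)
    let ?gi = "gpar p (GE i)" and ?\<delta> = "\<lambda>l. of_bool (l = [Suc i..<j]) :: L"
    let ?A = "(- 1 :: L) ^ (s * ?g)" and ?C = "(- 1 :: L) ^ (?g * ?gi)"
    have L: "skewL N p j s (\<lambda>l. of_bool (l = [i..<j])) (b # l)
        = emb (qh (2 * cartan N p j i)) * skewL N p j (s + ?gi) ?\<delta> l"
      and R: "skewR N p j (\<lambda>l. of_bool (l = [i..<j])) (b # l) = ?C * skewR N p j ?\<delta> l"
      unfolding skewL.simps skewR.simps d using 2 by (simp_all del: gpar.simps)
    have bl: "(b # l = [i..<j] @ [j]) = (l = [Suc i..<j] @ [j])" using 2 by (simp add: upt)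
    have sg: "(- 1 :: L) ^ ((s + ?gi) * ?g) = ?A * ?C"
      by (simp add: distrib_right power_add mult.commute[of ?gi ?g] del: gpar.simps)
    show ?thesis
    proof (cases "Suc i = j")
      case True
      have c: "2 * cartan N p j i = - 2 * (- 1) ^ p j" using Cons.prems True by (subst cartan_eq) auto
      have nil: "[Suc i..<j] = []" using True by simp
      show ?thesis unfolding L R bl w c nil skew_delta_Nil sg
        by (simp add: Eword_def sg del: gpar.simps emb_powi) (simp add: algebra_simps del: gpar.simps emb_powi)
    next
      case False
      then have c: "cartan N p j i = 0" using Cons.prems by (subst cartan_eq) auto
      have IH: "skewL N p j (s + ?gi) ?\<delta> l - (- 1) ^ ((s + ?gi) * ?g) * ?Q * skewR N p j ?\<delta> l
        = of_bool (l = [Suc i..<j] @ [j]) * (- 1) ^ ((s + ?gi + wpar p (Eword [Suc i..<j])) * ?g)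
           * (?Qi - ?Q)"
        using Cons.IH[of "Suc i" "s + ?gi"] Cons.prems False by (simp del: gpar.simps emb_powi)
      show ?thesis unfolding L R bl w c using IH unfolding sg
        by (simp add: mult_ac add.assoc del: gpar.simps emb_powi)
    qed
  next
    case 3
    then have "(\<lambda>l. of_bool (b # l = [i..<j]) :: L) = (\<lambda>_. 0)" "b # l \<noteq> [i..<j] @ [j]"
      by (auto simp: upt)
    with 3 show ?thesis by (simp del: gpar.simps)
  qed
qed

text \<open>The negative root vector of weight $\varepsilon_j - \varepsilon_i$, $j = i + d + 1$, as an
iterated $q$-commutator of $f_i, \dots, f_{j-1}$. It is scaled so that it pairs to \<open>1\<close>
with the word $e_i \cdots e_{j-1}$.\<close>

fun rootF :: "(nat \<Rightarrow> nat) \<Rightarrow> nat \<Rightarrow> nat \<Rightarrow> falg" where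
  "rootF p i 0 = ((- 1) ^ gpar p (GF i) * (qh (- 2) - qh 2)) \<cdot> ltr (GF i)"
| "rootF p i (Suc d) = (- 1) ^ p (i + d + 2) \<cdot> (ltr (GF (i + d + 1)) * rootF p i d
     - ((- 1) ^ (wpar p (Eword [i..<i + d + 1]) * gpar p (GF (i + d + 1))) * qh (2 * (- 1) ^ p (i + d + 1)))
       \<cdot> (rootF p i d * ltr (GF (i + d + 1))))"

lemma rootF_free: "1 \<le> i \<Longrightarrow> i + d < N \<Longrightarrow> rootF p i d \<in> free_on (Fgens N)"
  by (induction d) (auto simp: Fgens_def simp del: map_single gpar.simps)

lemma wpar_mset_cong: "mset u = mset v \<Longrightarrow> wpar p u = wpar p v"
  unfolding wpar_def by (metis sum_mset_sum_list mset_map)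

lemma keys_scal: "Poly_Mapping.keys (c \<cdot> x) \<subseteq> Poly_Mapping.keys (x :: 'a \<Rightarrow>\<^sub>0 K)"
  by (auto simp: in_keys_iff)

lemma homog_mult: "a \<in> homog M \<Longrightarrow> b \<in> homog M' \<Longrightarrow> a * b \<in> homog (M + M')"
  using keys_mult[of a b] unfolding homog_def by (fastforce simp: plus_list_def)

lemma homog_lin:
  assumes "a \<in> homog M" shows "c \<cdot> a \<in> homog M" and "b \<in> homog M \<Longrightarrow> a - b \<in> homog M"
proof -
  show "c \<cdot> a \<in> homog M" using assms keys_scal[of c a] unfolding homog_def by blast
  have "Poly_Mapping.keys (a - b) \<subseteq> Poly_Mapping.keys a \<union> Poly_Mapping.keys b"
    by (auto simp: in_keys_iff lookup_minus)
  then show "b \<in> homog M \<Longrightarrow> a - b \<in> homog M" using assms unfolding homog_def by blast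
qed

lemma rootF_homog: "rootF p i d \<in> homog (mset (Fword [i..<i + d + 1]))"
proof (induction d)
  case 0
  show ?case unfolding rootF.simps by (intro homog_lin) (simp add: homog_def Fword_def)
next
  case (Suc d)
  let ?M = "mset (Fword [i..<i + d + 1])" and ?f = "GF (i + d + 1)"
  have eq: "mset (Fword [i..<i + Suc d + 1]) = {#?f#} + ?M" "?M + {#?f#} = {#?f#} + ?M"
    by (simp_all add: Fword_def)
  have "ltr ?f * rootF p i d \<in> homog ({#?f#} + ?M)" "rootF p i d * ltr ?f \<in> homog ({#?f#} + ?M)"
    using homog_mult[OF homog_ltr Suc.IH, of ?f] homog_mult[OF Suc.IH homog_ltr, of ?f] unfolding eq(2) by auto
  then show ?case unfolding rootF.simps eq(1) by (intro homog_lin)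
qed

lemma wpar_rootF:
  assumes "u \<in> Poly_Mapping.keys (rootF p i d)"
  shows "wpar p u = wpar p (Eword [i..<i + d + 1])"
proof -
  have "mset u = mset (Fword [i..<i + d + 1])" using rootF_homog[of p i d] assms by (auto simp: homog_def)
  then have "wpar p u = wpar p (Fword [i..<i + d + 1])" by (rule wpar_mset_cong)
  also have "wpar p (Fword l) = wpar p (Eword l)" for l
    by (induction l) (auto simp: Fword_def Eword_def)
  finally show ?thesis .
qed

context pairing begin

lemma Jfree_rootF_Eword:
  assumes "1 \<le> i" "i + d < N" "set l \<subseteq> {1..<N}"
  shows "Jfree (rootF p i d) (bas (Eword l)) = of_bool (l = [i..<i + d + 1])"
  using assms(2,3)
proof (induction d arbitrary: l)
  case 0
  then have i: "i \<in> {1..<N}" using assms(1) by simp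
  have nz: "emb (qh (- 2) - qh 2) \<noteq> 0" using q_minus_qinv_nz(2) by (simp del: emb_diff)
  have x: "bas (Eword l) \<in> free_on EK" using Eword_lists(2)[OF 0(2)] by simp
  have Jword0: "Jword [] (Eword l') = of_bool (l' = [])" if "set l' \<subseteq> {1..<N}" for l'
  proof -
    have "(Eword l' \<in> lists (Kgens N)) = (l' = [])" by (cases l') (auto simp: Eword_def EFK_disjoint)
    then show ?thesis using Jword_nil_word[OF Eword_lists(2)[OF that]] i by simp
  qed
  have "Jword ([] @ [GF i]) (Eword l) = Jword [GF i] [GE i] * skewR N p i (\<lambda>l. Jword [] (Eword l)) l"
    using i 0 by (intro Jword_F_right) auto
  also have "skewR N p i (\<lambda>l. Jword [] (Eword l)) l = skewR N p i (\<lambda>l. of_bool (l = [])) l"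
    by (rule skewR_cong[OF _ 0(2)]) (rule Jword0)
  finally have 1: "Jfree (ltr (GF i)) (bas (Eword l)) = Jword [GF i] [GE i] * of_bool (l = [i])"
    by (simp add: skew_delta_Nil Jword_def)
  have "Jfree (rootF p i 0) (bas (Eword l))
      = emb ((- 1) ^ gpar p (GF i) * (qh (- 2) - qh 2)) * Jfree (ltr (GF i)) (bas (Eword l))"
    unfolding rootF.simps using i x by (intro Jfree_scal_left) auto
  also have "emb ((- 1) ^ gpar p (GF i) * (qh (- 2) - qh 2)) = (- 1) ^ gpar p (GF i) * emb (qh (- 2) - qh 2)"
    by (simp del: emb_diff gpar.simps)
  finally show ?case using nz unfolding 1 Jfree_gens(5)[OF i i]
    by (simp del: emb_diff gpar.simps flip: power_add)
next
  case (Suc d)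
  define j where "j = i + d + 1"
  have j: "j \<in> {1..<N}" "i < j" using Suc.prems by (auto simp: j_def)
  let ?y = "rootF p i d" and ?g = "gpar p (GF j)" and ?w = "bas (Eword l)"
  let ?S = "wpar p (Eword [i..<j])" and ?c = "Jword [GF j] [GE j]" and ?\<delta> = "\<lambda>l. of_bool (l = [i..<j]) :: L"
  let ?Q = "emb (qh (2 * (- 1) ^ p j))"
  have y: "?y \<in> free_on (Fgens N)" using Suc.prems assms(1) by (intro rootF_free) auto
  have x: "?w \<in> free_on EK" using Eword_lists(2)[OF Suc.prems(2)] by simp
  have IH: "Jfree ?y (bas (Eword l')) = ?\<delta> l'" if "set l' \<subseteq> {1..<N}" for l'
    using Suc.IH[OF _ that] Suc.prems by (simp add: j_def)
  have left: "Jfree (ltr (GF j) * ?y) ?w = ?c * skewL N p j ?S ?\<delta> l"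
    using Jfree_F_left[OF y j(1) Suc.prems(2), of ?S] wpar_rootF[of _ p i d]
      skewL_cong[of "{1..<N}", OF IH Suc.prems(2), where k = j and s = ?S] by (simp add: j_def)
  have right: "Jfree (?y * ltr (GF j)) ?w = ?c * skewR N p j ?\<delta> l"
    using Jfree_F_right[OF y j(1) Suc.prems(2)] skewR_cong[of "{1..<N}", OF IH Suc.prems(2), where k = j] by simp
  have fr: "ltr (GF j) * ?y \<in> free_on FK" "?y * ltr (GF j) \<in> free_on FK" "- (t \<cdot> (?y * ltr (GF j))) \<in> free_on FK" for t
    using y j(1) by (auto intro!: free_on_FK)
  have "rootF p i (Suc d) = (- 1) ^ p (j + 1) \<cdot> (ltr (GF j) * ?y + (- ((- 1) ^ (?S * ?g) * qh (2 * (- 1) ^ p j)))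
       \<cdot> (?y * ltr (GF j)))"
  proof -
    have e: "i + d + 2 = j + 1" by (simp add: j_def)
    show ?thesis unfolding rootF.simps j_def[symmetric] e scal_minus add_uminus_conv_diff ..
  qed
  then have "Jfree (rootF p i (Suc d)) ?w = emb ((- 1) ^ p (j + 1)) * (Jfree (ltr (GF j) * ?y) ?w
      + emb (- ((- 1) ^ (?S * ?g) * qh (2 * (- 1) ^ p j))) * Jfree (?y * ltr (GF j)) ?w)"
    using fr x by (simp only: Jfree_scal_left Jfree_add_left free_on_closed_ops)
  also have "\<dots> = (- 1) ^ p (j + 1) * ?c * (skewL N p j ?S ?\<delta> l - (- 1) ^ (?S * ?g) * ?Q * skewR N p j ?\<delta> l)"
    unfolding left right by (simp add: algebra_simps del: gpar.simps emb_powi)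
  also have "skewL N p j ?S ?\<delta> l - (- 1) ^ (?S * ?g) * ?Q * skewR N p j ?\<delta> l
     = of_bool (l = [i..<j] @ [j]) * (- 1) ^ ((?S + ?S) * ?g) * emb (qh (- 2 * (- 1) ^ p j) - qh (2 * (- 1) ^ p j))"
    using assms(1) j by (intro skew_diff_delta) auto
  also have "(- 1 :: L) ^ ((?S + ?S) * ?g) = 1" by (simp flip: mult_2)
  also have "qh (- 2 * (- 1) ^ p j) - qh (2 * (- 1) ^ p j) = (- 1) ^ p j * (qh (- 2) - qh 2)"
    by (cases "even (p j)") auto
  also have "(- 1) ^ p (j + 1) * ?c * (of_bool (l = [i..<j] @ [j]) * 1 * emb ((- 1) ^ p j * (qh (- 2) - qh 2)))
      = of_bool (l = [i..<j] @ [j])"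
  proof -
    have nz: "emb (qh (- 2) - qh 2) \<noteq> 0" using q_minus_qinv_nz(2) by (simp del: emb_diff)
    have "(- 1 :: L) ^ p (j + 1) * (- 1) ^ ?g * (- 1) ^ p j = 1"
      by (cases "even (p j)"; cases "even (p (j + 1))") auto
    moreover have "s1 * (s2 / X) * (t * 1 * (s3 * X)) = t" if "X \<noteq> 0" "s1 * s2 * s3 = 1" for s1 s2 s3 t X :: L
    proof -
      have "s1 * (s2 / X) * (t * 1 * (s3 * X)) = (s1 * s2 * s3) * t" using that(1) by simp
      then show ?thesis using that(2) by simp
    qed
    ultimately show ?thesis using nz
      unfolding Jfree_gens(5)[OF j(1) j(1)] emb_ring_hom(4)[of "(- 1) ^ p j"] emb_power emb_ring_hom(2,5)
      by (simp only: refl if_True)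
  qed
  also have "[i..<j] @ [j] = [i..<i + Suc d + 1]" by (simp add: j_def)
  finally show ?case .
qed

text \<open>The pairing with the root vector is thus a matrix coefficient of $V$: on elements of weight
$\varepsilon_i - \varepsilon_j$ this coefficient is the entry at $(i, j)$ of the representing matrix.\<close>

lemma Jfree_rootF:
  assumes "1 \<le> i" "i + d < N" "x \<in> free_on (Egens N)"
  shows "Jfree (rootF p i d) x = emb (coef x (Eword [i..<i + d + 1]))"
proof -
  have y: "rootF p i d \<in> free_on FK" using rootF_free[OF assms(1,2)] by (rule free_on_FK)
  have "Jfree (rootF p i d) x = Lext (\<lambda>w. Jfree (rootF p i d) (bas w)) x"
    by (rule Jfree_Lext_right[OF y free_on_EK[OF assms(3)]])
  also have "\<dots> = Lext (\<lambda>w. of_bool (w = Eword [i..<i + d + 1])) x"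
  proof (rule Lext_cong)
    fix w assume "w \<in> Poly_Mapping.keys x"
    then have "w \<in> lists (Egens N)" using assms(3) by (auto simp: free_on_def)
    then obtain l where l: "w = map GE l" "set l \<subseteq> {1..<N}"
      unfolding Egens_def lists_image by (auto simp: subset_iff)
    moreover have "(map GE l = map GE l') = (l = l')" for l' by (rule inj_map_eq_map) (simp add: inj_def)
    ultimately show "Jfree (rootF p i d) (bas w) = of_bool (w = Eword [i..<i + d + 1])"
      using Jfree_rootF_Eword[OF assms(1,2) l(2)] unfolding Eword_def by (simp only:)
  qed
  also have "\<dots> = emb (coef x (Eword [i..<i + d + 1]))"
    by (cases "Eword [i..<i + d + 1] \<in> Poly_Mapping.keys x")
      (auto simp: Lext_def in_keys_iff intro!: sum.neutral)
  finally show ?thesis .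
qed

end

section \<open>Root vectors and homogeneous elements on V\<close>

text \<open>If the new letter $f_j$ of the commutator is applied first, it kills every basis vector but $v_j$,
and it sends that one to $v_{j+1}$, which the shorter root vector kills. So only the term that applies
$f_j$ last contributes.\<close>

lemma rho_rootF:
  assumes "1 \<le> i"
  shows "rho_free p (rootF p i d) (bas l) = (if l = i then Poly_Mapping.single (i + d + 1)
    ((qh (- 2) - qh 2) * (- 1) ^ p (i + d + 1)) else 0)"
proof (induction d arbitrary: l)
  case 0
  have "(- 1 :: K) ^ gpar p (GF i) * (- 1) ^ p i = (- 1) ^ p (i + 1)"
    by (cases "even (p i)"; cases "even (p (i + 1))") auto
  then have s: "((- 1) ^ gpar p (GF i) * D) * (- 1) ^ p i = D * (- 1 :: K) ^ p (i + 1)" for D :: K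
    by (metis mult.commute mult.left_commute)
  have "rho_free p (rootF p i 0) (bas l)
      = ((- 1) ^ gpar p (GF i) * (qh (- 2) - qh 2)) \<cdot> act p [GF i] (bas l)"
    unfolding rootF.simps lin_scal[OF lin_rho_free_alg] rho_free_bas ..
  also have "act p [GF i] (bas l) = (if l = i then Poly_Mapping.single (i + 1) ((- 1) ^ p i) else 0)"
    by simp
  finally have F: "rho_free p (rootF p i 0) (bas l) = ((- 1) ^ gpar p (GF i) * (qh (- 2) - qh 2)) \<cdot>
      (if l = i then Poly_Mapping.single (i + 1) ((- 1) ^ p i) else 0)" .
  show ?case unfolding F
    by (cases "l = i") (simp_all only: simp_thms if_True if_False map_single mult_zero_right s scal_simps add_0_right)
next
  case (Suc d)
  define j where "j = i + d + 1"
  let ?D = "qh (- 2) - qh 2"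
  have IH: "rho_free p (rootF p i d) (bas l) = (if l = i then Poly_Mapping.single j (?D * (- 1) ^ p j) else 0)" for l
    unfolding j_def by (rule Suc.IH)
  have A: "rho_free p (ltr (GF j) * rootF p i d) (bas l)
      = (if l = i then Poly_Mapping.single (j + 1) ((- 1) ^ p j * (?D * (- 1) ^ p j)) else 0)"
    unfolding rho_free_mult IH by simp
  have Z: "rho_free p (rootF p i d * ltr (GF j)) (bas l) = 0"
  proof (cases "l = j")
    case True
    have "rho_free p (rootF p i d) (Poly_Mapping.single (j + 1) c) = 0" for c
      using IH[of "j + 1"] by (subst lin_single[OF lin_rho_free]) (simp add: j_def)
    with True show ?thesis by simp
  next
    case False
    then show ?thesis by simp
  qed
  have e: "i + d + 2 = j + 1" "i + Suc d + 1 = j + 1" by (simp_all add: j_def)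
  have sgn: "(- 1) ^ p (j + 1) * ((- 1) ^ p j * (D * (- 1) ^ p j)) = D * (- 1) ^ p (j + 1)" for D :: K
    by (cases "even (p j)") auto
  have step: "rho_free p (rootF p i (Suc d)) (bas l) = (- 1) ^ p (j + 1) \<cdot>
      (if l = i then Poly_Mapping.single (j + 1) ((- 1) ^ p j * (?D * (- 1) ^ p j)) else 0)"
    unfolding rootF.simps j_def[symmetric] e lin_scal[OF lin_rho_free_alg] lin_diff[OF lin_rho_free_alg]
      A Z scal_simps diff_0_right ..
  show ?case unfolding e step
    by (cases "l = i") (simp_all only: simp_thms if_True if_False map_single mult_zero_right sgn scal_simps)
qed

definition epsdiff :: "nat \<Rightarrow> nat \<Rightarrow> weight" where "epsdiff i j = (\<lambda>k. eps i k - eps j k)"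

lemma epsdiff_eq_iff:
  assumes "i < j" shows "epsdiff i j = epsdiff k l \<longleftrightarrow> k = i \<and> l = j"
proof
  assume eq: "epsdiff i j = epsdiff k l"
  have "epsdiff i j i = 1" "epsdiff i j j = - 1" using assms by (simp_all add: epsdiff_def eps_def)
  then have "epsdiff k l i = 1" "epsdiff k l j = - 1" unfolding eq .
  then show "k = i \<and> l = j"
    unfolding epsdiff_def eps_def by (cases "i = k"; cases "i = l"; cases "j = k"; cases "j = l"; simp)
qed auto

lemma epsdiff_nonzero: "i < j \<Longrightarrow> epsdiff i j \<noteq> (\<lambda>_. 0)"
proof
  assume "i < j" "epsdiff i j = (\<lambda>_. 0)"
  then have "epsdiff i j i = 0" by simp
  with \<open>i < j\<close> show False by (simp add: epsdiff_def eps_def)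
qed

lemma wdeg_Nil: "wdeg [] = (\<lambda>_. 0)"
  by (simp add: wdeg_def)

lemma wdeg_Cons: "wdeg (a # w) = (\<lambda>k. gdeg a k + wdeg w k)"
  by (simp add: wdeg_def)

lemma wdeg_Eword_upt: "k \<le> l \<Longrightarrow> wdeg (Eword [k..<l]) = epsdiff k l"
proof (induction "l - k" arbitrary: k)
  case 0
  then show ?case by (simp add: Eword_def epsdiff_def wdeg_def)
next
  case (Suc d)
  then have "k < l" "wdeg (Eword [Suc k..<l]) = epsdiff (Suc k) l" by auto
  then show ?case by (auto simp: upt_conv_Cons Eword_def wdeg_Cons epsdiff_def alpha_def)
qed

lemma wdeg_Fword: "wdeg (Fword l) = (\<lambda>k. - wdeg (Eword l) k)"
proof (induction l)
  case Nil
  show ?case by (simp add: Fword_def Eword_def wdeg_def)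
next
  case (Cons a l)
  have "wdeg (Fword (a # l)) = (\<lambda>k. - alpha a k + wdeg (Fword l) k)"
    "wdeg (Eword (a # l)) = (\<lambda>k. alpha a k + wdeg (Eword l) k)"
    by (simp_all add: Fword_def Eword_def wdeg_Cons)
  then show ?case using Cons.IH by simp
qed

lemma wdeg_mset_cong: "mset u = mset v \<Longrightarrow> wdeg u = wdeg v"
  unfolding wdeg_def by (metis sum_mset_sum_list mset_map)

lemma epsdiff_Qpos:
  assumes "1 \<le> i" "i < j" "j \<le> N" shows "epsdiff i j \<in> Qpos N"
proof -
  have "(\<Sum>t = 1..<N. int (of_bool (i \<le> t \<and> t < j)) * alpha t k) = (\<Sum>t = i..<j. alpha t k)" for k
    using assms by (intro sum.mono_neutral_cong_right) auto
  also have "(\<Sum>t = i..<j. alpha t k) = epsdiff i j k" for k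
    unfolding alpha_def epsdiff_def using sum_Suc_diff'[of i j "\<lambda>t. - eps t k"] assms by simp
  finally have "epsdiff i j = (\<lambda>k. \<Sum>t = 1..<N. int (of_bool (i \<le> t \<and> t < j)) * alpha t k)" by auto
  moreover have "epsdiff i j \<noteq> (\<lambda>_. 0)" by (rule epsdiff_nonzero[OF assms(2)])
  ultimately show ?thesis unfolding Qpos_def by (auto intro!: exI[of _ "\<lambda>t. of_bool (i \<le> t \<and> t < j)"])
qed

lemma act_E_lists:
  assumes "w \<in> lists (Egens N)" "w \<noteq> []" "act p w (bas l) \<noteq> 0"
  obtains k where "1 \<le> k" "k < l" "l \<le> N" "w = Eword [k..<l]" "act p w (bas l) = bas k"
proof -
  from assms(1) obtain r where r: "w = Eword r" "set r \<subseteq> {1..<N}"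
    unfolding Egens_def lists_image Eword_def by (auto simp: subset_iff)
  with assms(3) obtain k where k: "k \<le> l" "r = [k..<l]" unfolding r(1) act_Eword by (auto split: if_splits)
  with assms(2) r(1) have "k < l" by (cases "k = l") (auto simp: Eword_def)
  moreover have "k \<in> set r" "l - 1 \<in> set r" using k \<open>k < l\<close> by auto
  ultimately have "1 \<le> k" "l \<le> N" using r(2) by fastforce+
  moreover have "act p w (bas l) = bas k" unfolding r(1) act_Eword using k by auto
  ultimately show ?thesis using that \<open>k < l\<close> r k by blast
qed

definition Ehom :: "nat \<Rightarrow> weight \<Rightarrow> falg set" where
  "Ehom N \<mu> = {x \<in> free_on (Egens N). \<forall>w \<in> Poly_Mapping.keys x. wdeg w = \<mu>}"

text \<open>Among the words of weight $\varepsilon_i - \varepsilon_j$ only $e_i \cdots e_{j-1}$ acts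
nontrivially, by the description of the action of words as walks.\<close>

lemma rho_Ehom_root:
  assumes "x \<in> Ehom N (epsdiff i j)" "i < j"
  shows "rho_free p x (bas l) = (if l = j then Poly_Mapping.single i (coef x (Eword [i..<j])) else 0)"
proof -
  have *: "act p w (bas l) = (if l = j \<and> w = Eword [i..<j] then bas i else 0)"
    if "w \<in> Poly_Mapping.keys x" for w
  proof (cases "act p w (bas l) = 0")
    case True
    have "act p (Eword [i..<j]) (bas j) \<noteq> 0"
    proof -
      have "\<exists>i'\<le>j. [i..<j] = [i'..<j]" using less_imp_le[OF assms(2)] by blast
      moreover have "j - length [i..<j] = i" using assms(2) by simp
      moreover have "bas i \<noteq> (0 :: vec)" by (metis lookup_single_eq lookup_zero one_neq_zero)
      ultimately show ?thesis unfolding act_Eword by (simp only: if_True not_False_eq_True)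
    qed
    with True show ?thesis by auto
  next
    case False
    have w: "w \<in> lists (Egens N)" "wdeg w = epsdiff i j" using assms(1) that by (auto simp: Ehom_def free_on_def)
    then have "w \<noteq> []" using epsdiff_nonzero[OF assms(2)] by (metis wdeg_Nil)
    from act_E_lists[OF w(1) this False] obtain k where
      k: "1 \<le> k" "k < l" "l \<le> N" "w = Eword [k..<l]" "act p w (bas l) = bas k" by blast
    have "epsdiff i j = epsdiff k l" using w(2) k(2,4) wdeg_Eword_upt[of k l] by simp
    with epsdiff_eq_iff[OF assms(2)] have "k = i" "l = j" by auto
    with k show ?thesis by simp
  qed
  show ?thesis
  proof (cases "l = j")
    case True
    have **: "act p w (bas l) = (if w = Eword [i..<j] then bas i else 0)"
      if "w \<in> Poly_Mapping.keys x" for w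
      using *[OF that] True by (simp only: simp_thms)
    have "rho_free p x (bas l) = (\<Sum>w\<in>Poly_Mapping.keys x.
        if w = Eword [i..<j] then Poly_Mapping.single i (coef x (Eword [i..<j])) else 0)"
      unfolding rho_free_act linext_def by (rule sum.cong) (auto simp: **)
    also have "\<dots> = Poly_Mapping.single i (coef x (Eword [i..<j]))"
      by (cases "Eword [i..<j] \<in> Poly_Mapping.keys x") (auto simp: in_keys_iff intro!: sum.neutral)
    finally show ?thesis using True by simp
  next
    case False
    then show ?thesis unfolding rho_free_act linext_def by (auto simp: * intro!: sum.neutral)
  qed
qed

lemma rho_Ehom_nonroot:
  assumes "x \<in> Ehom N \<mu>" "\<mu> \<noteq> (\<lambda>_. 0)" "\<And>i j. 1 \<le> i \<Longrightarrow> i < j \<Longrightarrow> j \<le> N \<Longrightarrow> \<mu> \<noteq> epsdiff i j"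
  shows "rho_free p x (bas l) = 0"
proof -
  have "act p w (bas l) = 0" if "w \<in> Poly_Mapping.keys x" for w
  proof (rule ccontr)
    assume nz: "act p w (bas l) \<noteq> 0"
    have w: "w \<in> lists (Egens N)" "wdeg w = \<mu>" using assms(1) that by (auto simp: Ehom_def free_on_def)
    then have "w \<noteq> []" using assms(2) by (metis wdeg_Nil)
    from act_E_lists[OF w(1) this nz] obtain k where
      k: "1 \<le> k" "k < l" "l \<le> N" "w = Eword [k..<l]" by blast
    then have "\<mu> = epsdiff k l" using w(2) wdeg_Eword_upt[of k l] by simp
    with assms(3) k show False by blast
  qed
  then show ?thesis unfolding rho_free_act linext_def by (auto intro!: sum.neutral)
qed

section \<open>Spans and bases in the quotient algebra\<close>

lemma carrier_Uq: "carrier (Uq N p) = quo N p ` carrier (free_alg N)"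
  unfolding Uq_def quo_def FactRing_def A_RCOSETS_defs a_r_coset_def r_coset_def
  by auto

lemma ring_Uq: "ring (Uq N p)"
  unfolding Uq_def by (rule ideal.quotient_is_ring[OF ideal_rel_ideal])

lemma quo_simps:
  assumes "x \<in> carrier (free_alg N)" "y \<in> carrier (free_alg N)"
  shows "quo N p x \<otimes>\<^bsub>Uq N p\<^esub> quo N p y = quo N p (x * y)"
    "quo N p x \<oplus>\<^bsub>Uq N p\<^esub> quo N p y = quo N p (x + y)"
  using ring_hom_mult[OF quo_hom assms] ring_hom_add[OF quo_hom assms] by simp_all

lemma quo_zero: "\<zero>\<^bsub>Uq N p\<^esub> = quo N p 0"
  using ring_hom_zero[OF quo_hom ring_free_alg ring_Uq] by simp

definition lincomb :: "(nat \<Rightarrow> K) \<Rightarrow> falg list \<Rightarrow> falg" where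
  "lincomb c Ys = (\<Sum>r<length Ys. c r \<cdot> Ys ! r)"

lemma lincomb_Cons: "lincomb c (Y # Ys) = c 0 \<cdot> Y + lincomb (\<lambda>r. c (Suc r)) Ys"
  unfolding lincomb_def length_Cons sum.lessThan_Suc_shift by simp

lemma lincomb_free_on: "set Ys \<subseteq> free_on S \<Longrightarrow> lincomb c Ys \<in> free_on S"
  unfolding lincomb_def by (intro free_on_sum free_on_closed_ops(2)) (metis nth_mem lessThan_iff subsetD)

lemma Span_eq_lincomb:
  assumes "set Ys \<subseteq> carrier (free_alg N)"
  shows "ring.Span (Uq N p) (Kscalars N p) (map (quo N p) Ys) = range (\<lambda>c. quo N p (lincomb c Ys))"
  using assms
proof (induction Ys)
  case Nil
  then show ?case by (simp add: ring.Span.simps[OF ring_Uq] lincomb_def quo_zero)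
next
  case (Cons Y Ys)
  interpret U: ring "Uq N p" by (rule ring_Uq)
  have Y: "Y \<in> carrier (free_alg N)" and Ys: "set Ys \<subseteq> carrier (free_alg N)" using Cons.prems by auto
  have C: "lincomb c Ys \<in> carrier (free_alg N)" for c using lincomb_free_on Ys by simp
  have one: "b \<cdot> 1 \<in> carrier (free_alg N)" "b \<cdot> Y \<in> carrier (free_alg N)" for b using Y by simp_all
  have eq: "quo N p (b \<cdot> 1) \<otimes>\<^bsub>Uq N p\<^esub> quo N p Y \<oplus>\<^bsub>Uq N p\<^esub> quo N p (lincomb c Ys)
      = quo N p (b \<cdot> Y + lincomb c Ys)" for b c
    using one C Y by (simp only: quo_simps scal_mult_left mult_1)
  have IH: "U.Span (Kscalars N p) (map (quo N p) Ys) = range (\<lambda>c. quo N p (lincomb c Ys))"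
    by (rule Cons.IH[OF Ys])
  have "U.Span (Kscalars N p) (map (quo N p) (Y # Ys))
      = (\<Union>b. \<Union>c. {quo N p (b \<cdot> 1) \<otimes>\<^bsub>Uq N p\<^esub> quo N p Y \<oplus>\<^bsub>Uq N p\<^esub> quo N p (lincomb c Ys)})"
    using IH unfolding U.Span.simps list.map foldr.simps comp_def U.line_extension_def Kscalars_def
    by (auto simp: set_add_def set_mult_def r_coset_def)
  also have "\<dots> = (\<Union>b. \<Union>c. {quo N p (b \<cdot> Y + lincomb c Ys)})" unfolding eq ..
  also have "\<dots> = range (\<lambda>c. quo N p (lincomb c (Y # Ys)))"
  proof -
    have 1: "quo N p (b \<cdot> Y + lincomb c Ys) \<in> range (\<lambda>c. quo N p (lincomb c (Y # Ys)))" for b c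
      by (rule range_eqI[of _ _ "case_nat b c"]) (simp add: lincomb_Cons)
    have 2: "quo N p (lincomb c (Y # Ys)) \<in> (\<Union>b. \<Union>c. {quo N p (b \<cdot> Y + lincomb c Ys)})" for c
      unfolding lincomb_Cons by blast
    show ?thesis
    proof (intro subset_antisym subsetI)
      fix z assume "z \<in> (\<Union>b. \<Union>c. {quo N p (b \<cdot> Y + lincomb c Ys)})"
      then obtain b c where "z = quo N p (b \<cdot> Y + lincomb c Ys)" by blast
      then show "z \<in> range (\<lambda>c. quo N p (lincomb c (Y # Ys)))" using 1 by (simp only:)
    next
      fix z assume "z \<in> range (\<lambda>c. quo N p (lincomb c (Y # Ys)))"
      then obtain c where "z = quo N p (lincomb c (Y # Ys))" by blast
      then show "z \<in> (\<Union>b. \<Union>c. {quo N p (b \<cdot> Y + lincomb c Ys)})" using 2 by (simp only:)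
    qed
  qed
  finally show ?case .
qed

lemma independent_in_carrier:
  assumes "ring R" "ring.independent R K us" shows "set us \<subseteq> carrier R"
  using assms(2) by (induction rule: ring.independent.induct[OF assms(1), consumes 1]) auto

text \<open>A spanning list lies in its own span, so the basis vectors have representatives in the free
algebra with the same homogeneity as the span.\<close>

lemma basis_lift:
  assumes "ring.independent (Uq N p) (Kscalars N p) us"
    and "ring.Span (Uq N p) (Kscalars N p) us = quo N p ` S" "S \<subseteq> carrier (free_alg N)"
  obtains Us where "us = map (quo N p) Us" "set Us \<subseteq> S"
proof -
  have "set us \<subseteq> quo N p ` carrier (free_alg N)"
    using independent_in_carrier[OF ring_Uq assms(1)] unfolding carrier_Uq .
  then have "us \<in> lists (quo N p ` carrier (free_alg N))" by auto
  then obtain Vs where Vs: "us = map (quo N p) Vs" "set Vs \<subseteq> carrier (free_alg N)"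
    unfolding lists_image by (auto simp: subset_iff simp del: free_alg_sel)
  have "quo N p V \<in> quo N p ` S" if "V \<in> set Vs" for V
  proof -
    from that obtain r where r: "r < length Vs" "Vs ! r = V" by (auto simp: in_set_conv_nth)
    have "lincomb (\<lambda>s. of_bool (s = r)) Vs = (\<Sum>s<length Vs. if s = r then V else 0)"
      unfolding lincomb_def by (rule sum.cong) (auto simp: r)
    also have "\<dots> = V" using r(1) by simp
    finally have "quo N p V \<in> range (\<lambda>c. quo N p (lincomb c Vs))" by (metis rangeI)
    then show ?thesis using Span_eq_lincomb[OF Vs(2), of p] Vs(1) assms(2) by simp
  qed
  then have "us \<in> lists (quo N p ` S)" unfolding Vs(1) by auto
  then show ?thesis unfolding lists_image using that by (auto simp: subset_iff)
qed

section \<open>The action of Theta on the tensor square of V\<close>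

definition Fhom :: "nat \<Rightarrow> weight \<Rightarrow> falg set" where
  "Fhom N \<mu> = {x \<in> free_on (Fgens N). \<forall>w \<in> Poly_Mapping.keys x. wdeg w = \<mu>}"

lemma Uplus_eq: "Uplus N p \<mu> = quo N p ` Ehom N \<mu>"
  and Uminus_eq: "Uminus N p \<mu> = quo N p ` Fhom N \<mu>"
  by (simp_all add: Uplus_def Uminus_def Ehom_def Fhom_def)

lemma hom_in_carrier: "Ehom N \<mu> \<subseteq> carrier (free_alg N)" "Fhom N \<mu> \<subseteq> carrier (free_alg N)"
  "Ehom N \<mu> \<subseteq> free_on (Egens N)" "Fhom N \<mu> \<subseteq> free_on (Fgens N)"
  using free_on_mono[of "Egens N" "Egens N \<union> Fgens N \<union> Kgens N"]
    free_on_mono[of "Fgens N" "Egens N \<union> Fgens N \<union> Kgens N"]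
  unfolding Ehom_def Fhom_def free_alg_sel by blast+

lemma rootF_Fhom:
  assumes "1 \<le> i" "i + d < N"
  shows "rootF p i d \<in> Fhom N (\<lambda>k. - epsdiff i (i + d + 1) k)"
proof -
  have "wdeg w = (\<lambda>k. - epsdiff i (i + d + 1) k)" if "w \<in> Poly_Mapping.keys (rootF p i d)" for w
  proof -
    have "mset w = mset (Fword [i..<i + d + 1])" using rootF_homog[of p i d] that by (auto simp: homog_def)
    then have "wdeg w = wdeg (Fword [i..<i + d + 1])" by (rule wdeg_mset_cong)
    then show ?thesis unfolding wdeg_Fword using wdeg_Eword_upt[of i "i + d + 1"] by simp
  qed
  with rootF_free[OF assms] show ?thesis by (simp add: Fhom_def)
qed

lemma ptens_single: "ptens (Poly_Mapping.single i c) z = c \<cdot> linext (\<lambda>b. bas (i, b)) z"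
  by (simp add: ptens_def)

lemma ptens_zero: "ptens 0 z = 0" "ptens x 0 = 0"
  unfolding ptens_def linext_simps by (auto simp: linext_def)

text \<open>The second tensor factor with the sign that arises from moving an operator past $v_k$.\<close>

definition koszul :: "(nat \<Rightarrow> nat) \<Rightarrow> nat \<Rightarrow> nat \<Rightarrow> vec \<Rightarrow> vec" where
  "koszul p k l = linext (\<lambda>j. (- 1) ^ ((p j + p l) * p k) \<cdot> bas j)"

lemma otens_bas: "otens p X Y (bas (k, l)) = ptens (X (bas k)) (koszul p k l (Y (bas l)))"
  by (simp add: otens_def koszul_def)

lemma lin_otens: "lin (otens p X Y)"
  unfolding otens_def by (rule lin_linext)

lemma otens_zero:
  assumes "\<And>k. X (bas k) = 0" shows "otens p X Y w = 0"
  by (rule lin_eqI[of "otens p X Y" "\<lambda>_. 0" w, OF lin_otens lin_0])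
    (auto simp: otens_bas assms ptens_zero)

context pairing begin

lemma Jfree_lincomb:
  assumes "set Ys \<subseteq> free_on (Fgens N)" "x \<in> free_on EK"
  shows "Jfree (lincomb c Ys) x = (\<Sum>r<length Ys. emb (c r) * Jfree (Ys ! r) x)"
proof -
  have Y: "Ys ! r \<in> free_on FK" if "r < length Ys" for r
    using that assms(1) nth_mem free_on_FK by blast
  have "Jfree (lincomb c Ys) x = (\<Sum>r<length Ys. Jfree (c r \<cdot> Ys ! r) x)"
    unfolding lincomb_def using Y assms(2) by (intro Jfree_sum_left) auto
  also have "\<dots> = (\<Sum>r<length Ys. emb (c r) * Jfree (Ys ! r) x)"
    using Y assms(2) by (intro sum.cong) (auto simp: Jfree_scal_left)
  finally show ?thesis .
qed

text \<open>Let \<open>c r\<close> be the coordinates of the root vector in the basis of the \<open>y \<mu> ! r\<close>. Pairing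
with \<open>x \<mu> ! r\<close> identifies \<open>c r\<close> with the matrix entry of that element at $(i, j)$. Hence the sum
collapses to $E_{ij} \otimes \varrho(y)$ for the root vector $y$.\<close>

lemma Theta_root_term:
  assumes "dual_bases N p J x y" "1 \<le> i" "i < j" "j \<le> N"
  shows "(\<Sum>r<length (x (epsdiff i j)). otens p (rho p (x (epsdiff i j) ! r)) (rho p (y (epsdiff i j) ! r)) (bas (k, l)))
    = (if k = j \<and> l = i then Poly_Mapping.single (i, j) ((- 1) ^ (p i * p j) * (qh (- 2) - qh 2)) else 0)"
proof -
  let ?\<mu> = "epsdiff i j" and ?D = "qh (- 2) - qh 2"
  \<comment> \<open>the root vectors are indexed by the number of commutators\<close>
  define d where "d = j - i - 1"
  have j: "j = i + d + 1" and d: "i + d < N" using assms(3,4) by (simp_all add: d_def)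
  have Q: "?\<mu> \<in> Qpos N" using assms by (intro epsdiff_Qpos) auto
  note db = assms(1)[unfolded dual_bases_def, rule_format, OF Q]
  obtain Xs where Xs: "x ?\<mu> = map (quo N p) Xs" "set Xs \<subseteq> Ehom N ?\<mu>"
    using basis_lift[OF db[THEN conjunct1] db[THEN conjunct2, THEN conjunct1, unfolded Uplus_eq]
        hom_in_carrier(1)] by blast
  obtain Ys where Ys: "y ?\<mu> = map (quo N p) Ys" "set Ys \<subseteq> Fhom N (\<lambda>k. - ?\<mu> k)"
    using basis_lift[OF db[THEN conjunct2, THEN conjunct2, THEN conjunct1]
        db[THEN conjunct2, THEN conjunct2, THEN conjunct2, THEN conjunct1, unfolded Uminus_eq]
        hom_in_carrier(2)] by blast
  have len: "length Ys = length Xs" using db Xs(1) Ys(1) by simp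
  have dual: "Jfree (Ys ! r) (Xs ! s) = (if r = s then 1 else 0)" if "r < length Xs" "s < length Xs" for r s
    using db that len unfolding Jfree_def Xs(1) Ys(1) by simp
  have X: "Xs ! r \<in> Ehom N ?\<mu>" if "r < length Xs" for r using nth_mem[of r Xs] that Xs(2) by auto
  have Y: "Ys ! r \<in> Fhom N (\<lambda>k. - ?\<mu> k)" if "r < length Xs" for r using nth_mem[of r Ys] that Ys(2) len by auto
  have YF: "set Ys \<subseteq> free_on (Fgens N)" "set Ys \<subseteq> carrier (free_alg N)"
    using order.trans[OF Ys(2) hom_in_carrier(4)] order.trans[OF Ys(2) hom_in_carrier(2)] by auto
  let ?F = "rootF p i d"
  have F: "?F \<in> Fhom N (\<lambda>k. - ?\<mu> k)" using rootF_Fhom[OF assms(2) d] by (simp only: j)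
  then have "quo N p ?F \<in> ring.Span (Uq N p) (Kscalars N p) (y ?\<mu>)"
    using db unfolding Uminus_eq by blast
  then obtain c where c: "quo N p ?F = quo N p (lincomb c Ys)"
    unfolding Ys(1) Span_eq_lincomb[OF YF(2)] by blast
  have coef: "c s = coef (Xs ! s) (Eword [i..<j])" if s: "s < length Xs" for s
  proof -
    have XE: "Xs ! s \<in> free_on (Egens N)" using X[OF s] hom_in_carrier(3)[of N ?\<mu>] by blast
    have "Jfree ?F (Xs ! s) = Jfree (lincomb c Ys) (Xs ! s)" unfolding Jfree_def c ..
    also have "\<dots> = (\<Sum>r<length Ys. emb (c r) * Jfree (Ys ! r) (Xs ! s))"
      by (rule Jfree_lincomb[OF YF(1) free_on_EK[OF XE]])
    also have "\<dots> = (\<Sum>r<length Xs. if r = s then emb (c s) else 0)"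
      unfolding len using s by (intro sum.cong) (auto simp: dual)
    also have "\<dots> = emb (c s)" using s by simp
    finally have "emb (c s) = emb (coef (Xs ! s) (Eword [i..<j]))"
      using Jfree_rootF[OF assms(2) d XE] by (simp only: j)
    then show ?thesis by simp
  qed
  have rx: "rho p (x ?\<mu> ! r) (bas k) = (if k = j then Poly_Mapping.single i (c r) else 0)"
    if r: "r < length Xs" for r k
  proof -
    have "rho p (x ?\<mu> ! r) (bas k) = rho_free p (Xs ! r) (bas k)"
      unfolding Xs(1) nth_map[OF r] by (rule rho_quo) (rule subsetD[OF hom_in_carrier(1) X[OF r]])
    then show ?thesis using rho_Ehom_root[OF X[OF r] assms(3)] coef[OF r] by simp
  qed
  have ry: "rho p (y ?\<mu> ! r) v = rho_free p (Ys ! r) v" if r: "r < length Xs" for r v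
    unfolding Ys(1) nth_map[OF r[folded len]]
    by (rule rho_quo) (rule subsetD[OF hom_in_carrier(2) Y[OF r]])
  have FC: "?F \<in> carrier (free_alg N)" "lincomb c Ys \<in> carrier (free_alg N)"
    using subsetD[OF hom_in_carrier(2) F] lincomb_free_on YF(2) by auto
  have rF: "(\<Sum>r<length Xs. c r \<cdot> rho_free p (Ys ! r) v) = rho_free p ?F v" for v
  proof -
    have "rho_free p ?F v = rho p (quo N p ?F) v" by (rule rho_quo[symmetric, OF FC(1)])
    also have "\<dots> = rho_free p (lincomb c Ys) v" unfolding c by (rule rho_quo[OF FC(2)])
    also have "\<dots> = (\<Sum>r<length Xs. c r \<cdot> rho_free p (Ys ! r) v)"
      unfolding lincomb_def len lin_sum[OF lin_rho_free_alg] lin_scal[OF lin_rho_free_alg] ..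
    finally show ?thesis by simp
  qed
  have L: "length (x ?\<mu>) = length Xs" using Xs(1) by simp
  show ?thesis
  proof (cases "k = j")
    case False
    then show ?thesis unfolding L by (simp add: otens_bas rx ptens_zero)
  next
    case True
    let ?H = "\<lambda>z. linext (\<lambda>b. bas (i, b)) (koszul p j l z) :: vec2"
    have lin: "lin ?H" unfolding koszul_def by (rule lin_comp[OF lin_linext lin_linext])
    have "(\<Sum>r<length (x ?\<mu>). otens p (rho p (x ?\<mu> ! r)) (rho p (y ?\<mu> ! r)) (bas (k, l)))
       = (\<Sum>r<length Xs. ?H (c r \<cdot> rho_free p (Ys ! r) (bas l)))"
      unfolding L by (rule sum.cong) (simp_all add: otens_bas rx ry True ptens_single lin_scal[OF lin])
    also have "\<dots> = ?H (rho_free p ?F (bas l))"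
      unfolding rF[symmetric] lin_sum[OF lin] ..
    also have "\<dots> = (if l = i then Poly_Mapping.single (i, j) ((- 1) ^ (p i * p j) * ?D) else 0)"
    proof (cases "l = i")
      case True
      have sgn: "?D * (- 1) ^ p j * (- 1) ^ ((p j + p i) * p j) = (- 1) ^ (p i * p j) * ?D"
        by (cases "even (p i)"; cases "even (p j)") auto
      have "?H (Poly_Mapping.single j (?D * (- 1) ^ p j)) =
          Poly_Mapping.single (i, j) (?D * (- 1) ^ p j * (- 1) ^ ((p j + p i) * p j))"
        unfolding koszul_def linext_single map_single mult_zero_right True mult_1_right by simp
      then show ?thesis unfolding rho_rootF[OF assms(2)] j[symmetric] sgn using True by simp
    next
      case False
      then show ?thesis unfolding rho_rootF[OF assms(2)] by (simp add: lin_zero[OF lin])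
    qed
    finally show ?thesis using True by simp
  qed
qed

lemma Theta_nonroot_term:
  assumes "dual_bases N p J x y" "\<mu> \<in> Qpos N" "\<And>i j. 1 \<le> i \<Longrightarrow> i < j \<Longrightarrow> j \<le> N \<Longrightarrow> \<mu> \<noteq> epsdiff i j"
    "r < length (x \<mu>)"
  shows "otens p (rho p (x \<mu> ! r)) Y w = 0"
proof (rule otens_zero)
  fix k
  note db = assms(1)[unfolded dual_bases_def, rule_format, OF assms(2)]
  obtain Xs where Xs: "x \<mu> = map (quo N p) Xs" "set Xs \<subseteq> Ehom N \<mu>"
    using basis_lift[OF db[THEN conjunct1] db[THEN conjunct2, THEN conjunct1, unfolded Uplus_eq]
        hom_in_carrier(1)] by blast
  have r: "r < length Xs" using assms(4) Xs(1) by simp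
  then have X: "Xs ! r \<in> Ehom N \<mu>" using Xs(2) nth_mem by blast
  have "\<mu> \<noteq> (\<lambda>_. 0)" using assms(2) by (simp add: Qpos_def)
  then have "rho_free p (Xs ! r) (bas k) = 0" using rho_Ehom_nonroot[OF X] assms(3) by blast
  then show "rho p (x \<mu> ! r) (bas k) = 0"
    unfolding Xs(1) nth_map[OF r] using rho_quo[OF subsetD[OF hom_in_carrier(1) X], of p] by simp
qed

definition posroots :: "(nat \<times> nat) set" where
  "posroots = {(i, j). 1 \<le> i \<and> i < j \<and> j \<le> N}"

lemma finite_posroots: "finite posroots"
  by (rule finite_subset[of _ "{..N} \<times> {..N}"]) (auto simp: posroots_def)

text \<open>All weights other than $\varepsilon_i - \varepsilon_j$ with $i < j$ contribute zero, so the sum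
over $\mu > 0$ ranges over the positive roots.\<close>

lemma Theta_eq:
  assumes "dual_bases N p J x y"
  shows "Theta N p x y w = w + (\<Sum>(i, j)\<in>posroots. \<Sum>r<length (x (epsdiff i j)).
    otens p (rho p (x (epsdiff i j) ! r)) (rho p (y (epsdiff i j) ! r)) w)"
proof -
  let ?T = "\<lambda>\<mu>. \<Sum>r<length (x \<mu>). otens p (rho p (x \<mu> ! r)) (rho p (y \<mu> ! r)) w"
  let ?f = "\<lambda>\<mu>. if \<mu> \<in> Qpos N then ?T \<mu> else 0" and ?epsdiff = "\<lambda>(i, j). epsdiff i j"
  have "{\<mu>. ?f \<mu> \<noteq> 0} \<subseteq> ?epsdiff ` posroots"
  proof clarify
    fix \<mu> assume nz: "?f \<mu> \<noteq> 0"
    then have "\<mu> \<in> Qpos N" by (auto split: if_splits)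
    show "\<mu> \<in> ?epsdiff ` posroots"
    proof (rule ccontr)
      assume n: "\<mu> \<notin> ?epsdiff ` posroots"
      have "\<mu> \<noteq> epsdiff i j" if "1 \<le> i" "i < j" "j \<le> N" for i j
        using n that unfolding posroots_def by force
      then have "?T \<mu> = 0"
        using Theta_nonroot_term[OF assms \<open>\<mu> \<in> Qpos N\<close>] by (intro sum.neutral ballI) simp
      moreover have "?f \<mu> = ?T \<mu>" using \<open>\<mu> \<in> Qpos N\<close> by (rule if_P)
      ultimately have "?f \<mu> = 0" by (rule trans[rotated])
      with nz show False by (rule notE)
    qed
  qed
  then have "Sum_any ?f = sum ?f (?epsdiff ` posroots)"
    by (intro Sum_any.expand_superset finite_imageI finite_posroots)
  also have "inj_on ?epsdiff posroots"
    by (rule inj_onI) (auto simp: posroots_def epsdiff_eq_iff)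
  then have "sum ?f (?epsdiff ` posroots) = (\<Sum>ij\<in>posroots. ?f (?epsdiff ij))"
    by (simp add: sum.reindex comp_def)
  also have "\<dots> = (\<Sum>(i, j)\<in>posroots. ?T (epsdiff i j))"
    by (rule sum.cong) (auto simp: posroots_def epsdiff_Qpos)
  finally show ?thesis unfolding Theta_def by simp
qed

lemma lin_Theta:
  assumes "dual_bases N p J x y" shows "lin (Theta N p x y)"
proof -
  have "lin (\<lambda>w. w + (\<Sum>ij\<in>posroots. (\<Sum>r<length (x (epsdiff (fst ij) (snd ij))).
    otens p (rho p (x (epsdiff (fst ij) (snd ij)) ! r)) (rho p (y (epsdiff (fst ij) (snd ij)) ! r)) w)))"
    by (intro lin_plus lin_id lin_Sum lin_otens)
  then show ?thesis unfolding Theta_eq[OF assms, abs_def] split_def .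
qed

lemma Theta_bas:
  assumes "dual_bases N p J x y" "k \<in> {1..N}" "l \<in> {1..N}"
  shows "Theta N p x y (bas (k, l)) = bas (k, l) +
    (if l < k then Poly_Mapping.single (l, k) ((- 1) ^ (p l * p k) * (qh (- 2) - qh 2)) else 0)"
proof -
  let ?G = "Poly_Mapping.single (l, k) ((- 1) ^ (p l * p k) * (qh (- 2) - qh 2)) :: vec2"
  have "Theta N p x y (bas (k, l)) = bas (k, l) + (\<Sum>ij\<in>posroots. if ij = (l, k) then ?G else 0)"
    unfolding Theta_eq[OF assms(1)]
  proof (intro arg_cong[of _ _ "\<lambda>z. bas (k, l) + z"] sum.cong refl, clarify)
    fix i j assume "(i, j) \<in> posroots"
    then have ij: "1 \<le> i" "i < j" "j \<le> N" by (auto simp: posroots_def)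
    show "(\<Sum>r<length (x (epsdiff i j)). otens p (rho p (x (epsdiff i j) ! r)) (rho p (y (epsdiff i j) ! r)) (bas (k, l)))
      = (if (i, j) = (l, k) then ?G else 0)"
      unfolding Theta_root_term[OF assms(1) ij] by (cases "k = j \<and> l = i") (simp_all only: simp_thms if_True if_False prod.inject, auto)
  qed
  also have "(\<Sum>ij\<in>posroots. if ij = (l, k) then ?G else 0) = (if l < k then ?G else 0)"
    using assms(2,3) by (simp add: finite_posroots) (simp add: posroots_def)
  finally show ?thesis .
qed

end

section \<open>The R-matrices\<close>

lemma bil_eps:
  assumes "k \<in> {1..N}"
  shows "bil N p (eps k) (eps l) = (if k = l then (- 1) ^ p k else 0)"
proof -
  have "bil N p (eps k) (eps l) = (\<Sum>t = 1..N. if t = k then (if k = l then (- 1) ^ p k else 0) else 0)"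
    unfolding bil_def eps_def by (rule sum.cong) auto
  then show ?thesis using assms by simp
qed

text \<open>The diagonal terms of the two matrices merely replace the coefficient \<open>1\<close> of the identity by
$q^{\mp(-1)^{\bar k}}$.\<close>

lemma qh_diag:
  "1 + (qh (- 1) - qh 1) * ((- 1) ^ a * qh (- ((- 1) ^ a))) = qh (- 2 * (- 1) ^ a)"
  "1 + (qh 1 - qh (- 1)) * ((- 1) ^ a * qh ((- 1) ^ a)) = qh (2 * (- 1) ^ a)"
  by (cases "even a"; simp add: power_int_minus field_simps power2_eq_square)+

lemma lin_flip: "lin (flip p)" and lin_fhalf: "lin (fhalf N p)"
  unfolding flip_def fhalf_def by (rule lin_linext)+

lemma flip_single: "flip p (Poly_Mapping.single (k, l) c) = Poly_Mapping.single (l, k) (c * (- 1) ^ (p k * p l))"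
  by (simp add: flip_def)

lemma fhalf_single: "fhalf N p (Poly_Mapping.single (k, l) c)
    = Poly_Mapping.single (k, l) (c * qh (- bil N p (eps k) (eps l)))"
  by (simp add: fhalf_def)

lemma otens_munit:
  "otens p (munit i j) (munit j' i') (bas (k, l)) =
    (if k = j \<and> l = i' then Poly_Mapping.single (i, j') ((- 1) ^ ((p j' + p l) * p k)) else 0)"
  by (simp add: otens_bas munit_def koszul_def ptens_single ptens_zero linext_simps)

lemma lin_R0: "lin (R0 N p)" and lin_Rinf: "lin (Rinf N p)"
  unfolding R0_def[abs_def] Rinf_def[abs_def] split_def
  by (intro lin_plus lin_id lin_scalar lin_Sum lin_otens)+

lemma Rmat_sums:
  assumes "k \<in> {1..N}" "l \<in> {1..N}"
  shows "(\<Sum>i = 1..N. c i \<cdot> otens p (munit i i) (munit i i) (bas (k, l)))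
      = (if k = l then Poly_Mapping.single (k, k) (c k) else 0)"
    and "(\<Sum>(i, j) \<in> {(i, j). i \<in> {1..N} \<and> j \<in> {1..N} \<and> P i j}.
         (- 1) ^ p j \<cdot> otens p (munit i j) (munit j i) (bas (k, l)))
      = (if P l k then Poly_Mapping.single (l, k) ((- 1) ^ (p k * p l)) else 0)"
proof -
  have "(\<Sum>i = 1..N. c i \<cdot> otens p (munit i i) (munit i i) (bas (k, l)))
      = (\<Sum>i = 1..N. if i = k then (if k = l then Poly_Mapping.single (k, k) (c k) else 0) else 0)"
    by (rule sum.cong) (auto simp: otens_munit simp flip: mult_2)
  then show "(\<Sum>i = 1..N. c i \<cdot> otens p (munit i i) (munit i i) (bas (k, l)))
      = (if k = l then Poly_Mapping.single (k, k) (c k) else 0)"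
    using assms by simp
  let ?S = "{(i, j). i \<in> {1..N} \<and> j \<in> {1..N} \<and> P i j}"
  have fin: "finite ?S" by (rule finite_subset[of _ "{1..N} \<times> {1..N}"]) auto
  have sgn: "(- 1 :: K) ^ p a * (- 1) ^ ((p a + p b) * p a) = (- 1) ^ (p a * p b)" for a b
    by (cases "even (p a)"; cases "even (p b)") auto
  have "(\<Sum>(i, j) \<in> ?S. (- 1) ^ p j \<cdot> otens p (munit i j) (munit j i) (bas (k, l)))
      = (\<Sum>ij \<in> ?S. if ij = (l, k) then Poly_Mapping.single (l, k) ((- 1) ^ (p k * p l)) else 0)"
  proof (rule sum.cong[OF refl], clarify)
    fix i j
    have c: "((i, j) = (l, k)) = (k = j \<and> l = i)" by auto
    show "(- 1) ^ p j \<cdot> otens p (munit i j) (munit j i) (bas (k, l))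
      = (if (i, j) = (l, k) then Poly_Mapping.single (l, k) ((- 1) ^ (p k * p l)) else 0)"
      unfolding otens_munit c
    proof (cases "k = j \<and> l = i")
      case True
      then show "(- 1) ^ p j \<cdot> (if k = j \<and> l = i then Poly_Mapping.single (i, j) ((- 1) ^ ((p j + p l) * p k)) else 0)
        = (if k = j \<and> l = i then Poly_Mapping.single (l, k) ((- 1) ^ (p k * p l)) else 0)"
        by (simp add: sgn)
    qed (simp only: if_False scal_simps)
  qed
  also have "\<dots> = (if (l, k) \<in> ?S then Poly_Mapping.single (l, k) ((- 1) ^ (p k * p l)) else 0)"
    using fin by (simp only: sum.delta)
  finally show "(\<Sum>(i, j) \<in> ?S. (- 1) ^ p j \<cdot> otens p (munit i j) (munit j i) (bas (k, l)))
      = (if P l k then Poly_Mapping.single (l, k) ((- 1) ^ (p k * p l)) else 0)"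
    using assms by simp
qed

lemma flip_R0_bas:
  assumes "k \<in> {1..N}" "l \<in> {1..N}"
  shows "(flip p \<circ> R0 N p) (bas (k, l)) = (if k = l
    then Poly_Mapping.single (k, k) ((- 1) ^ p k * qh (- 2 * (- 1) ^ p k))
    else Poly_Mapping.single (l, k) ((- 1) ^ (p k * p l))
      + (if l < k then Poly_Mapping.single (k, l) (qh (- 2) - qh 2) else 0))"
proof -
  have R: "R0 N p (bas (k, l)) = bas (k, l)
     + (qh (- 1) - qh 1) \<cdot> (if k = l then Poly_Mapping.single (k, k) ((- 1) ^ p k * qh (- bil N p (eps k) (eps k))) else 0)
     + (qh (- 2) - qh 2) \<cdot> (if l < k then Poly_Mapping.single (l, k) ((- 1) ^ (p k * p l)) else 0)"
    unfolding R0_def Rmat_sums(1)[OF assms] Rmat_sums(2)[OF assms, where P = "(<)"] ..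
  show ?thesis
  proof (cases "k = l")
    case True
    have "R0 N p (bas (k, l)) = Poly_Mapping.single (k, k) (qh (- 2 * (- 1) ^ p k))"
      unfolding R bil_eps[OF assms(1)] qh_diag(1)[symmetric, of "p k"] single_add using True by simp
    then show ?thesis using True by (cases "even (p k)") (simp_all add: flip_single)
  next
    case False
    have "R0 N p (bas (k, l)) = bas (k, l)
       + (if l < k then Poly_Mapping.single (l, k) ((qh (- 2) - qh 2) * (- 1) ^ (p k * p l)) else 0)"
      unfolding R using False by (cases "l < k") simp_all
    moreover have "D * (- 1) ^ (p k * p l) * (- 1) ^ (p l * p k) = D" for D :: K
      by (cases "even (p k)"; cases "even (p l)") auto
    ultimately show ?thesis using False
      by (cases "l < k") (simp_all only: o_apply lin_add[OF lin_flip] lin_zero[OF lin_flip] flip_single if_True if_False simp_thms mult_1)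
  qed
qed

lemma flip_Rinf_bas:
  assumes "k \<in> {1..N}" "l \<in> {1..N}"
  shows "(flip p \<circ> Rinf N p) (bas (k, l)) = (if k = l
    then Poly_Mapping.single (k, k) ((- 1) ^ p k * qh (2 * (- 1) ^ p k))
    else Poly_Mapping.single (l, k) ((- 1) ^ (p k * p l))
      + (if k < l then Poly_Mapping.single (k, l) (qh 2 - qh (- 2)) else 0))"
proof -
  have R: "Rinf N p (bas (k, l)) = bas (k, l)
     + (qh 1 - qh (- 1)) \<cdot> (if k = l then Poly_Mapping.single (k, k) ((- 1) ^ p k * qh (bil N p (eps k) (eps k))) else 0)
     + (qh 2 - qh (- 2)) \<cdot> (if k < l then Poly_Mapping.single (l, k) ((- 1) ^ (p k * p l)) else 0)"
    unfolding Rinf_def Rmat_sums(1)[OF assms] Rmat_sums(2)[OF assms, where P = "\<lambda>i j. i > j"] ..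
  show ?thesis
  proof (cases "k = l")
    case True
    have "Rinf N p (bas (k, l)) = Poly_Mapping.single (k, k) (qh (2 * (- 1) ^ p k))"
      unfolding R bil_eps[OF assms(1)] qh_diag(2)[symmetric, of "p k"] single_add using True by simp
    then show ?thesis using True by (cases "even (p k)") (simp_all add: flip_single)
  next
    case False
    have "Rinf N p (bas (k, l)) = bas (k, l)
       + (if k < l then Poly_Mapping.single (l, k) ((qh 2 - qh (- 2)) * (- 1) ^ (p k * p l)) else 0)"
      unfolding R using False by (cases "k < l") simp_all
    moreover have "D * (- 1) ^ (p k * p l) * (- 1) ^ (p l * p k) = D" for D :: K
      by (cases "even (p k)"; cases "even (p l)") auto
    ultimately show ?thesis using False
      by (cases "k < l") (simp_all only: o_apply lin_add[OF lin_flip] lin_zero[OF lin_flip] flip_single if_True if_False simp_thms mult_1)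
  qed
qed

lemma (in pairing) Rhat_bas:
  assumes "dual_bases N p J x y" "k \<in> {1..N}" "l \<in> {1..N}"
  shows "Rhat N p x y (bas (k, l)) = (flip p \<circ> R0 N p) (bas (k, l))"
proof -
  let ?b = "\<lambda>k l. qh (- bil N p (eps k) (eps l))"
  have "Rhat N p x y (bas (k, l)) = flip p (fhalf N p (?b k l \<cdot> Theta N p x y (bas (k, l))))"
    unfolding Rhat_def o_apply fhalf_single lin_single[OF lin_Theta[OF assms(1)], of "(k, l)" "?b k l"] mult_1 ..
  also have "\<dots> = ?b k l \<cdot> (flip p (fhalf N p (bas (k, l))) + flip p (fhalf N p
    (if l < k then Poly_Mapping.single (l, k) ((- 1) ^ (p l * p k) * (qh (- 2) - qh 2)) else 0)))"
    unfolding Theta_bas[OF assms] lin_scal[OF lin_fhalf] lin_scal[OF lin_flip]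
      lin_add[OF lin_fhalf] lin_add[OF lin_flip] ..
  also have "\<dots> = (flip p \<circ> R0 N p) (bas (k, l))"
  proof (cases "k = l")
    case True
    have b: "?b k k * ?b k k = qh (- 2 * (- 1) ^ p k)"
      unfolding bil_eps[OF assms(2)] qh_simps(1)[symmetric] by simp
    have "(- 1 :: K) ^ (p k * p k) = (- 1) ^ p k" by (cases "even (p k)") auto
    then have "flip p (fhalf N p (bas (k, k))) = Poly_Mapping.single (k, k) (?b k k * (- 1) ^ p k)"
      unfolding fhalf_single flip_single by simp
    moreover have "?b k k * (?b k k * (- 1) ^ p k) = (- 1) ^ p k * qh (- 2 * (- 1) ^ p k)"
      unfolding b[symmetric] by (simp only: mult_ac)
    ultimately show ?thesis unfolding flip_R0_bas[OF assms(2,3)]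
      using True lin_zero[OF lin_fhalf, of N p] lin_zero[OF lin_flip, of p]
      by (simp only: simp_thms if_True if_False less_irrefl add_0_right map_single mult_zero_right)
  next
    case False
    then have b: "?b k l = 1" "?b l k = 1" using assms(2,3) by (simp_all add: bil_eps)
    have "(- 1) ^ (p l * p k) * D * (- 1) ^ (p l * p k) = D" for D :: K
      by (cases "even (p k)"; cases "even (p l)") auto
    then show ?thesis unfolding flip_R0_bas[OF assms(2,3)] using False
      by (cases "l < k") (simp_all only: simp_thms if_True if_False fhalf_single flip_single b scal_simps
        mult_1 mult_1_right lin_zero[OF lin_fhalf] lin_zero[OF lin_flip])
  qed
  finally show ?thesis .
qed

lemma VV_keys: "w \<in> VV N \<Longrightarrow> a \<in> Poly_Mapping.keys w \<Longrightarrow> \<exists>k l. a = (k, l) \<and> k \<in> {1..N} \<and> l \<in> {1..N}"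
  by (cases a) (auto simp: VV_def)

lemma VV_single: "k \<in> {1..N} \<Longrightarrow> l \<in> {1..N} \<Longrightarrow> Poly_Mapping.single (k, l) c \<in> VV N"
  by (simp add: VV_def)

lemma VV_add: "v \<in> VV N \<Longrightarrow> w \<in> VV N \<Longrightarrow> v + w \<in> VV N"
  unfolding VV_def using keys_add[of v w] by blast

lemma VV_lin:
  assumes "lin f" "\<And>k l. k \<in> {1..N} \<Longrightarrow> l \<in> {1..N} \<Longrightarrow> f (bas (k, l)) \<in> VV N" "w \<in> VV N"
  shows "f w \<in> VV N"
proof -
  have "f (linext bas w) = linext (\<lambda>a. f (bas a)) w"
    by (rule lin_eqI[of "\<lambda>w. f (linext bas w)" "linext (\<lambda>a. f (bas a))" w, OF lin_comp[OF assms(1) lin_linext] lin_linext]) simp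
  then have "f w = linext (\<lambda>a. f (bas a)) w" unfolding linext_expand .
  moreover have "Poly_Mapping.keys (f (bas a)) \<subseteq> {1..N} \<times> {1..N}" if "a \<in> Poly_Mapping.keys w" for a
    using VV_keys[OF assms(3) that] assms(2) by (auto simp: VV_def)
  then have "Poly_Mapping.keys (linext (\<lambda>a. f (bas a)) w) \<subseteq> {1..N} \<times> {1..N}"
    by (intro order.trans[OF keys_linext] UN_least)
  ultimately show ?thesis unfolding VV_def by simp
qed

lemma lin_flip_R: "lin (flip p \<circ> R0 N p)" "lin (flip p \<circ> Rinf N p)"
  unfolding comp_def by (rule lin_comp[OF lin_flip lin_R0], rule lin_comp[OF lin_flip lin_Rinf])

lemma flip_R_VV:
  assumes "w \<in> VV N" shows "(flip p \<circ> R0 N p) w \<in> VV N" "(flip p \<circ> Rinf N p) w \<in> VV N"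
proof -
  have z: "0 \<in> VV N" by (simp add: VV_def)
  note lin = lin_flip_R
  show "(flip p \<circ> R0 N p) w \<in> VV N"
    by (rule VV_lin[OF lin(1) _ assms]) (simp only: flip_R0_bas VV_single VV_add z simp_thms split: if_split)
  show "(flip p \<circ> Rinf N p) w \<in> VV N"
    by (rule VV_lin[OF lin(2) _ assms]) (simp only: flip_Rinf_bas VV_single VV_add z simp_thms split: if_split)
qed

text \<open>Both composites preserve the span of $v_k \otimes v_l$ and $v_l \otimes v_k$. Both maps
exchange these vectors up to the same sign. For $k < l$ the first map has the additional term
$q^{-1} - q$ on $v_l \otimes v_k$ and the second one $q - q^{-1}$ on $v_k \otimes v_l$; in the
composites these cancel.\<close>

lemma flip_R_inverse:
  assumes "w \<in> VV N"
  shows "(flip p \<circ> R0 N p) ((flip p \<circ> Rinf N p) w) = w" "(flip p \<circ> Rinf N p) ((flip p \<circ> R0 N p) w) = w"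
proof -
  let ?A = "flip p \<circ> R0 N p" and ?C = "flip p \<circ> Rinf N p"
  note lin = lin_flip_R[of p N]
  have bas: "?A (?C (bas (k, l))) = bas (k, l)" "?C (?A (bas (k, l))) = bas (k, l)"
    if kl: "k \<in> {1..N}" "l \<in> {1..N}" for k l
  proof -
    define D where "D = qh (- 2) - qh 2"
    then have D': "qh 2 - qh (- 2) = - D" by simp
    let ?s = "\<lambda>k l. (- 1 :: K) ^ (p k * p l)"
    have A: "?A (Poly_Mapping.single (k, l) c) = c \<cdot> (if k = l
        then Poly_Mapping.single (k, k) ((- 1) ^ p k * qh (- 2 * (- 1) ^ p k))
        else Poly_Mapping.single (l, k) (?s k l) + (if l < k then Poly_Mapping.single (k, l) D else 0))"
      if "k \<in> {1..N}" "l \<in> {1..N}" for k l c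
      by (subst lin_single[OF lin(1)]) (simp only: flip_R0_bas[OF that] D_def)
    have C: "?C (Poly_Mapping.single (k, l) c) = c \<cdot> (if k = l
        then Poly_Mapping.single (k, k) ((- 1) ^ p k * qh (2 * (- 1) ^ p k))
        else Poly_Mapping.single (l, k) (?s k l) + (if k < l then Poly_Mapping.single (k, l) (- D) else 0))"
      if "k \<in> {1..N}" "l \<in> {1..N}" for k l c
      by (subst lin_single[OF lin(2)]) (simp only: flip_Rinf_bas[OF that] D')
    have ss: "?s l k = ?s k l" "?s k l * ?s k l = 1" "?s k l * (?s k l * c) = c" for c
      by (cases "even (p k)"; cases "even (p l)"; simp)+
    note simps = lin_add[OF lin(1)] lin_add[OF lin(2)] lin_zero[OF lin(1)] lin_zero[OF lin(2)]
      A[OF kl] A[OF kl(2,1)] C[OF kl] C[OF kl(2,1)] ss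
      scal_add scal_simps map_single mult_zero_right if_True if_False simp_thms mult_1 add_0_right
    have d: "(1 * ((- 1) ^ p k * a)) * ((- 1) ^ p k * b) = (1 :: K)" if "a * b = 1" for a b :: K
      using that by (cases "even (p k)") simp_all
    have qq: "qh (2 * (- 1) ^ p k) * qh (- 2 * (- 1) ^ p k) = 1"
      by (simp flip: qh_simps(1))
    then have qq': "qh (- 2 * (- 1) ^ p k) * qh (2 * (- 1) ^ p k) = 1" by (simp only: mult.commute)
    consider "k = l" | "k < l" | "l < k" by linarith
    then have "?A (?C (bas (k, l))) = bas (k, l) \<and> ?C (?A (bas (k, l))) = bas (k, l)"
    proof cases
      case 1
      show ?thesis unfolding 1[symmetric]
        by (simp only: A[OF kl(1,1)] C[OF kl(1,1)] simp_thms if_True map_single mult_zero_right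
            d[OF qq] d[OF qq'])
    next
      case 2
      then have "(k = l) = False" "(l = k) = False" "(l < k) = False" "(k < l) = True" by auto
      note simps = simps this
      show ?thesis by (simp only: simps) (simp add: mult.commute[of D] flip: single_add)
    next
      case 3
      then have "(k = l) = False" "(l = k) = False" "(l < k) = True" "(k < l) = False" by auto
      note simps = simps this
      show ?thesis by (simp only: simps) (simp add: mult.commute[of D] flip: single_add)
    qed
    then show "?A (?C (bas (k, l))) = bas (k, l)" "?C (?A (bas (k, l))) = bas (k, l)" by simp_all
  qed
  show "?A (?C w) = w"
    by (rule lin_eqI[of "\<lambda>w. ?A (?C w)" "\<lambda>w. w" w, OF lin_comp[OF lin] lin_id])
      (use VV_keys[OF assms] bas in blast)
  show "?C (?A w) = w"
    by (rule lin_eqI[of "\<lambda>w. ?C (?A w)" "\<lambda>w. w" w, OF lin_comp[OF lin(2,1)] lin_id])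
      (use VV_keys[OF assms] bas in blast)
qed

theorem theoremA3:
  fixes m n N :: nat
    and p :: "nat \<Rightarrow> nat"
    and J :: "falg set \<Rightarrow> falg set \<Rightarrow> L"
    and x y :: "weight \<Rightarrow> falg set list"
  assumes "N = m + n" and "N > 2"
    and "\<forall>i\<in>{1..N}. p i \<in> {0, 1}"
    and "card {i \<in> {1..N}. p i = 0} = m" and "card {i \<in> {1..N}. p i = 1} = n"
    and "bialgebra_pairing N p J"
    and "dual_bases N p J x y"
  shows "(\<forall>w\<in>VV N. Rhat N p x y w = (flip p \<circ> R0 N p) w) \<and>
    bij_betw (Rhat N p x y) (VV N) (VV N) \<and>
    (\<forall>w\<in>VV N. inv_into (VV N) (Rhat N p x y) w = (flip p \<circ> Rinf N p) w)"
proof -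
  interpret pairing N p J by unfold_locales (rule assms(6))
  let ?A = "flip p \<circ> R0 N p" and ?C = "flip p \<circ> Rinf N p" and ?R = "Rhat N p x y"
  have "lin ?R"
    unfolding Rhat_def comp_def
    by (rule lin_comp[OF lin_flip lin_comp[OF lin_fhalf lin_comp[OF lin_Theta[OF assms(7)] lin_fhalf]]])
  note lin = this lin_flip_R(1)[of p N]
  have R: "?R w = ?A w" if "w \<in> VV N" for w
    by (rule lin_eqI[of ?R ?A w, OF lin]) (use VV_keys[OF that] Rhat_bas[OF assms(7)] in blast)
  have bij: "bij_betw ?R (VV N) (VV N)"
  proof (rule bij_betw_byWitness[where f' = ?C])
    show "\<forall>w\<in>VV N. ?C (?R w) = w" using R flip_R_inverse(2) by simp
    show "\<forall>w\<in>VV N. ?R (?C w) = w" using R flip_R_inverse(1) flip_R_VV(2) by simp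
    show "?R ` VV N \<subseteq> VV N" "?C ` VV N \<subseteq> VV N" using R flip_R_VV by auto
  qed
  moreover have "inv_into (VV N) ?R w = ?C w" if "w \<in> VV N" for w
  proof (rule inv_into_f_eq)
    show "inj_on ?R (VV N)" using bij by (rule bij_betw_imp_inj_on)
    show "?C w \<in> VV N" by (rule flip_R_VV(2)[OF that])
    show "?R (?C w) = w" unfolding R[OF flip_R_VV(2)[OF that]] by (rule flip_R_inverse(1)[OF that])
  qed
  ultimately show ?thesis using R by blast
qed

end
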